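(* Let $\mathcal X:y^n=f(x)$ be a superelliptic curve over $\mathbb F_q$ as in the context, and let $s\ge1$ satisfy $t(s)\ge0$. Then $K-G_s\wedge A_s$ is linearly equivalent to the effective divisor $\frac{t(s)}{c}D_\infty$, and its class lies in the cyclic subgroup of $\operatorname{Pic}(\mathcal X)$ generated by $[D_\infty]$, where it is determined by $(n,d,q,\delta)$ and $s$ alone. In particular, on every such curve and at every such $s$, whatever the value of $\varepsilon(G_s,A_s)$, the divisor $K-G_s\wedge A_s$ is linearly equivalent over $\mathbb F_q$ to an effective divisor of degree $t(s)$; and when $t(s)=0$ one has $G_s\vee A_s\sim D$ on every such curve.
   Context: Setting. $q$ is a power of a prime $p$; $n\ge2$, $d\ge3$ are integers with $n\mid q-1$ (so $p\nmid n$); $c=\gcd(n,d)$; $f\in\mathbb F_q[x]$ is separable of degree $d$ with no root in $\mathbb F_q$. $\mathcal X$ is the smooth projective model of $y^n=f(x)$ over $\mathbb F_q$, of genus $g_{\mathcal X}=\frac{(n-1)(d-1)+1-c}{2}$, and $\pi:\mathcal X\to\mathbb P^1$, $(x,y)\mapsto x$. $\mathrm{Ram}$ is the reduced divisor of the $d$ geometric points over the roots of $f$, $D_\infty$ the reduced divisor of the $c$ geometric points over $x=\infty$. $D$ is the sum of all $\mathbb F_q$-rational points of $\mathcal X$ over $\mathbb A^1(\mathbb F_q)$, and $E=\sum_{a\in\mathbb F_q}\pi^*(a)-D$ (effective). $\delta=\#\{a\in\mathbb F_q:f(a)\notin(\mathbb F_q^* )^n\}$. $M=\frac{(q-1)n}{c}-1$,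 $\mu(s)=\min\{s,M-s\}$, $t(s)=2g_{\mathcal X}-2-c\,\mu(s)+n\delta$ (a multiple of $c$). $G_s=sD_\infty$, $K=\operatorname{div}(-dx/(x^q-x))$, $A_s=D-G_s+K=(n-1)\mathrm{Ram}-E+(M-s)D_\infty$. $\wedge,\vee$ denote the coefficientwise minimum and maximum of divisors, $\sim$ linear equivalence over $\mathbb F_q$. The excess is $\varepsilon(G,A)=\dim_{\mathbb F_q}\frac{(L(G)+L(A))\cap L(G\vee A-D)}{L(G-D)+L(A-D)}$, where $L(\cdot)$ is the Riemann-Roch space. *)

theory Defs
  imports
    "HOL-Computational_Algebra.Computational_Algebra"
    "HOL-Library.Function_Algebras"
    "HOL-Algebra.Coset"
    "HOL-Algebra.Generated_Groups"
begin

text \<open>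
  The smooth projective model of a plane curve over a field \<open>k\<close> is represented by its function
  field \<open>F\<close>, an extension of \<open>k\<close> given by an embedding \<open>\<iota>\<close>. Its closed points are the places of
  \<open>F/k\<close>; a divisor over \<open>k\<close> is a finitely supported integer-valued function on the places.
\<close>

definition field_embedding :: "('k::field \<Rightarrow> 'f::field) \<Rightarrow> bool" where
  "field_embedding \<iota> \<longleftrightarrow>
     \<iota> 1 = 1 \<and> (\<forall>a b. \<iota> (a + b) = \<iota> a + \<iota> b) \<and> (\<forall>a b. \<iota> (a * b) = \<iota> a * \<iota> b)"

definition poly_at :: "('k::field \<Rightarrow> 'f::field) \<Rightarrow> 'k poly \<Rightarrow> 'f \<Rightarrow> 'f" where
  "poly_at \<iota> p x = poly (map_poly \<iota> p) x"

definition poly2_at :: "('k::field \<Rightarrow> 'f::field) \<Rightarrow> 'k poly poly \<Rightarrow> 'f \<Rightarrow> 'f \<Rightarrow> 'f" where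
  "poly2_at \<iota> p x y = poly (map_poly (\<lambda>g. poly_at \<iota> g x) p) y"

text \<open>
  \<open>F = k(x, y)\<close> with \<open>x\<close> transcendental over \<open>k\<close> and \<open>y ^ n = f(x)\<close>. When \<open>f\<close> is separable and
  nonconstant, \<open>T ^ n - f(x)\<close> is irreducible over \<open>k(x)\<close>, so these conditions determine
  \<open>(F, x, y)\<close> up to isomorphism over \<open>k\<close>.
\<close>

definition superelliptic_function_field ::
  "('k::field \<Rightarrow> 'f::field) \<Rightarrow> 'f \<Rightarrow> 'f \<Rightarrow> nat \<Rightarrow> 'k poly \<Rightarrow> bool" where
  "superelliptic_function_field \<iota> x y n f \<longleftrightarrow>
     field_embedding \<iota> \<and>
     (\<forall>p. p \<noteq> 0 \<longrightarrow> poly_at \<iota> p x \<noteq> 0) \<and>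
     y ^ n = poly_at \<iota> f x \<and>
     (\<forall>z. \<exists>p r. poly2_at \<iota> r x y \<noteq> 0 \<and> z = poly2_at \<iota> p x y / poly2_at \<iota> r x y)"

subsection \<open>Places and divisors\<close>

text \<open>
  A place is a normalised discrete valuation of \<open>F\<close>, trivial on \<open>k\<close>. The value at \<open>0\<close>
  (mathematically \<open>\<infinity>\<close>) is the dummy \<open>0\<close>, so that distinct functions are distinct places.
\<close>

type_synonym 'f place = "'f \<Rightarrow> int"
type_synonym 'f divisor = "'f place \<Rightarrow> int"

definition is_place :: "('k::field \<Rightarrow> 'f::field) \<Rightarrow> 'f place \<Rightarrow> bool" where
  "is_place \<iota> P \<longleftrightarrow>
     P 0 = 0 \<and>
     (\<forall>u v. u \<noteq> 0 \<longrightarrow> v \<noteq> 0 \<longrightarrow> P (u * v) = P u + P v) \<and>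
     (\<forall>u v. u \<noteq> 0 \<longrightarrow> v \<noteq> 0 \<longrightarrow> u + v \<noteq> 0 \<longrightarrow> min (P u) (P v) \<le> P (u + v)) \<and>
     (\<forall>a. a \<noteq> 0 \<longrightarrow> P (\<iota> a) = 0) \<and>
     (\<exists>t. P t = 1)"

text \<open>Sums, differences and (by \<open>inf\<close>, \<open>sup\<close>) coefficientwise minima and maxima of divisors are
  the pointwise operations on functions.\<close>

definition is_divisor :: "('k::field \<Rightarrow> 'f::field) \<Rightarrow> 'f divisor \<Rightarrow> bool" where
  "is_divisor \<iota> A \<longleftrightarrow> finite {P. A P \<noteq> 0} \<and> (\<forall>P. A P \<noteq> 0 \<longrightarrow> is_place \<iota> P)"

definition is_effective :: "('k::field \<Rightarrow> 'f::field) \<Rightarrow> 'f divisor \<Rightarrow> bool" where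
  "is_effective \<iota> A \<longleftrightarrow> is_divisor \<iota> A \<and> (\<forall>P. 0 \<le> A P)"

definition div_scale :: "int \<Rightarrow> 'f divisor \<Rightarrow> 'f divisor" where
  "div_scale m A = (\<lambda>P. m * A P)"

definition div_fun :: "('k::field \<Rightarrow> 'f::field) \<Rightarrow> 'f \<Rightarrow> 'f divisor" where
  "div_fun \<iota> h = (\<lambda>P. if is_place \<iota> P then P h else 0)"

definition lin_equiv :: "('k::field \<Rightarrow> 'f::field) \<Rightarrow> 'f divisor \<Rightarrow> 'f divisor \<Rightarrow> bool" where
  "lin_equiv \<iota> A B \<longleftrightarrow> (\<exists>h. h \<noteq> 0 \<and> A - B = div_fun \<iota> h)"

definition divisor_group :: "('k::field \<Rightarrow> 'f::field) \<Rightarrow> 'f divisor monoid" where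
  "divisor_group \<iota> = \<lparr>carrier = {A. is_divisor \<iota> A}, mult = (+), one = 0\<rparr>"

definition principal_divisors :: "('k::field \<Rightarrow> 'f::field) \<Rightarrow> 'f divisor set" where
  "principal_divisors \<iota> = {div_fun \<iota> h | h. h \<noteq> 0}"

definition Pic :: "('k::field \<Rightarrow> 'f::field) \<Rightarrow> 'f divisor set monoid" where
  "Pic \<iota> = divisor_group \<iota> Mod principal_divisors \<iota>"

definition divisor_class :: "('k::field \<Rightarrow> 'f::field) \<Rightarrow> 'f divisor \<Rightarrow> 'f divisor set" where
  "divisor_class \<iota> A = principal_divisors \<iota> #>\<^bsub>divisor_group \<iota>\<^esub> A"

subsection \<open>Dimensions, degrees and Riemann-Roch spaces\<close>

text \<open>The dimension over \<open>k\<close> of \<open>U / V\<close>, for \<open>k\<close>-subspaces \<open>V \<subseteq> U\<close> of \<open>F\<close> with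
  finite-dimensional quotient: the size of a family in \<open>U\<close> whose classes are a basis of \<open>U / V\<close>.\<close>

definition quotient_dim :: "('k::field \<Rightarrow> 'f::field) \<Rightarrow> 'f set \<Rightarrow> 'f set \<Rightarrow> nat" where
  "quotient_dim \<iota> U V = (let scale = (\<lambda>a z. \<iota> a * z) in
     THE m. \<exists>B. finite B \<and> card B = m \<and> \<not> module.dependent scale B \<and>
       module.span scale B \<inter> V = {0} \<and>
       {b + v | b v. b \<in> module.span scale B \<and> v \<in> V} = U)"

text \<open>The degree of \<open>P\<close> is the dimension of its residue field, the valuation ring modulo its
  maximal ideal.\<close>

definition place_degree :: "('k::field \<Rightarrow> 'f::field) \<Rightarrow> 'f place \<Rightarrow> nat" where
  "place_degree \<iota> P = quotient_dim \<iota> {z. z = 0 \<or> 0 \<le> P z} {z. z = 0 \<or> 1 \<le> P z}"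

definition divisor_degree :: "('k::field \<Rightarrow> 'f::field) \<Rightarrow> 'f divisor \<Rightarrow> int" where
  "divisor_degree \<iota> A = (\<Sum>P | A P \<noteq> 0. A P * int (place_degree \<iota> P))"

definition riemann_roch_space :: "('k::field \<Rightarrow> 'f::field) \<Rightarrow> 'f divisor \<Rightarrow> 'f set" where
  "riemann_roch_space \<iota> A = {h. h = 0 \<or> (\<forall>P. is_place \<iota> P \<longrightarrow> 0 \<le> P h + A P)}"

definition excess ::
  "('k::field \<Rightarrow> 'f::field) \<Rightarrow> 'f divisor \<Rightarrow> 'f divisor \<Rightarrow> 'f divisor \<Rightarrow> nat" where
  "excess \<iota> D G A = (let L = riemann_roch_space \<iota> in
     quotient_dim \<iota>
       ({u + v | u v. u \<in> L G \<and> v \<in> L A} \<inter> L (sup G A - D))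
       {u + v | u v. u \<in> L (G - D) \<and> v \<in> L (A - D)})"

subsection \<open>Differentials\<close>

definition is_derivation :: "('k::field \<Rightarrow> 'f::field) \<Rightarrow> ('f \<Rightarrow> 'f) \<Rightarrow> bool" where
  "is_derivation \<iota> \<theta> \<longleftrightarrow>
     (\<forall>a. \<theta> (\<iota> a) = 0) \<and>
     (\<forall>u v. \<theta> (u + v) = \<theta> u + \<theta> v) \<and>
     (\<forall>u v. \<theta> (u * v) = u * \<theta> v + v * \<theta> u)"

text \<open>The order at \<open>P\<close> of a nonzero differential \<open>h dg\<close>: for a uniformiser \<open>t\<close> at \<open>P\<close> one has
  \<open>h dg = h (dg/dt) dt\<close>, where \<open>d/dt\<close> is the derivation of \<open>F/k\<close> with \<open>dt/dt = 1\<close>. Over a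
  perfect field \<open>k\<close>, every uniformiser \<open>t\<close> is a separating element, so \<open>d/dt\<close> exists and is
  unique, and the order does not depend on \<open>t\<close>.\<close>

definition differential_order :: "('k::field \<Rightarrow> 'f::field) \<Rightarrow> 'f place \<Rightarrow> 'f \<Rightarrow> 'f \<Rightarrow> int" where
  "differential_order \<iota> P h g =
     (THE m. \<exists>t \<theta>. P t = 1 \<and> is_derivation \<iota> \<theta> \<and> \<theta> t = 1 \<and> m = P (h * \<theta> g))"

definition div_differential :: "('k::field \<Rightarrow> 'f::field) \<Rightarrow> 'f \<Rightarrow> 'f \<Rightarrow> 'f divisor" where
  "div_differential \<iota> h g = (\<lambda>P. if is_place \<iota> P then differential_order \<iota> P h g else 0)"

subsection \<open>Divisors and invariants of a superelliptic curve\<close>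

text \<open>A reduced divisor of geometric points that is stable under Galois is, over \<open>k\<close>, the sum
  with coefficients \<open>1\<close> of the closed points carrying them (\<open>k\<close> is perfect).\<close>

definition div_infinity :: "('k::field \<Rightarrow> 'f::field) \<Rightarrow> 'f \<Rightarrow> 'f divisor" where
  "div_infinity \<iota> x = (\<lambda>P. if is_place \<iota> P \<and> P x < 0 then 1 else 0)"

definition div_affine_rational :: "('k::field \<Rightarrow> 'f::field) \<Rightarrow> 'f \<Rightarrow> 'f divisor" where
  "div_affine_rational \<iota> x =
     (\<lambda>P. if is_place \<iota> P \<and> place_degree \<iota> P = 1 \<and> (\<exists>a. 0 < P (x - \<iota> a)) then 1 else 0)"

definition non_power_count :: "nat \<Rightarrow> 'k::{finite,field} poly \<Rightarrow> nat" where
  "non_power_count n f = card {a. poly f a \<notin> {b ^ n | b. b \<noteq> 0}}"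

definition superelliptic_genus :: "nat \<Rightarrow> nat \<Rightarrow> int" where
  "superelliptic_genus n d = ((int n - 1) * (int d - 1) + 1 - int (gcd n d)) div 2"

definition superelliptic_M :: "nat \<Rightarrow> nat \<Rightarrow> nat \<Rightarrow> int" where
  "superelliptic_M n d q = (int q - 1) * int n div int (gcd n d) - 1"

definition superelliptic_mu :: "nat \<Rightarrow> nat \<Rightarrow> nat \<Rightarrow> int \<Rightarrow> int" where
  "superelliptic_mu n d q s = min s (superelliptic_M n d q - s)"

definition superelliptic_t :: "nat \<Rightarrow> nat \<Rightarrow> nat \<Rightarrow> nat \<Rightarrow> int \<Rightarrow> int" where
  "superelliptic_t n d q \<delta> s =
     2 * superelliptic_genus n d - 2 - int (gcd n d) * superelliptic_mu n d q s + int n * int \<delta>"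

end

theory Submission
  imports Defs "HOL-Algebra.Algebraic_Closure_Type"
begin

text \<open>
  The divisor \<open>K - G \<and> A\<close> is computed place by place. Let \<open>c = gcd(n, d)\<close>, \<open>u = n / c\<close> and
  \<open>v = d / c\<close>.

  \<^item> At a place over a root of \<open>f\<close> the extension is totally ramified and \<open>y\<close> is a uniformiser;
    \<open>K\<close> has coefficient \<open>n - 1\<close> and \<open>G\<close>, \<open>D\<close> vanish, so the difference is \<open>n - 1\<close>.
  \<^item> At a place over \<open>x = a\<close> with \<open>a\<close> in \<open>k\<close>, \<open>K\<close> has coefficient \<open>- 1\<close> and the difference is
    \<open>- D\<close>. The \<open>n\<close>-th roots of unity lie in \<open>k\<close>, so all places over \<open>a\<close> are rational if \<open>f(a)\<close>
    is an \<open>n\<close>-th power, and none is otherwise.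
  \<^item> At the remaining finite places all the divisors vanish.
  \<^item> At infinity \<open>x\<close> and \<open>y\<close> have orders \<open>- u\<close> and \<open>- v\<close>, \<open>K\<close> has coefficient \<open>M\<close>, and the
    difference is \<open>M - \<mu>(s)\<close>.

  Away from infinity this is the divisor of \<open>H = y ^ (n - 1) / (\<Prod> (x - a))\<close>, the product taken over
  the \<open>a\<close> for which \<open>f(a)\<close> is an \<open>n\<close>-th power. The difference therefore equals the divisor of
  \<open>H\<close> plus a constant multiple of \<open>D\<^sub>\<infinity>\<close>, and counting shows that the multiple is \<open>t(s) / c\<close>
  (lemmas \<open>difference_principal\<close> and \<open>t_eq\<close>). Everything else follows from this linear equivalence, from
  \<open>G \<or> A - D = K - G \<and> A\<close>, and from \<open>deg D\<^sub>\<infinity> = c\<close>.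

  A place is only given as a valuation of \<open>F\<close>, so the local structure of the curve has to be found
  inside \<open>F\<close>. Three devices, all based on the Frobenius map, replace the geometry.

  Uniformisers and residue fields: let \<open>R\<close> be a subring with fraction field \<open>F\<close>, and \<open>t\<close> an element
  of \<open>R\<close> such that \<open>g ^ Q - g\<close> is divisible by \<open>t\<close> for all \<open>g\<close> in \<open>R\<close>. If \<open>P\<close> is a place
  that is nonnegative on \<open>R\<close> and positive at \<open>t\<close>, then an element \<open>g\<close> with \<open>P g > 0\<close> becomes
  divisible by \<open>t\<close> after multiplication with the unit \<open>1 - g ^ (Q - 1)\<close>. Hence \<open>t\<close> is a
  uniformiser, \<open>R\<close> covers the residue field, and \<open>P\<close> is determined by the elements of \<open>R\<close> that vanish
  at it. Such charts exist over the roots of \<open>f\<close>, over the other irreducible polynomials in \<open>x\<close>,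
  and at infinity.

  Differentials: \<open>F\<close> is generated by \<open>x\<close> over its subfield of \<open>q\<close>-th powers. By comparing orders
  modulo \<open>q\<close>, the powers \<open>t ^ i\<close> with \<open>i < q\<close> of any uniformiser form a basis over that subfield, so
  that \<open>d/dt\<close> is formal differentiation, preserves the valuation ring, and lowers by one every
  positive order prime to the characteristic.

  Existence of the places at infinity: comparing a relation between the powers of \<open>y\<close> with its
  \<open>q\<close>-th power shows that \<open>1, y, \<dots>, y ^ (n - 1)\<close> are independent over \<open>k(x)\<close>. Hence every point
  \<open>(x', y')\<close> of the curve over a Laurent series field, with \<open>x'\<close> transcendental, gives an embedding of
  \<open>F\<close>. The points with \<open>x' = T ^ (- u)\<close> yield one place for each irreducible factor of
  \<open>X ^ c - l\<close>, where \<open>l\<close> is the leading coefficient of \<open>f\<close>, and its degree is that of the factor.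
\<close>

hide_const (open) Module.smult UnivPoly.monom UnivPoly.coeff Polynomials.degree Polynomials.lead_coeff
  Divisibility.irreducible Divisibility.prime

section \<open>Evaluation of polynomials along a ring homomorphism\<close>

locale eval_hom =
  fixes \<phi> :: "'a::comm_ring_1 \<Rightarrow> 'b::comm_ring_1"
  assumes hom_1 [simp]: "\<phi> 1 = 1"
    and hom_add [simp]: "\<phi> (a + b) = \<phi> a + \<phi> b"
    and hom_mult [simp]: "\<phi> (a * b) = \<phi> a * \<phi> b"
begin

lemma hom_0 [simp]: "\<phi> 0 = 0"
  using hom_add[of 0 0] by simp

lemma hom_minus [simp]: "\<phi> (- a) = - \<phi> a"
  using hom_add[of a "- a"] by (simp add: eq_neg_iff_add_eq_0 add.commute)

lemma hom_diff [simp]: "\<phi> (a - b) = \<phi> a - \<phi> b"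
  using hom_add[of a "- b"] by simp

lemma hom_power [simp]: "\<phi> (a ^ m) = \<phi> a ^ m"
  by (induction m) auto

lemma hom_of_nat [simp]: "\<phi> (of_nat m) = of_nat m"
  by (induction m) auto

definition ev :: "'a poly \<Rightarrow> 'b \<Rightarrow> 'b" where
  "ev p z = poly (map_poly \<phi> p) z"

lemma ev_0 [simp]: "ev 0 z = 0"
  by (simp add: ev_def)

lemma ev_pCons [simp]: "ev (pCons a p) z = \<phi> a + z * ev p z"
  by (simp add: ev_def map_poly_pCons)

lemma ev_1 [simp]: "ev 1 z = 1"
  by (simp add: ev_def)

lemma ev_add [simp]: "ev (p + r) z = ev p z + ev r z"
  by (induction p r rule: poly_induct2) (auto simp: algebra_simps)

lemma ev_smult [simp]: "ev (smult a p) z = \<phi> a * ev p z"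
  by (induction p) (auto simp: algebra_simps)

lemma ev_mult [simp]: "ev (p * r) z = ev p z * ev r z"
  by (induction p) (auto simp: algebra_simps)

lemma ev_minus [simp]: "ev (- p) z = - ev p z"
  using ev_smult[of "- 1" p z] by simp

lemma ev_diff [simp]: "ev (p - r) z = ev p z - ev r z"
  using ev_add[of p "- r" z] by simp

lemma ev_power [simp]: "ev (p ^ m) z = ev p z ^ m"
  by (induction m) auto

lemma ev_monom [simp]: "ev (monom a m) z = \<phi> a * z ^ m"
  by (induction m) (auto simp: monom_Suc monom_0 algebra_simps)

lemma ev_sum [simp]: "ev (\<Sum>i\<in>I. g i) z = (\<Sum>i\<in>I. ev (g i) z)"
  by (induction I rule: infinite_finite_induct) auto

lemma ev_dvd: "p dvd r \<Longrightarrow> ev p z dvd ev r z"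
  by (auto simp: dvd_def)

lemma ev_eq_sum:
  assumes "degree p < m"
  shows "ev p z = (\<Sum>i<m. \<phi> (coeff p i) * z ^ i)"
proof -
  have "p = (\<Sum>i<m. monom (coeff p i) i)"
    by (rule poly_eqI) (use assms in \<open>auto simp: coeff_sum coeff_monom if_distrib sum.delta coeff_eq_0 cong: if_cong\<close>)
  then have "ev p z = ev (\<Sum>i<m. monom (coeff p i) i) z" by simp
  then show ?thesis by simp
qed

end

locale field_ext =
  fixes \<iota> :: "'k::field \<Rightarrow> 'f::field"
  assumes emb: "field_embedding \<iota>"
begin

sublocale eval_hom \<iota>
  using emb by unfold_locales (auto simp: field_embedding_def)

lemma emb_eq_0_iff [simp]: "\<iota> a = 0 \<longleftrightarrow> a = 0"
proof
  assume "\<iota> a = 0"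
  then have "\<iota> (a * inverse a) = 0" by (simp only: hom_mult) simp
  then show "a = 0" by (cases "a = 0") auto
qed auto

lemma emb_eq_iff [simp]: "\<iota> a = \<iota> b \<longleftrightarrow> a = b"
  using emb_eq_0_iff[of "a - b"] by (simp del: emb_eq_0_iff)

lemma inj_emb: "inj \<iota>"
  by (simp add: inj_def)

lemma hom_inverse [simp]: "\<iota> (inverse a) = inverse (\<iota> a)"
proof (cases "a = 0")
  case False
  then have "\<iota> (inverse a) * \<iota> a = 1" by (simp flip: hom_mult)
  then show ?thesis using False by (simp add: field_simps)
qed auto

lemma hom_divide [simp]: "\<iota> (a / b) = \<iota> a / \<iota> b"
  by (simp add: divide_inverse)

lemma poly_at_eq: "poly_at \<iota> = ev"
  by (intro ext) (simp add: poly_at_def ev_def)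

sublocale two: eval_hom "\<lambda>g. ev g z" for z
  by unfold_locales auto

lemma poly2_at_eq: "poly2_at \<iota> p x y = two.ev x p y"
  by (simp add: poly2_at_def two.ev_def poly_at_eq)

end

section \<open>Finite fields\<close>

lemma finite_field_power_card:
  fixes a :: "'k::{finite,field}"
  shows "a ^ card (UNIV :: 'k set) = a"
proof (cases "a = 0")
  case True
  then show ?thesis by (simp add: finite_UNIV_card_ge_0)
next
  case False
  let ?U = "UNIV - {0 :: 'k}"
  have "bij_betw ((*) a) ?U ?U"
    by (rule bij_betw_byWitness[where f' = "\<lambda>b. b / a"]) (use False in auto)
  then have "(\<Prod>b\<in>?U. a * b) = \<Prod>?U"
    by (rule prod.reindex_bij_betw)
  then have "a ^ card ?U * \<Prod>?U = \<Prod>?U" by (simp add: prod.distrib)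
  moreover have "\<Prod>?U \<noteq> 0" by simp
  ultimately have "a ^ card ?U = 1" by simp
  moreover have "card (UNIV :: 'k set) = Suc (card ?U)"
    by (rule card.remove) auto
  ultimately show ?thesis by (metis power_Suc mult_1_right)
qed

lemma card_field_ge_2: "card (UNIV :: 'k::{finite,field} set) \<ge> 2"
  using card_mono[of UNIV "{0, 1 :: 'k}"] by simp

lemma of_nat_card_field: "of_nat (card (UNIV :: 'k::{finite,field} set)) = (0 :: 'k)"
proof -
  have "(\<Sum>b\<in>UNIV. b + 1) = (\<Sum>b\<in>UNIV. b :: 'k)"
    by (rule sum.reindex_bij_betw) (rule bij_betw_byWitness[where f' = "\<lambda>b. b - 1"], auto)
  then show ?thesis by (simp add: sum.distrib)
qed

lemma degree_frobenius_defect: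
  fixes v :: "'a::idom"
  assumes "q > 0"
  shows "degree ([:v, 1:] ^ q - monom 1 q - [:v ^ q:]) < q"
proof -
  let ?G = "[:v, 1:] ^ q - monom 1 q"
  have "degree ?G < q"
  proof (rule degree_lessI)
    show "\<forall>k\<ge>q. coeff ?G k = 0"
    proof (intro allI impI)
      fix k assume "k \<ge> q"
      show "coeff ?G k = 0"
      proof (cases "k = q")
        case True
        have "coeff ([:v, 1:] ^ q) (degree ([:v, 1:] ^ q)) = 1"
          by (simp add: lead_coeff_power)
        then show ?thesis using True by (simp add: degree_power_eq)
      next
        case False
        then show ?thesis using \<open>k \<ge> q\<close>
          by (auto simp: degree_power_eq intro!: coeff_eq_0)
      qed
    qed
  qed (use assms in auto)
  then show ?thesis
    using assms by (metis degree_pCons_0 degree_diff_less)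
qed

text \<open>
  The defect \<open>(X + v) ^ q - X ^ q - v ^ q\<close> has degree below \<open>q\<close>, so it is zero as soon as it
  vanishes on \<open>q\<close> elements.
\<close>

lemma frobenius_add_aux:
  fixes u v :: "'a::idom" and S :: "'a set"
  assumes "finite S" "card S = q" "q > 0"
    and root: "\<And>s. s \<in> S \<Longrightarrow> (s + v) ^ q = s ^ q + v ^ q"
  shows "(u + v) ^ q = u ^ q + v ^ q"
proof -
  define H where "H = [:v, 1:] ^ q - monom 1 q - [:v ^ q:]"
  have H: "poly H z = (z + v) ^ q - z ^ q - v ^ q" for z
    by (simp add: H_def poly_monom add.commute)
  have "H = 0"
  proof (rule ccontr)
    assume "H \<noteq> 0"
    then have "card S \<le> card {z. poly H z = 0}"
      by (intro card_mono poly_roots_finite) (auto simp: H root)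
    also have "\<dots> \<le> degree H" by (rule card_poly_roots_bound) fact
    also have "\<dots> < q" unfolding H_def by (rule degree_frobenius_defect) fact
    finally show False using assms by simp
  qed
  then have "poly H u = 0" by simp
  then show ?thesis by (simp add: H algebra_simps)
qed

text \<open>
  For \<open>v\<close> in \<open>S\<close> the defect vanishes on \<open>S\<close> because \<open>S\<close> consists of elements fixed by the
  \<open>q\<close>-power map; by symmetry this gives the roots that are needed for arbitrary \<open>v\<close>.
\<close>

lemma frobenius_add:
  fixes u v :: "'a::idom" and S :: "'a set"
  assumes "finite S" "card S = q" "q > 0"
    and pow: "\<And>s. s \<in> S \<Longrightarrow> s ^ q = s"
    and add: "\<And>s r. s \<in> S \<Longrightarrow> r \<in> S \<Longrightarrow> s + r \<in> S"
  shows "(u + v) ^ q = u ^ q + v ^ q"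
proof (rule frobenius_add_aux[OF assms(1-3)])
  fix s assume s: "s \<in> S"
  have "(v + s) ^ q = v ^ q + s ^ q"
    by (rule frobenius_add_aux[OF assms(1-3)]) (simp add: pow add s)
  then show "(s + v) ^ q = s ^ q + v ^ q" by (simp add: add.commute)
qed

locale finite_field_ext = field_ext \<iota> for \<iota> :: "'k::{finite,field} \<Rightarrow> 'f::field" +
  fixes q :: nat
  assumes q_def: "q = card (UNIV :: 'k set)"
begin

lemma q_ge_2: "q \<ge> 2"
  unfolding q_def by (rule card_field_ge_2)

lemma q_pos [simp]: "q > 0"
  using q_ge_2 by simp

lemma power_q [simp]: "(a :: 'k) ^ q = a"
  unfolding q_def by (rule finite_field_power_card)

lemma power_q_power [simp]: "(a :: 'k) ^ (q ^ j) = a"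
  by (induction j) (simp_all add: power_mult)

lemma power_q_minus_1: "a \<noteq> 0 \<Longrightarrow> (a :: 'k) ^ (q - 1) = 1"
  using power_q[of a] q_pos by (metis Suc_diff_1 mult_cancel_right1 power_Suc2)

lemma of_nat_q [simp]: "of_nat q = (0 :: 'f)"
  using of_nat_card_field[where 'k = 'k] hom_of_nat[of q] by (simp add: q_def)

lemma of_nat_q_base [simp]: "of_nat q = (0 :: 'k)"
  by (simp add: q_def of_nat_card_field)

lemma frobenius [simp]: "(u + v :: 'f) ^ q = u ^ q + v ^ q"
proof (rule frobenius_add[where S = "range \<iota>"])
  show "card (range \<iota>) = q" by (simp add: card_image inj_emb q_def)
  show "s ^ q = s" if "s \<in> range \<iota>" for s
    using that by (auto simp flip: hom_power)
  show "s + r \<in> range \<iota>" if "s \<in> range \<iota>" "r \<in> range \<iota>" for s r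
    using that by (auto simp del: hom_add simp flip: hom_add)
qed auto

lemma frobenius_field_embedding: "field_embedding (\<lambda>a :: 'f. a ^ q)"
  by (auto simp: field_embedding_def power_mult_distrib)

lemma frobenius_poly [simp]: "(u + v :: 'k poly) ^ q = u ^ q + v ^ q"
proof (rule frobenius_add[where S = "range (\<lambda>a. [:a:])"])
  show "card (range (\<lambda>a :: 'k. [:a:])) = q" by (simp add: card_image inj_def q_def)
  show "s ^ q = s" if "s \<in> range (\<lambda>a :: 'k. [:a:])" for s
    using that by (auto simp: poly_const_pow)
  show "s + r \<in> range (\<lambda>a. [:a:])" if "s \<in> range (\<lambda>a :: 'k. [:a:])" "r \<in> range (\<lambda>a. [:a:])" for s r
    using that by auto
qed auto

lemma frobenius_iter: "(u + v :: 'f) ^ (q ^ j) = u ^ (q ^ j) + v ^ (q ^ j)"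
  by (induction j) (simp_all add: power_mult mult.commute[of q])

lemma frobenius_poly_iter: "(u + v :: 'k poly) ^ (q ^ j) = u ^ (q ^ j) + v ^ (q ^ j)"
  by (induction j) (simp_all add: power_mult mult.commute[of q])

lemma frobenius_diff_iter: "(u - v :: 'f) ^ (q ^ j) = u ^ (q ^ j) - v ^ (q ^ j)"
  using frobenius_iter[of "u - v" v j] by simp

lemma frobenius_poly_diff_iter: "(u - v :: 'k poly) ^ (q ^ j) = u ^ (q ^ j) - v ^ (q ^ j)"
  using frobenius_poly_iter[of "u - v" v j] by simp

text \<open>
  Both sides are monic of degree \<open>q\<close> and vanish on all of \<open>k\<close>.
\<close>

lemma prod_linear: "(\<Prod>a\<in>UNIV. [:- a, 1:]) = monom 1 q - monom (1 :: 'k) 1"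
proof -
  have "degree (\<Prod>a\<in>UNIV. [:- a :: 'k, 1:]) = q"
    by (subst degree_prod_eq_sum_degree) (auto simp: q_def)
  moreover have "lead_coeff (\<Prod>a\<in>UNIV. [:- a :: 'k, 1:]) = 1"
    by (simp add: lead_coeff_prod)
  moreover have "poly (\<Prod>a\<in>UNIV. [:- a, 1:]) b = poly (monom 1 q - monom (1 :: 'k) 1) b" for b
    by (simp add: poly_prod poly_monom)
  ultimately show ?thesis
    by (intro poly_eqI_degree_lead_coeff[where A = UNIV and n = q])
       (use q_ge_2 in \<open>auto simp: coeff_monom q_def[symmetric] degree_diff_le degree_monom_eq\<close>)
qed

end

section \<open>Separable polynomials over a field\<close>

abbreviation monic_irreducible :: "'a::field poly \<Rightarrow> bool" where
  "monic_irreducible p \<equiv> irreducible p \<and> lead_coeff p = 1"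

definition separable :: "'a::field poly \<Rightarrow> bool" where
  "separable p \<longleftrightarrow> coprime p (pderiv p)"

lemma irreducible_degree_pos: "irreducible (p :: 'a::field poly) \<Longrightarrow> degree p > 0"
  using is_unit_iff_degree[of p] by (auto simp: Factorial_Ring.irreducible_def)

lemma irreducible_dvd_mult:
  "irreducible (p :: 'a::field poly) \<Longrightarrow> p dvd a * b \<longleftrightarrow> p dvd a \<or> p dvd b"
  using field_poly_irreducible_imp_prime prime_elem_dvd_mult_iff by blast

lemma irreducible_dvd_power:
  "irreducible (p :: 'a::field poly) \<Longrightarrow> p dvd g ^ N \<Longrightarrow> p dvd g"
  using field_poly_irreducible_imp_prime prime_elem_dvd_power by blast

lemma irreducible_dvd_prod:
  assumes "irreducible (p :: 'a::field poly)" "p dvd prod g I"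
  shows "\<exists>i\<in>I. p dvd g i"
  using assms(2)
proof (induction I rule: infinite_finite_induct)
  case (insert i I)
  then show ?case using assms(1) by (auto simp: irreducible_dvd_mult)
qed (use assms(1) in \<open>auto simp: Factorial_Ring.irreducible_def\<close>)

lemma exists_monic_irreducible_factor:
  fixes p :: "'a::field poly"
  assumes "degree p > 0"
  shows "\<exists>r. monic_irreducible r \<and> r dvd p"
proof -
  obtain r where r: "degree r > 0" "r dvd p"
    and least: "\<And>s. degree s > 0 \<Longrightarrow> s dvd p \<Longrightarrow> degree r \<le> degree s"
    using assms ex_has_least_nat[of "\<lambda>r. degree r > 0 \<and> r dvd p" p degree] by auto
  have r0: "r \<noteq> 0" using r by auto
  have "irreducible r"
  proof (rule Factorial_Ring.irreducibleI)
    show "r \<noteq> 0" by fact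
    show "\<not> is_unit r" using r r0 by (simp add: is_unit_iff_degree)
    fix a b assume ab: "r = a * b"
    then have "a \<noteq> 0" "b \<noteq> 0" using r0 by auto
    then have deg: "degree r = degree a + degree b" using ab by (simp add: degree_mult_eq)
    show "is_unit a \<or> is_unit b"
    proof (rule ccontr)
      assume "\<not> (is_unit a \<or> is_unit b)"
      then have "degree a > 0" "degree b > 0"
        using \<open>a \<noteq> 0\<close> \<open>b \<noteq> 0\<close> by (auto simp: is_unit_iff_degree)
      moreover have "a dvd p" using ab r(2) by (meson dvd_mult_left dvd_trans dvd_refl dvd_triv_left)
      ultimately show False using least[of a] deg by simp
    qed
  qed
  then have "irreducible (smult (inverse (lead_coeff r)) r)"
    using r0 by (metis inverse_nonzero_iff_nonzero irreducible_mult_unit_left is_unit_pCons_iff leading_coeff_0_iff mult_pCons_left mult_zero_left pCons_0_0 add.right_neutral smult_0_left)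
  moreover have "smult (inverse (lead_coeff r)) r dvd p"
    using r r0 by (simp add: smult_dvd)
  ultimately show ?thesis using r0 by (intro exI[of _ "smult (inverse (lead_coeff r)) r"]) auto
qed

lemma monic_irreducible_dvd_eq:
  fixes p r :: "'a::field poly"
  assumes "monic_irreducible p" "monic_irreducible r" "p dvd r"
  shows "p = r"
proof -
  have "r dvd p"
    using assms Factorial_Ring.irreducibleD'[of r p] irreducible_degree_pos[of p] is_unit_iff_degree[of p] by auto
  then obtain c where c: "p = r * c" by auto
  obtain e where e: "r = p * e" using assms by auto
  have "r = r * (c * e)" using c e by (metis mult.assoc)
  moreover have "r \<noteq> 0" using assms by auto
  ultimately have "c * e = 1" by simp
  then have "degree c = 0" by (metis dvd_triv_left is_unit_iff_degree not_is_unit_0 mult_zero_left zero_neq_one)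
  then obtain a where a: "c = [:a:]" by (auto elim: degree_eq_zeroE)
  then have p: "p = smult a r" using c by simp
  then have "lead_coeff p = a * lead_coeff r" by (simp only: lead_coeff_smult)
  then have "a = 1" using assms by (metis mult.right_neutral)
  then show ?thesis using p by simp
qed

lemma separable_nonzero: "separable p \<Longrightarrow> p \<noteq> 0"
  by (auto simp: separable_def)

lemma separable_irreducible_factor:
  fixes p s :: "'a::field poly"
  assumes "separable (p * s)" "irreducible p"
  shows "separable s \<and> \<not> p dvd s"
proof
  have *: "is_unit c" if "c dvd p * s" "c dvd pderiv (p * s)" for c
    using assms(1) that unfolding separable_def coprime_def by blast
  show "separable s"
    unfolding separable_def coprime_def
  proof (intro allI impI)
    fix c assume "c dvd s" "c dvd pderiv s"
    then show "is_unit c" by (intro *) (auto simp: pderiv_mult)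
  qed
  show "\<not> p dvd s"
  proof
    assume "p dvd s"
    then have "is_unit p" by (intro *) (auto simp: pderiv_mult)
    then show False using assms(2) by (simp add: Factorial_Ring.irreducible_def)
  qed
qed

text \<open>
  A separable polynomial is a product of distinct irreducible factors; this rule splits them off
  one at a time.
\<close>

lemma separable_induct [consumes 1, case_names const step]:
  fixes \<chi> :: "'a::field poly"
  assumes "separable \<chi>"
    and "\<And>\<chi>. \<chi> \<noteq> 0 \<Longrightarrow> degree \<chi> = 0 \<Longrightarrow> Q \<chi>"
    and "\<And>p s. monic_irreducible p \<Longrightarrow> separable s \<Longrightarrow> \<not> p dvd s \<Longrightarrow> Q s \<Longrightarrow> Q (p * s)"
  shows "Q \<chi>"
  using assms(1)
proof (induction "degree \<chi>" arbitrary: \<chi> rule: less_induct)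
  case less
  have nz: "\<chi> \<noteq> 0" using less.prems by (rule separable_nonzero)
  show ?case
  proof (cases "degree \<chi> = 0")
    case True
    then show ?thesis using assms(2) nz by blast
  next
    case False
    then obtain p s where p: "monic_irreducible p" "\<chi> = p * s"
      using exists_monic_irreducible_factor[of \<chi>] by (auto elim!: dvdE)
    then have s: "separable s" "\<not> p dvd s"
      using separable_irreducible_factor less.prems by auto
    have "degree s < degree \<chi>"
      using p nz irreducible_degree_pos[of p] by (auto simp: degree_mult_eq)
    then show ?thesis using less.hyps s p assms(3) by blast
  qed
qed

text \<open>
  Distinct irreducible factors that each divide \<open>g\<close> have a product dividing \<open>g\<close>.
\<close>

lemma separable_dvd_power:
  fixes \<chi> g :: "'a::field poly"
  assumes "separable \<chi>" "\<chi> dvd g ^ N"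
  shows "\<chi> dvd g"
  using assms
proof (induction rule: separable_induct)
  case (const \<chi>)
  then show ?case by (simp add: is_unit_iff_degree unit_imp_dvd)
next
  case (step p s)
  then have "p dvd g" "s dvd g"
    using irreducible_dvd_power[of p g N] by (auto dest: dvd_mult_left dvd_mult_right)
  then obtain k where k: "g = s * k" by auto
  then have "p dvd k" using step \<open>p dvd g\<close> irreducible_dvd_mult by blast
  then show ?case using k by (simp add: mult.commute[of p])
qed

lemma separable_sum_degree_factors:
  fixes \<chi> :: "'a::field poly"
  assumes "separable \<chi>"
  shows "finite {p. monic_irreducible p \<and> p dvd \<chi>} \<and>
         (\<Sum>p | monic_irreducible p \<and> p dvd \<chi>. degree p) = degree \<chi>"
  using assms
proof (induction rule: separable_induct)
  case (const \<chi>)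
  then have "is_unit \<chi>" by (simp add: is_unit_iff_degree)
  then have "{p. monic_irreducible p \<and> p dvd \<chi>} = {}"
    by (auto simp: Factorial_Ring.irreducible_def dest: dvd_unit_imp_unit)
  then show ?case using const by (simp only:) simp
next
  case (step p s)
  have eq: "{r. monic_irreducible r \<and> r dvd p * s} = insert p {r. monic_irreducible r \<and> r dvd s}"
    using step(1) monic_irreducible_dvd_eq[of _ p] by (auto simp: irreducible_dvd_mult)
  have "p \<noteq> 0" "s \<noteq> 0" using step by auto
  then have deg: "degree (p * s) = degree p + degree s" by (rule degree_mult_eq)
  show ?case unfolding eq deg using step by simp
qed

text \<open>
  A common divisor of \<open>X ^ m - l\<close> and \<open>m X ^ (m - 1)\<close> divides \<open>X ^ m\<close>, hence \<open>l\<close>.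
\<close>

lemma separable_binomial:
  fixes l :: "'a::field"
  assumes "l \<noteq> 0" "of_nat m \<noteq> (0 :: 'a)"
  shows "separable (monom 1 m - [:l:])"
  unfolding separable_def coprime_def
proof (intro allI impI)
  fix c assume c: "c dvd monom 1 m - [:l:]" "c dvd pderiv (monom 1 m - [:l:])"
  have m: "m > 0" using assms by (cases m) auto
  have "pderiv (monom 1 m - [:l:]) = monom (of_nat m) (m - 1)"
    by (simp add: pderiv_diff pderiv_monom)
  then have "c dvd monom (of_nat m) (m - 1) * monom (1 / of_nat m) 1"
    using c by (metis dvd_mult2)
  then have "c dvd monom 1 m" using assms m by (simp add: mult_monom)
  then have "c dvd monom 1 m - (monom 1 m - [:l:])" using c dvd_diff by blast
  then have "c dvd [:l:]" by simp
  moreover have "is_unit [:l:]" using assms by (simp add: is_unit_pCons_iff)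
  ultimately show "is_unit c" by (rule dvd_unit_imp_unit)
qed

context finite_field_ext
begin

text \<open>
  Among the powers \<open>X ^ (q ^ i)\<close> two agree modulo \<open>\<chi>\<close>, and their difference is a
  power of some \<open>X ^ (q ^ j) - X\<close>, since Frobenius is additive.
\<close>

lemma radical_dvd_frobenius:
  fixes \<chi> :: "'k poly"
  assumes "\<chi> \<noteq> 0" and rad: "\<And>g N. \<chi> dvd g ^ N \<Longrightarrow> \<chi> dvd g"
  shows "\<exists>j\<ge>1. \<chi> dvd monom 1 (q ^ j) - monom 1 1"
proof -
  let ?r = "\<lambda>i. monom (1 :: 'k) (q ^ i) mod \<chi>"
  have "range ?r \<subseteq> {p. degree p \<le> degree \<chi>}"
  proof clarify
    fix i show "degree (?r i) \<le> degree \<chi>"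
      using degree_mod_less[OF assms(1), of "monom 1 (q ^ i)"] by auto
  qed
  moreover have "finite {p :: 'k poly. degree p \<le> degree \<chi>}"
  proof (rule finite_subset)
    show "{p :: 'k poly. degree p \<le> degree \<chi>} \<subseteq> Poly ` {xs. set xs \<subseteq> UNIV \<and> length xs \<le> Suc (degree \<chi>)}"
    proof
      fix p :: "'k poly" assume "p \<in> {p. degree p \<le> degree \<chi>}"
      then have "length (coeffs p) \<le> Suc (degree \<chi>)"
        by (cases "p = 0") (auto simp: length_coeffs_degree)
      then show "p \<in> Poly ` {xs. set xs \<subseteq> UNIV \<and> length xs \<le> Suc (degree \<chi>)}"
        by (intro image_eqI[where x = "coeffs p"]) auto
    qed
    show "finite (Poly ` {xs :: 'k list. set xs \<subseteq> UNIV \<and> length xs \<le> Suc (degree \<chi>)})"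
      by (intro finite_imageI finite_lists_length_le) auto
  qed
  ultimately have "finite (range ?r)" by (rule finite_subset)
  then have "\<not> inj ?r" using finite_imageD[of ?r UNIV] infinite_UNIV_nat by blast
  then obtain i0 i1 where "i0 \<noteq> i1" "?r i0 = ?r i1" unfolding inj_def by blast
  then obtain i i' where "i < i'" "?r i' = ?r i"
    by (cases "i0 < i1") (auto simp: not_less_iff_gr_or_eq)
  then have "\<chi> dvd monom 1 (q ^ i') - monom 1 (q ^ i)"
    by (simp add: mod_eq_dvd_iff)
  also have "monom (1 :: 'k) (q ^ i') - monom 1 (q ^ i) = (monom 1 (q ^ (i' - i)) - monom 1 1) ^ (q ^ i)"
    using \<open>i < i'\<close> by (simp add: frobenius_poly_diff_iter monom_power flip: power_add)
  finally have "\<chi> dvd monom 1 (q ^ (i' - i)) - monom 1 1" by (rule rad)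
  then show ?thesis using \<open>i < i'\<close> by (intro exI[of _ "i' - i"]) auto
qed

text \<open>
  \<open>X ^ (Q ^ (m + 1)) - X\<close> is the \<open>Q\<close>-th power of \<open>X ^ (Q ^ m) - X\<close> plus \<open>X ^ Q - X\<close>.
\<close>

lemma dvd_frobenius_iter:
  fixes \<chi> :: "'k poly"
  assumes "\<chi> dvd monom 1 (q ^ j) - monom 1 1"
  shows "\<chi> dvd monom 1 (q ^ (j * m)) - monom 1 1"
proof (induction m)
  case (Suc m)
  have "monom (1 :: 'k) (q ^ (j * Suc m)) - monom 1 1
      = (monom 1 (q ^ (j * m)) - monom 1 1) ^ (q ^ j) + (monom 1 (q ^ j) - monom 1 1)"
    by (simp add: frobenius_poly_diff_iter monom_power power_add mult.commute)
  moreover have "\<chi> dvd (monom 1 (q ^ (j * m)) - monom 1 1) ^ (q ^ j)"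
    using Suc by (simp add: dvd_power dvd_trans)
  ultimately show ?case using assms by (metis dvd_add)
qed auto

lemma irreducible_dvd_frobenius:
  "irreducible (p :: 'k poly) \<Longrightarrow> \<exists>j\<ge>1. p dvd monom 1 (q ^ j) - monom 1 1"
  using radical_dvd_frobenius irreducible_dvd_power by (metis not_irreducible_zero)

lemma separable_dvd_frobenius:
  "separable (\<chi> :: 'k poly) \<Longrightarrow> \<exists>j\<ge>1. \<chi> dvd monom 1 (q ^ j) - monom 1 1"
  using radical_dvd_frobenius separable_dvd_power separable_nonzero by metis

text \<open>
  \<open>p\<close> divides some \<open>X ^ (q ^ j) - X\<close>, whose derivative is \<open>- 1\<close>.
\<close>

lemma irreducible_not_dvd_pderiv:
  assumes "irreducible (p :: 'k poly)"
  shows "\<not> p dvd pderiv p"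
proof
  assume dvd: "p dvd pderiv p"
  obtain j where j: "j \<ge> 1" "p dvd monom 1 (q ^ j) - monom 1 1"
    using irreducible_dvd_frobenius assms by blast
  then obtain s where s: "monom 1 (q ^ j) - monom 1 1 = p * s" by auto
  have "pderiv (monom (1 :: 'k) (q ^ j) - monom 1 1) = - 1"
    using j by (simp add: pderiv_diff pderiv_monom of_nat_power power_0_left flip: one_pCons)
  then have "- 1 = p * pderiv s + s * pderiv p" by (metis s pderiv_mult)
  then have "p dvd - 1" using dvd by (metis dvd_add dvd_mult dvd_triv_left)
  then show False using assms by (simp add: Factorial_Ring.irreducible_def)
qed

text \<open>\<open>X ^ q - X\<close> is the product of all \<open>X - a\<close>.\<close>

lemma irreducible_dvd_prod_linear:
  assumes "monic_irreducible (p :: 'k poly)" "p dvd monom 1 q - monom 1 1"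
  shows "\<exists>a. p = [:- a, 1:]"
proof -
  have "p dvd (\<Prod>a\<in>UNIV. [:- a, 1:])" using assms(2) by (simp only: prod_linear)
  then obtain a where "p dvd [:- a, 1:]" using irreducible_dvd_prod assms(1) by blast
  then show ?thesis
    using monic_irreducible_dvd_eq[of p "[:- a, 1:]"] assms irreducible_linear_field_poly[of 1 "- a"] by auto
qed

end

section \<open>Places\<close>

locale place_of_ext = field_ext \<iota> for \<iota> :: "'k::field \<Rightarrow> 'f::field" +
  fixes P :: "'f place"
  assumes place: "is_place \<iota> P"
begin

lemma P_0 [simp]: "P 0 = 0"
  using place by (simp add: is_place_def)

lemma P_mult: "u \<noteq> 0 \<Longrightarrow> v \<noteq> 0 \<Longrightarrow> P (u * v) = P u + P v"
  using place by (simp add: is_place_def)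

lemma P_emb [simp]: "P (\<iota> a) = 0"
  using place by (cases "a = 0") (auto simp: is_place_def)

lemma P_1 [simp]: "P 1 = 0"
  using P_emb[of 1] by simp

lemma P_minus [simp]: "P (- u) = P u"
proof (cases "u = 0")
  case False
  have "P (\<iota> (- 1)) + P u = P (\<iota> (- 1) * u)" by (rule P_mult[symmetric]) (use False in auto)
  moreover have "P (\<iota> (- 1)) = 0" by (rule P_emb)
  ultimately show ?thesis by simp
qed auto

lemma P_power: "u \<noteq> 0 \<Longrightarrow> P (u ^ m) = int m * P u"
  by (induction m) (auto simp: P_mult algebra_simps)

lemma P_inverse: "u \<noteq> 0 \<Longrightarrow> P (inverse u) = - P u"
  using P_mult[of u "inverse u"] by simp

lemma P_divide: "u \<noteq> 0 \<Longrightarrow> v \<noteq> 0 \<Longrightarrow> P (u / v) = P u - P v"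
  by (simp add: divide_inverse P_mult P_inverse)

lemma P_prod: "(\<And>i. i \<in> I \<Longrightarrow> g i \<noteq> 0) \<Longrightarrow> P (\<Prod>i\<in>I. g i) = (\<Sum>i\<in>I. P (g i))"
  by (induction I rule: infinite_finite_induct) (auto simp: P_mult)

lemma exists_uniformizer: "\<exists>t. P t = 1"
  using place by (simp add: is_place_def)

text \<open>\<open>ord_ge m z\<close> reads \<open>P z\<close> as \<open>\<infinity>\<close> at \<open>z = 0\<close>.\<close>

definition ord_ge :: "int \<Rightarrow> 'f \<Rightarrow> bool" where
  "ord_ge m z \<longleftrightarrow> z = 0 \<or> m \<le> P z"

lemma ord_ge_0 [simp]: "ord_ge m 0"
  by (simp add: ord_ge_def)

lemma ord_ge_emb [simp]: "ord_ge 0 (\<iota> a)"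
  by (simp add: ord_ge_def)

lemma ord_ge_1 [simp]: "ord_ge 0 1"
  by (simp add: ord_ge_def)

lemma ord_ge_add: "ord_ge m u \<Longrightarrow> ord_ge m v \<Longrightarrow> ord_ge m (u + v)"
proof (cases "u = 0 \<or> v = 0 \<or> u + v = 0")
  case False
  assume "ord_ge m u" "ord_ge m v"
  moreover have "min (P u) (P v) \<le> P (u + v)" using place False by (simp add: is_place_def)
  ultimately show ?thesis using False by (auto simp: ord_ge_def)
qed auto

lemma ord_ge_minus [simp]: "ord_ge m (- u) \<longleftrightarrow> ord_ge m u"
  by (simp add: ord_ge_def)

lemma ord_ge_diff: "ord_ge m u \<Longrightarrow> ord_ge m v \<Longrightarrow> ord_ge m (u - v)"
  using ord_ge_add[of m u "- v"] by simp

lemma ord_ge_mult: "ord_ge m u \<Longrightarrow> ord_ge m' v \<Longrightarrow> ord_ge (m + m') (u * v)"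
  by (cases "u = 0"; cases "v = 0") (auto simp: ord_ge_def P_mult)

lemma ord_ge_mult0: "ord_ge 0 u \<Longrightarrow> ord_ge m v \<Longrightarrow> ord_ge m (u * v)"
  using ord_ge_mult[of 0 u m v] by simp

lemma ord_ge_mono: "ord_ge m u \<Longrightarrow> m' \<le> m \<Longrightarrow> ord_ge m' u"
  by (auto simp: ord_ge_def)

lemma ord_ge_power: "ord_ge 0 u \<Longrightarrow> ord_ge 0 (u ^ m)"
  by (induction m) (auto intro: ord_ge_mult0)

lemma ord_ge_sum: "(\<And>i. i \<in> I \<Longrightarrow> ord_ge m (g i)) \<Longrightarrow> ord_ge m (\<Sum>i\<in>I. g i)"
  by (induction I rule: infinite_finite_induct) (auto intro: ord_ge_add)

lemma ord_ge_ev: "ord_ge 0 z \<Longrightarrow> ord_ge 0 (ev p z)"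
  by (induction p) (auto intro!: ord_ge_add ord_ge_mult0)

lemma not_pos_unit: "ord_ge 0 u \<Longrightarrow> \<not> ord_ge 1 u \<Longrightarrow> u \<noteq> 0 \<and> P u = 0"
  by (auto simp: ord_ge_def)

lemma pos_mult_iff: "ord_ge 0 u \<Longrightarrow> ord_ge 0 v \<Longrightarrow> ord_ge 1 (u * v) \<longleftrightarrow> ord_ge 1 u \<or> ord_ge 1 v"
  by (cases "u = 0"; cases "v = 0") (auto simp: ord_ge_def P_mult)

lemma pos_power: "ord_ge 1 u \<Longrightarrow> m > 0 \<Longrightarrow> ord_ge 1 (u ^ m)"
proof (induction m)
  case (Suc m)
  then show ?case using ord_ge_mult0[of "u ^ m" 1 u] ord_ge_mono[of 1 u 0]
    by (simp add: ord_ge_power mult.commute)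
qed auto

lemma P_add_lt:
  assumes "u \<noteq> 0" "ord_ge (P u + 1) v"
  shows "u + v \<noteq> 0 \<and> P (u + v) = P u"
proof -
  have nz: "u + v \<noteq> 0"
  proof
    assume "u + v = 0"
    then have "v = - u" by (simp add: eq_neg_iff_add_eq_0 add.commute)
    then show False using assms by (auto simp: ord_ge_def)
  qed
  have "ord_ge (P u) (u + v)"
    by (rule ord_ge_add) (use assms in \<open>auto simp: ord_ge_def\<close>)
  moreover have "\<not> ord_ge (P u + 1) (u + v)"
    using ord_ge_diff[of "P u + 1" "u + v" v] assms by (auto simp: ord_ge_def)
  ultimately show ?thesis using nz by (auto simp: ord_ge_def)
qed

text \<open>
  At a pole of \<open>z\<close> the leading term of a polynomial in \<open>z\<close> dominates.
\<close>

lemma ev_pole: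
  assumes "P z < 0" "p \<noteq> 0"
  shows "ev p z \<noteq> 0 \<and> P (ev p z) = int (degree p) * P z"
  using assms(2)
proof (induction p)
  case (pCons a p)
  have z: "z \<noteq> 0" using assms(1) by auto
  show ?case
  proof (cases "p = 0")
    case True
    then show ?thesis using pCons by auto
  next
    case False
    then have IH: "ev p z \<noteq> 0" "P (ev p z) = int (degree p) * P z" using pCons by auto
    have P1: "P (z * ev p z) = int (degree (pCons a p)) * P z"
      using z IH False by (simp add: P_mult algebra_simps)
    also have "\<dots> < 0" using assms(1) False by (simp add: mult_less_0_iff)
    finally have "ord_ge (P (z * ev p z) + 1) (\<iota> a)" by (auto simp: ord_ge_def)
    then have "z * ev p z + \<iota> a \<noteq> 0 \<and> P (z * ev p z + \<iota> a) = P (z * ev p z)"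
      using z IH by (intro P_add_lt) auto
    then show ?thesis using P1 by (simp add: add.commute)
  qed
qed auto

lemma ev_congruence:
  assumes "ord_ge 0 u" "ord_ge 0 v" "ord_ge 1 (u - v)"
  shows "ord_ge 1 (ev p u - ev p v)"
proof (induction p)
  case (pCons a p)
  have "ev (pCons a p) u - ev (pCons a p) v = u * (ev p u - ev p v) + ev p v * (u - v)"
    by (simp add: algebra_simps)
  then show ?case using pCons assms by (simp del: ev_pCons add: ord_ge_add ord_ge_mult0 ord_ge_ev)
qed auto

text \<open>When a summand is added whose order differs from that of the sum so far, the smaller of the
  two orders survives.\<close>

lemma distinct_orders:
  assumes "finite I" "I \<noteq> {}" "\<And>i. i \<in> I \<Longrightarrow> \<tau> i \<noteq> 0" "inj_on (\<lambda>i. P (\<tau> i)) I"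
  shows "(\<Sum>i\<in>I. \<tau> i) \<noteq> 0 \<and> (\<exists>j\<in>I. P (\<Sum>i\<in>I. \<tau> i) = P (\<tau> j)) \<and> (\<forall>i\<in>I. P (\<Sum>i\<in>I. \<tau> i) \<le> P (\<tau> i))"
  using assms
proof (induction I rule: finite_ne_induct)
  case (insert k I)
  let ?S = "\<Sum>i\<in>I. \<tau> i"
  have IH: "?S \<noteq> 0" "\<exists>j\<in>I. P ?S = P (\<tau> j)" "\<forall>i\<in>I. P ?S \<le> P (\<tau> i)"
    using insert by (auto simp: inj_on_insert)
  have "\<tau> k \<noteq> 0" using insert by auto
  have "P (\<tau> k) \<noteq> P ?S" using IH(2) insert by (force simp: inj_on_def)
  then consider "P (\<tau> k) < P ?S" | "P ?S < P (\<tau> k)" by linarith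
  then show ?case
  proof cases
    case 1
    then have "\<tau> k + ?S \<noteq> 0 \<and> P (\<tau> k + ?S) = P (\<tau> k)"
      by (intro P_add_lt) (use \<open>\<tau> k \<noteq> 0\<close> in \<open>auto simp: ord_ge_def\<close>)
    then show ?thesis using insert(1,3) IH(3) 1 by fastforce
  next
    case 2
    then have "?S + \<tau> k \<noteq> 0 \<and> P (?S + \<tau> k) = P ?S"
      by (intro P_add_lt) (use IH(1) in \<open>auto simp: ord_ge_def\<close>)
    then have "\<tau> k + ?S \<noteq> 0" "P (\<tau> k + ?S) = P ?S" by (simp_all add: add.commute)
    then show ?thesis using insert(1,3) IH(2,3) 2 by simp
  qed
qed auto

text \<open>
  Among the nonzero polynomials whose value at \<open>z\<close> vanishes at \<open>P\<close>, one of least degree divides all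
  the others. It is the minimal polynomial of the residue of \<open>z\<close>.
\<close>

lemma residue_minimal_polynomial:
  assumes "ord_ge 0 z" "g \<noteq> 0" "ord_ge 1 (ev g z)"
  shows "\<exists>p. monic_irreducible p \<and> (\<forall>g. ord_ge 1 (ev g z) \<longleftrightarrow> p dvd g)"
proof -
  let ?V = "\<lambda>g. g \<noteq> 0 \<and> ord_ge 1 (ev g z)"
  obtain p where p: "p \<noteq> 0" "ord_ge 1 (ev p z)" and least: "\<And>g. ?V g \<Longrightarrow> degree p \<le> degree g"
    using ex_has_least_nat[of ?V g degree] assms by auto
  have iff: "ord_ge 1 (ev g z) \<longleftrightarrow> p dvd g" for g
  proof
    assume g: "ord_ge 1 (ev g z)"
    have "ev (g mod p) z = ev g z - ev (g div p) z * ev p z"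
      by (metis ev_diff ev_mult minus_div_mult_eq_mod)
    then have "ord_ge 1 (ev (g mod p) z)"
      using g p assms(1) by (auto intro!: ord_ge_diff ord_ge_mult0 ord_ge_ev)
    then have "g mod p = 0"
      using least[of "g mod p"] degree_mod_less[OF p(1), of g] by fastforce
    then show "p dvd g" by auto
  next
    assume "p dvd g"
    then show "ord_ge 1 (ev g z)" using p assms(1)
      by (auto elim!: dvdE simp: mult.commute[of "ev p z"] intro!: ord_ge_mult0 ord_ge_ev)
  qed
  have degp: "degree p > 0"
  proof (rule ccontr)
    assume "\<not> degree p > 0"
    then have "p dvd 1" using p(1) by (simp add: is_unit_iff_degree)
    then have "ord_ge 1 (ev 1 z)" using iff by blast
    then show False by (simp add: ord_ge_def)
  qed
  obtain r where r: "monic_irreducible r" "r dvd p" using exists_monic_irreducible_factor[OF degp] by blast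
  then obtain s where s: "p = r * s" by auto
  then have "ord_ge 1 (ev r z) \<or> ord_ge 1 (ev s z)"
    using p(2) pos_mult_iff[of "ev r z" "ev s z"] assms(1) by (simp add: ord_ge_ev)
  then have "p dvd r"
  proof
    assume "ord_ge 1 (ev s z)"
    moreover have "s \<noteq> 0" using p s by auto
    ultimately have "degree p \<le> degree s" using least by blast
    moreover have "degree p = degree r + degree s" using p(1) s by (auto simp: degree_mult_eq)
    ultimately show "p dvd r" using irreducible_degree_pos[of r] r by simp
  qed (use iff in blast)
  then have "p dvd g \<longleftrightarrow> r dvd g" for g using r(2) dvd_trans by blast
  then show ?thesis using r(1) iff by blast
qed

end

section \<open>Subrings with a local parameter\<close>

inductive_set adjoin :: "('k::field \<Rightarrow> 'f::field) \<Rightarrow> 'f set \<Rightarrow> 'f set"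
  for \<iota> :: "'k \<Rightarrow> 'f" and S :: "'f set" where
  adjoin_emb: "\<iota> a \<in> adjoin \<iota> S"
| adjoin_gen: "s \<in> S \<Longrightarrow> s \<in> adjoin \<iota> S"
| adjoin_add: "u \<in> adjoin \<iota> S \<Longrightarrow> v \<in> adjoin \<iota> S \<Longrightarrow> u + v \<in> adjoin \<iota> S"
| adjoin_mult: "u \<in> adjoin \<iota> S \<Longrightarrow> v \<in> adjoin \<iota> S \<Longrightarrow> u * v \<in> adjoin \<iota> S"

lemma (in field_ext) adjoin_1: "1 \<in> adjoin \<iota> S"
  using adjoin_emb[of \<iota> 1 S] by simp

lemma (in field_ext) adjoin_0: "0 \<in> adjoin \<iota> S"
  using adjoin_emb[of \<iota> 0 S] by simp

lemma (in field_ext) adjoin_minus: "u \<in> adjoin \<iota> S \<Longrightarrow> - u \<in> adjoin \<iota> S"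
  using adjoin_mult[OF adjoin_emb[of \<iota> "- 1" S], of u] by simp

lemma (in field_ext) adjoin_diff: "u \<in> adjoin \<iota> S \<Longrightarrow> v \<in> adjoin \<iota> S \<Longrightarrow> u - v \<in> adjoin \<iota> S"
  using adjoin_add[OF _ adjoin_minus, of u S v] by simp

lemma (in field_ext) adjoin_power: "u \<in> adjoin \<iota> S \<Longrightarrow> u ^ m \<in> adjoin \<iota> S"
  by (induction m) (auto intro: adjoin_1 adjoin_mult)

lemma (in field_ext) adjoin_ev: "u \<in> adjoin \<iota> S \<Longrightarrow> ev p u \<in> adjoin \<iota> S"
  by (induction p) (auto intro: adjoin_0 adjoin_mult adjoin_add adjoin_emb)

lemma (in place_of_ext) adjoin_ord_ge_0:
  assumes "\<And>s. s \<in> S \<Longrightarrow> ord_ge 0 s" "u \<in> adjoin \<iota> S"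
  shows "ord_ge 0 u"
  using assms(2) by induction (auto intro: assms(1) ord_ge_add ord_ge_mult0)

text \<open>
  A chart is a subring \<open>R\<close> with fraction field \<open>F\<close> and an element \<open>t\<close> of \<open>R\<close> such
  that \<open>g ^ Q = g\<close> holds in \<open>R / t R\<close>. This makes \<open>R / t R\<close> von Neumann regular, so at
  every prime containing \<open>t\<close> the local ring of \<open>R\<close> has maximal ideal generated by \<open>t\<close>. It
  replaces the smoothness of the curve at the points where \<open>t\<close> vanishes.
\<close>

locale chart = field_ext \<iota> for \<iota> :: "'k::field \<Rightarrow> 'f::field" +
  fixes S :: "'f set" and t :: 'f and Q :: nat
  assumes frac: "\<And>z. \<exists>g\<in>adjoin \<iota> S. \<exists>h\<in>adjoin \<iota> S. h \<noteq> 0 \<and> z = g / h"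
    and t_in: "t \<in> adjoin \<iota> S" and t_nz: "t \<noteq> 0"
    and Q_ge_2: "Q \<ge> 2"
    and frob: "\<And>g. g \<in> adjoin \<iota> S \<Longrightarrow> \<exists>r\<in>adjoin \<iota> S. g ^ Q - g = t * r"

locale chart_place = chart \<iota> S t Q + place_of_ext \<iota> P
  for \<iota> :: "'k::field \<Rightarrow> 'f::field" and S t Q P +
  assumes nonneg: "\<And>s. s \<in> S \<Longrightarrow> ord_ge 0 s" and t_pos: "P t > 0"
begin

abbreviation "R \<equiv> adjoin \<iota> S"

lemma R_nonneg: "g \<in> R \<Longrightarrow> ord_ge 0 g"
  using adjoin_ord_ge_0 nonneg by blast

text \<open>If \<open>P g > 0\<close> then \<open>1 - g ^ (Q - 1)\<close> is a unit at \<open>P\<close> and its product with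
  \<open>g\<close> is divisible by \<open>t\<close>.\<close>

lemma extract_parameter:
  assumes "g \<in> R" "g \<noteq> 0"
  shows "\<exists>N s g'. s \<in> R \<and> g' \<in> R \<and> \<not> ord_ge 1 s \<and> \<not> ord_ge 1 g' \<and> s * g = t ^ N * g'"
  using assms
proof (induction "nat (P g)" arbitrary: g rule: less_induct)
  case less
  show ?case
  proof (cases "ord_ge 1 g")
    case False
    then show ?thesis using less.prems
      by (intro exI[of _ 0] exI[of _ 1] exI[of _ g]) (auto simp: ord_ge_def adjoin_1)
  next
    case True
    obtain r where r: "r \<in> R" "g ^ Q - g = t * r" using frob less.prems by blast
    define s where "s = 1 - g ^ (Q - 1)"
    have sR: "s \<in> R" unfolding s_def using less.prems by (intro adjoin_diff adjoin_1 adjoin_power)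
    have s0: "\<not> ord_ge 1 s"
    proof
      assume "ord_ge 1 s"
      then have "ord_ge 1 (s + g ^ (Q - 1))"
        using True Q_ge_2 by (intro ord_ge_add pos_power) auto
      then show False by (simp add: s_def ord_ge_def)
    qed
    have sg: "s * g = - (t * r)"
    proof -
      have "g ^ (Q - 1) * g = g ^ Q" using Q_ge_2 by (metis Suc_diff_1 le_trans not_gr_zero one_le_numeral not_one_le_zero power_Suc2)
      then have "s * g = g - g ^ Q" by (simp add: s_def left_diff_distrib)
      then show ?thesis using r(2) by (metis minus_diff_eq)
    qed
    have s_unit: "s \<noteq> 0 \<and> P s = 0" using not_pos_unit R_nonneg sR s0 by blast
    have "s * g \<noteq> 0" using s_unit less.prems by simp
    then have r0: "r \<noteq> 0" using sg by auto
    have "P g = P t + P r"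
    proof -
      have "P (s * g) = P (- (t * r))" by (simp only: sg)
      then show ?thesis using s_unit less.prems r0 t_nz by (simp add: P_mult)
    qed
    then have "nat (P r) < nat (P g)" using t_pos True less.prems by (auto simp: ord_ge_def)
    then obtain N s' g' where IH: "s' \<in> R" "g' \<in> R" "\<not> ord_ge 1 s'" "\<not> ord_ge 1 g'" "s' * r = t ^ N * g'"
      using less.hyps r(1) r0 by blast
    have "(s' * s) * g = t ^ Suc N * (- g')"
    proof -
      have "(s' * s) * g = s' * (s * g)" by (simp add: algebra_simps)
      also have "\<dots> = s' * (- (t * r))" by (simp only: sg)
      also have "\<dots> = - t * (s' * r)" by (simp add: algebra_simps)
      also have "\<dots> = t ^ Suc N * (- g')" by (simp only: IH(5)) (simp add: algebra_simps)
      finally show ?thesis .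
    qed
    moreover have "\<not> ord_ge 1 (s' * s)"
      using pos_mult_iff R_nonneg IH sR s0 by blast
    ultimately show ?thesis
      using IH sR by (intro exI[of _ "Suc N"] exI[of _ "s' * s"] exI[of _ "- g'"])
        (auto intro: adjoin_mult adjoin_minus)
  qed
qed

lemma order_eq:
  assumes "s \<in> R" "g' \<in> R" "\<not> ord_ge 1 s" "\<not> ord_ge 1 g'" "s * g = t ^ N * g'" "g \<noteq> 0"
  shows "P g = int N * P t"
proof -
  have "s \<noteq> 0 \<and> P s = 0" "g' \<noteq> 0 \<and> P g' = 0" using assms not_pos_unit R_nonneg by blast+
  moreover from this have "P s + P g = P (t ^ N) + P g'"
    using assms(5,6) t_nz by (metis P_mult power_not_zero)
  ultimately show ?thesis using t_nz by (simp add: P_power)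
qed

text \<open>
  All orders are multiples of \<open>P t\<close>, and \<open>1\<close> occurs as an order.
\<close>

lemma P_t: "P t = 1"
proof -
  obtain z where z: "P z = 1" using exists_uniformizer by blast
  obtain g h where gh: "g \<in> R" "h \<in> R" "h \<noteq> 0" "z = g / h" using frac by blast
  have "g \<noteq> 0" using z gh by auto
  then have "1 = P g - P h" using P_divide z gh by auto
  moreover have "\<exists>N. P g = int N * P t" "\<exists>N. P h = int N * P t"
    using extract_parameter order_eq gh \<open>g \<noteq> 0\<close> by blast+
  ultimately have "P t dvd 1" by (metis dvd_diff dvd_triv_right)
  then show ?thesis using t_pos by auto
qed

text \<open>
  A unit of the valuation ring is \<open>u / v\<close> with \<open>u\<close>, \<open>v\<close> in \<open>R\<close> units at \<open>P\<close>, because the powers of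
  \<open>t\<close> split off numerator and denominator agree; and \<open>v ^ (Q - 2)\<close> inverts \<open>v\<close> modulo \<open>t\<close>.
\<close>

lemma residue_in_R:
  assumes "ord_ge 0 z"
  shows "\<exists>g\<in>R. ord_ge 1 (z - g)"
proof (cases "ord_ge 1 z")
  case True
  then show ?thesis by (intro bexI[of _ 0]) (auto simp: adjoin_0)
next
  case False
  then have z: "z \<noteq> 0" "P z = 0" using assms not_pos_unit by blast+
  obtain a b where ab: "a \<in> R" "b \<in> R" "b \<noteq> 0" "z = a / b" using frac by blast
  then have "a \<noteq> 0" using z by auto
  obtain N s a' where a': "s \<in> R" "a' \<in> R" "\<not> ord_ge 1 s" "\<not> ord_ge 1 a'" "s * a = t ^ N * a'"
    using extract_parameter ab \<open>a \<noteq> 0\<close> by blast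
  obtain M s' b' where b': "s' \<in> R" "b' \<in> R" "\<not> ord_ge 1 s'" "\<not> ord_ge 1 b'" "s' * b = t ^ M * b'"
    using extract_parameter ab by blast
  have "int N = P a" "int M = P b"
    using order_eq[OF a'] order_eq[OF b'] \<open>a \<noteq> 0\<close> ab P_t by auto
  moreover have "P a = P b" using z ab \<open>a \<noteq> 0\<close> P_divide by auto
  ultimately have "N = M" by simp
  have nz: "s \<noteq> 0" "s' \<noteq> 0" "a' \<noteq> 0" "b' \<noteq> 0" using a' b' by (auto simp: ord_ge_def)
  define u v where "u = s' * a'" and "v = s * b'"
  have uv: "u \<in> R" "v \<in> R" "v \<noteq> 0" using a' b' nz by (auto simp: u_def v_def intro: adjoin_mult)
  have v_unit: "\<not> ord_ge 1 v" unfolding v_def using pos_mult_iff R_nonneg a' b' by blast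
  have "a = t ^ N * a' / s" "b = t ^ M * b' / s'" using a'(5) b'(5) nz by (auto simp: field_simps)
  then have "z = (t ^ N * a' / s) / (t ^ M * b' / s')" using ab(4) by simp
  also have "\<dots> = u / v" using nz t_nz \<open>N = M\<close> by (simp add: u_def v_def field_simps)
  finally have "z = u / v" .
  obtain r where r: "r \<in> R" "v ^ Q - v = t * r" using frob uv by blast
  define g where "g = u * v ^ (Q - 2)"
  have "v ^ Q = v * v * v ^ (Q - 2)"
    using Q_ge_2 by (metis le_add_diff_inverse power2_eq_square power_add)
  then have tr: "t * r = v * v * v ^ (Q - 2) - v" using r(2) by simp
  have "t * (r * u * inverse (v * v)) = (t * r) * (u / (v * v))"
    by (simp add: divide_inverse algebra_simps)
  also have "\<dots> = u * v ^ (Q - 2) - u / v"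
    unfolding tr using \<open>v \<noteq> 0\<close> by (simp add: field_simps)
  finally have zg: "z - g = - (t * (r * u * inverse (v * v)))"
    using \<open>z = u / v\<close> by (simp add: g_def)
  have inv: "ord_ge 0 (inverse (v * v))"
  proof -
    have "P v = 0" using v_unit not_pos_unit[OF R_nonneg[OF uv(2)]] by blast
    then have "P (inverse (v * v)) = 0" using uv(3) P_inverse[of "v * v"] P_mult[of v v] by simp
    then show ?thesis unfolding ord_ge_def by simp
  qed
  have "ord_ge 1 t" using P_t by (simp add: ord_ge_def)
  then have "ord_ge 1 ((r * u * inverse (v * v)) * t)"
    by (intro ord_ge_mult0 inv R_nonneg r(1) uv)
  then have "ord_ge 1 (z - g)"
    unfolding zg by (metis mult.commute ord_ge_minus)
  moreover have "g \<in> R" unfolding g_def using uv by (intro adjoin_mult adjoin_power)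
  ultimately show ?thesis by blast
qed

end

text \<open>
  The factorisation \<open>s g = t ^ N g'\<close> with \<open>s\<close>, \<open>g'\<close> nonzero at \<open>P\<close> determines \<open>P g = N\<close>, and it
  refers to \<open>P\<close> only through the elements of \<open>R\<close> that vanish at \<open>P\<close>.
\<close>

lemma chart_place_unique:
  assumes "chart_place \<iota> S t Q P" "chart_place \<iota> S t Q P'"
    and same: "\<And>g. g \<in> adjoin \<iota> S \<Longrightarrow>
      place_of_ext.ord_ge P 1 g \<longleftrightarrow> place_of_ext.ord_ge P' 1 g"
  shows "P = P'"
proof -
  interpret A: chart_place \<iota> S t Q P by fact
  interpret B: chart_place \<iota> S t Q P' by fact
  have eq: "P g = P' g" if g: "g \<in> adjoin \<iota> S" for g
  proof (cases "g = 0")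
    case False
    obtain N s g' where h: "s \<in> A.R" "g' \<in> A.R" "\<not> A.ord_ge 1 s" "\<not> A.ord_ge 1 g'" "s * g = t ^ N * g'"
      using A.extract_parameter g False by blast
    then have "\<not> B.ord_ge 1 s" "\<not> B.ord_ge 1 g'" using same by auto
    then show ?thesis
      using A.order_eq[OF h False] B.order_eq[of s g' g N] h False A.P_t B.P_t by simp
  qed auto
  show ?thesis
  proof
    fix z
    obtain g h where gh: "g \<in> adjoin \<iota> S" "h \<in> adjoin \<iota> S" "h \<noteq> 0" "z = g / h" using A.frac by blast
    show "P z = P' z"
    proof (cases "g = 0")
      case True
      then show ?thesis using gh by simp
    next
      case False
      then show ?thesis using gh eq by (simp add: A.P_divide B.P_divide)
    qed
  qed
qed

section \<open>Residue fields\<close>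

context field_ext
begin

sublocale over: vector_space "\<lambda>a z. \<iota> a * z"
  by unfold_locales (auto simp: algebra_simps)

text \<open>Complements of a subspace \<open>V\<close> in \<open>U\<close> have the same dimension: projecting along \<open>V\<close>
  embeds one into the other.\<close>

lemma complement_card_le:
  assumes V: "over.subspace V"
    and B: "finite B" "{b + v | b v. b \<in> over.span B \<and> v \<in> V} = U"
    and B': "finite B'" "\<not> over.dependent B'" "over.span B' \<inter> V = {0}"
      "{b + v | b v. b \<in> over.span B' \<and> v \<in> V} = U"
  shows "card B' \<le> card B"
proof -
  have "\<exists>w\<in>over.span B. b - w \<in> V" if "b \<in> B'" for b
  proof -
    have "b + 0 \<in> U" unfolding B'(4)[symmetric]
      using that over.span_base over.subspace_0[OF V] by blast
    then obtain w v where "b = w + v" "w \<in> over.span B" "v \<in> V"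
      unfolding B(2)[symmetric] by auto
    then show ?thesis by (intro bexI[of _ w]) auto
  qed
  then obtain \<pi> where \<pi>: "\<And>b. b \<in> B' \<Longrightarrow> \<pi> b \<in> over.span B" "\<And>b. b \<in> B' \<Longrightarrow> b - \<pi> b \<in> V"
    by metis
  have zero: "c b = 0" if c: "(\<Sum>b\<in>B'. \<iota> (c b) * \<pi> b) = 0" and b: "b \<in> B'" for c b
  proof -
    have "(\<Sum>b\<in>B'. \<iota> (c b) * b) = (\<Sum>b\<in>B'. \<iota> (c b) * (b - \<pi> b))"
      using c by (simp add: right_diff_distrib sum_subtractf)
    also have "\<dots> \<in> V"
      by (intro over.subspace_sum[OF V] over.subspace_scale[OF V] \<pi>)
    finally have "(\<Sum>b\<in>B'. \<iota> (c b) * b) \<in> over.span B' \<inter> V"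
      by (auto intro: over.span_sum over.span_scale over.span_base)
    then have "(\<Sum>b\<in>B'. \<iota> (c b) * b) = 0" using B'(3) by auto
    then show "c b = 0"
      using over.independentD[OF B'(2) B'(1) subset_refl, of c b] b by simp
  qed
  have inj: "inj_on \<pi> B'"
  proof (rule inj_onI)
    fix b1 b2 assume b: "b1 \<in> B'" "b2 \<in> B'" "\<pi> b1 = \<pi> b2"
    have "b1 - b2 = (b1 - \<pi> b1) - (b2 - \<pi> b2)" using b by simp
    also have "\<dots> \<in> V" by (intro over.subspace_diff[OF V] \<pi> b)
    finally have "b1 - b2 \<in> over.span B' \<inter> V"
      using b by (auto intro: over.span_diff over.span_base)
    then show "b1 = b2" using B'(3) by auto
  qed
  have "\<not> over.dependent (\<pi> ` B')"
  proof (rule over.independent_if_scalars_zero)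
    fix c w assume c: "(\<Sum>w\<in>\<pi> ` B'. \<iota> (c w) * w) = 0" and "w \<in> \<pi> ` B'"
    then obtain b where b: "b \<in> B'" "w = \<pi> b" by auto
    have "(\<Sum>b\<in>B'. \<iota> (c (\<pi> b)) * \<pi> b) = 0"
      using c inj by (simp add: sum.reindex)
    then show "c w = 0" using zero[of "\<lambda>b. c (\<pi> b)"] b by simp
  qed (use B' in auto)
  moreover have "\<pi> ` B' \<subseteq> over.span B" using \<pi> by auto
  ultimately have "card (\<pi> ` B') \<le> card B"
    using over.independent_span_bound B(1) by blast
  then show ?thesis by (simp add: card_image inj)
qed

lemma quotient_dim_eq:
  assumes "over.subspace V"
    and B: "finite B" "\<not> over.dependent B" "over.span B \<inter> V = {0}"
      "{b + v | b v. b \<in> over.span B \<and> v \<in> V} = U"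
  shows "quotient_dim \<iota> U V = card B"
  unfolding quotient_dim_def Let_def
proof (rule the_equality)
  show "\<exists>B'. finite B' \<and> card B' = card B \<and> \<not> over.dependent B' \<and> over.span B' \<inter> V = {0} \<and>
      {b + v | b v. b \<in> over.span B' \<and> v \<in> V} = U"
    using B by blast
next
  fix m
  assume "\<exists>B'. finite B' \<and> card B' = m \<and> \<not> over.dependent B' \<and> over.span B' \<inter> V = {0} \<and>
      {b + v | b v. b \<in> over.span B' \<and> v \<in> V} = U"
  then obtain B' where "card B' = m" and B': "finite B'" "\<not> over.dependent B'" "over.span B' \<inter> V = {0}"
      "{b + v | b v. b \<in> over.span B' \<and> v \<in> V} = U" by blast
  moreover have "card B' \<le> card B" "card B \<le> card B'"
    using complement_card_le[OF assms(1) B(1,4) B'] complement_card_le[OF assms(1) B'(1,4) B] by auto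
  ultimately show "m = card B" by simp
qed

end

context place_of_ext
begin

text \<open>
  If the residue of \<open>z\<close> generates the residue field and has minimal polynomial \<open>p\<close>, then the powers of
  \<open>z\<close> below \<open>degree p\<close> span a complement of the maximal ideal in the valuation ring.
\<close>

lemma place_degree_eq:
  assumes z: "ord_ge 0 z" and p: "p \<noteq> 0" and iff: "\<And>g. ord_ge 1 (ev g z) \<longleftrightarrow> p dvd g"
    and gen: "\<And>w. ord_ge 0 w \<Longrightarrow> \<exists>g. ord_ge 1 (w - ev g z)"
  shows "place_degree \<iota> P = degree p"
proof -
  define B where "B = (\<lambda>i. z ^ i) ` {..<degree p}"
  have degp: "degree p > 0"
  proof (rule ccontr)
    assume "\<not> degree p > 0"
    then have "p dvd 1" using p by (simp add: is_unit_iff_degree)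
    then have "ord_ge 1 (ev 1 z)" using iff by blast
    then show False by (simp add: ord_ge_def)
  qed
  have small: "g = 0" if "ord_ge 1 (ev g z)" "degree g < degree p" for g
    using that iff[of g] dvd_imp_degree_le[of p g] by fastforce
  have inj: "inj_on (\<lambda>i. z ^ i) {..<degree p}"
  proof (rule inj_onI)
    fix i j assume ij: "i \<in> {..<degree p}" "j \<in> {..<degree p}" "z ^ i = z ^ j"
    have "degree (monom (1 :: 'k) i - monom 1 j) < degree p"
      using ij by (intro degree_diff_less) (auto simp: degree_monom_eq)
    then have "monom (1 :: 'k) i - monom 1 j = 0"
      using ij by (intro small) auto
    then show "i = j" by (metis degree_monom_eq eq_iff_diff_eq_0 zero_neq_one)
  qed
  have span: "over.span B = {ev g z | g. degree g < degree p}"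
  proof
    show "over.span B \<subseteq> {ev g z | g. degree g < degree p}"
    proof
      fix w assume "w \<in> over.span B"
      then obtain c where "w = (\<Sum>b\<in>B. \<iota> (c b) * b)"
        using over.span_finite[of B] by (auto simp: B_def)
      also have "\<dots> = (\<Sum>i<degree p. \<iota> (c (z ^ i)) * z ^ i)"
        unfolding B_def using inj by (simp add: sum.reindex)
      also have "\<dots> = ev (\<Sum>i<degree p. monom (c (z ^ i)) i) z" by simp
      finally have w: "w = ev (\<Sum>i<degree p. monom (c (z ^ i)) i) z" .
      have "degree (\<Sum>i<degree p. monom (c (z ^ i)) i) < degree p"
        using degp by (intro degree_sum_less) (auto intro: le_less_trans[OF degree_monom_le])
      then show "w \<in> {ev g z | g. degree g < degree p}" using w by blast
    qed
  next
    show "{ev g z | g. degree g < degree p} \<subseteq> over.span B"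
      by (auto simp: ev_eq_sum B_def intro!: over.span_sum over.span_scale over.span_base[OF imageI])
  qed
  have "place_degree \<iota> P = card B"
    unfolding place_degree_def
  proof (rule quotient_dim_eq)
    have eq: "{z. z = 0 \<or> 0 \<le> P z} = {w. ord_ge 0 w}" "{z. z = 0 \<or> 1 \<le> P z} = {w. ord_ge 1 w}"
      by (auto simp: ord_ge_def)
    show "over.subspace {z. z = 0 \<or> 1 \<le> P z}"
      unfolding eq by (rule over.subspaceI) (auto intro: ord_ge_add ord_ge_mult0)
    show "finite B" by (simp add: B_def)
    show "\<not> over.dependent B"
    proof (rule over.independent_if_scalars_zero)
      fix c b assume c: "(\<Sum>b\<in>B. \<iota> (c b) * b) = 0" and "b \<in> B"
      then obtain i where i: "i < degree p" "b = z ^ i" by (auto simp: B_def)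
      let ?g = "\<Sum>i<degree p. monom (c (z ^ i)) i"
      have "ev ?g z = 0" using c inj by (simp add: B_def sum.reindex)
      moreover have "degree ?g < degree p"
        using degp by (intro degree_sum_less) (auto intro: le_less_trans[OF degree_monom_le])
      ultimately have "?g = 0" by (intro small) auto
      then have "coeff ?g i = 0" by simp
      then show "c b = 0" using i by (simp add: coeff_sum coeff_monom)
    qed (simp add: B_def)
    show "over.span B \<inter> {z. z = 0 \<or> 1 \<le> P z} = {0}"
      unfolding eq span
    proof (intro equalityI subsetI)
      fix w assume "w \<in> {ev g z | g. degree g < degree p} \<inter> {w. ord_ge 1 w}"
      then obtain g where "w = ev g z" "degree g < degree p" "ord_ge 1 (ev g z)" by auto
      then show "w \<in> {0}" using small[of g] by simp
    next
      fix w :: 'f assume "w \<in> {0}"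
      then show "w \<in> {ev g z | g. degree g < degree p} \<inter> {w. ord_ge 1 w}"
        using degp by (auto intro!: exI[of _ 0])
    qed
    show "{b + v | b v. b \<in> over.span B \<and> v \<in> {z. z = 0 \<or> 1 \<le> P z}} = {z. z = 0 \<or> 0 \<le> P z}"
      unfolding eq
    proof (intro equalityI subsetI)
      fix w assume "w \<in> {b + v | b v. b \<in> over.span B \<and> v \<in> {w. ord_ge 1 w}}"
      then show "w \<in> {w. ord_ge 0 w}"
        using z by (auto simp: span intro!: ord_ge_add ord_ge_ev intro: ord_ge_mono)
    next
      fix w assume "w \<in> {w. ord_ge 0 w}"
      then obtain g where g: "ord_ge 1 (w - ev g z)" using gen by blast
      have "ord_ge 1 (ev (g div p * p) z)" using iff dvd_triv_right by blast
      then have "ord_ge 1 ((w - ev g z) + ev (g div p * p) z)" by (rule ord_ge_add[OF g])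
      also have "(w - ev g z) + ev (g div p * p) z = w - ev (g mod p) z"
        using ev_add[of "g div p * p" "g mod p" z] by (simp del: ev_add ev_mult add: algebra_simps)
      finally have "ord_ge 1 (w - ev (g mod p) z)" .
      moreover have "degree (g mod p) < degree p"
        using degree_mod_less[OF p, of g] degp by auto
      ultimately show "w \<in> {b + v | b v. b \<in> over.span B \<and> v \<in> {w. ord_ge 1 w}}"
        unfolding span by (intro CollectI exI[of _ "ev (g mod p) z"] exI[of _ "w - ev (g mod p) z"]) auto
    qed
  qed
  then show ?thesis by (simp add: B_def card_image inj)
qed

end

text \<open>
  Modulo \<open>t\<close> the map \<open>g \<mapsto> g ^ (q ^ j)\<close> is a ring homomorphism that fixes \<open>k\<close>, so it suffices
  that it fixes generators.
\<close>

lemma (in finite_field_ext) adjoin_frobenius: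
  assumes gen: "\<And>s. s \<in> S \<Longrightarrow> \<exists>r\<in>adjoin \<iota> S. s ^ (q ^ j) - s = t * r"
    and "g \<in> adjoin \<iota> S"
  shows "\<exists>r\<in>adjoin \<iota> S. g ^ (q ^ j) - g = t * r"
  using assms(2)
proof induction
  case (adjoin_emb a)
  then show ?case by (intro bexI[of _ 0]) (auto simp: adjoin_0 simp flip: hom_power)
next
  case (adjoin_gen g)
  then show ?case by (rule gen)
next
  case (adjoin_add u v)
  then obtain r1 r2 where "r1 \<in> adjoin \<iota> S" "u ^ (q ^ j) - u = t * r1"
    "r2 \<in> adjoin \<iota> S" "v ^ (q ^ j) - v = t * r2" by blast
  moreover have "(u + v) ^ (q ^ j) - (u + v) = (u ^ (q ^ j) - u) + (v ^ (q ^ j) - v)"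
    by (simp add: frobenius_iter)
  ultimately show ?case
    by (intro bexI[of _ "r1 + r2"]) (auto simp: distrib_left intro: adjoin.intros)
next
  case (adjoin_mult u v)
  then obtain r1 r2 where "r1 \<in> adjoin \<iota> S" "u ^ (q ^ j) - u = t * r1"
    "r2 \<in> adjoin \<iota> S" "v ^ (q ^ j) - v = t * r2" by blast
  moreover have "(u * v) ^ (q ^ j) - u * v = u ^ (q ^ j) * (v ^ (q ^ j) - v) + v * (u ^ (q ^ j) - u)"
    by (simp add: algebra_simps power_mult_distrib)
  ultimately have "(u * v) ^ (q ^ j) - u * v = t * (u ^ (q ^ j) * r2 + v * r1)"
    by (simp only: distrib_left mult.left_commute)
  then show ?case using adjoin_mult \<open>r1 \<in> adjoin \<iota> S\<close> \<open>r2 \<in> adjoin \<iota> S\<close>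
    by (intro bexI[of _ "u ^ (q ^ j) * r2 + v * r1"])
      (auto intro: adjoin.adjoin_add adjoin.adjoin_mult adjoin_power)
qed

section \<open>Charts generated by two elements\<close>

text \<open>
  Here \<open>R = k[t, z]\<close>, so that \<open>R / t R\<close> is a quotient of \<open>k[X] / \<chi>\<close>. The places
  at which \<open>t\<close> vanishes correspond to certain monic irreducible factors of \<open>\<chi>\<close>, the minimal
  polynomials of the residue of \<open>z\<close>.
\<close>

locale plane_chart = finite_field_ext \<iota> q for \<iota> :: "'k::{finite,field} \<Rightarrow> 'f::field" and q +
  fixes t z :: 'f and \<chi> :: "'k poly"
  assumes plane_frac: "\<And>w. \<exists>g\<in>adjoin \<iota> {t, z}. \<exists>h\<in>adjoin \<iota> {t, z}. h \<noteq> 0 \<and> w = g / h"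
    and t_nonzero: "t \<noteq> 0"
    and sep: "separable \<chi>"
    and \<chi>_t: "\<exists>r\<in>adjoin \<iota> {t, z}. ev \<chi> z = t * r"
begin

abbreviation "A \<equiv> adjoin \<iota> {t, z}"

definition centered :: "'f place \<Rightarrow> bool" where
  "centered P \<longleftrightarrow> is_place \<iota> P \<and> P t > 0 \<and> place_of_ext.ord_ge P 0 z"

text \<open>
  \<open>\<chi>\<close> divides some \<open>X ^ Q - X\<close>, hence \<open>z ^ Q = z\<close> modulo \<open>t\<close>.
\<close>

lemma exists_chart: "\<exists>Q. chart \<iota> {t, z} t Q"
proof -
  obtain j where j: "j \<ge> 1" "\<chi> dvd monom 1 (q ^ j) - monom 1 1"
    using separable_dvd_frobenius[OF sep] by blast
  define Q where "Q = q ^ j"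
  have Q2: "Q \<ge> 2" using j q_ge_2 self_le_power[of q j] by (simp add: Q_def)
  obtain r where r: "r \<in> A" "ev \<chi> z = t * r" using \<chi>_t by blast
  obtain s where s: "monom 1 Q - monom 1 1 = \<chi> * s" using j by (auto simp: Q_def)
  have gen: "\<exists>r\<in>A. g ^ Q - g = t * r" if "g \<in> {t, z}" for g
  proof -
    consider "g = t" | "g = z" using \<open>g \<in> {t, z}\<close> by auto
    then show ?thesis
    proof cases
      case 1
      have "t ^ Q = t * t ^ (Q - 1)" using Q2 by (metis Suc_diff_1 le_trans not_gr_zero one_le_numeral not_one_le_zero power_Suc)
      then show ?thesis unfolding 1
        by (intro bexI[of _ "t ^ (Q - 1) - 1"] adjoin_diff adjoin_power adjoin_1)
          (auto simp: right_diff_distrib intro: adjoin.intros)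
    next
      case 2
      have "z ^ Q - z = ev (monom 1 Q - monom 1 1) z" by simp
      also have "\<dots> = t * (r * ev s z)" by (simp only: s ev_mult r(2) mult.assoc)
      finally show ?thesis unfolding 2
        by (intro bexI[of _ "r * ev s z"] adjoin_mult r(1) adjoin_ev) (auto intro: adjoin.intros)
    qed
  qed
  have "\<exists>r\<in>A. g ^ Q - g = t * r" if "g \<in> A" for g
    using adjoin_frobenius[of "{t, z}" j t] gen that unfolding Q_def by blast
  then have "chart \<iota> {t, z} t Q"
    using plane_frac t_nonzero Q2 by unfold_locales (auto intro: adjoin.intros)
  then show ?thesis by blast
qed

lemma reduce_mod_t: "g \<in> A \<Longrightarrow> \<exists>p. \<exists>r\<in>A. g = ev p z + t * r"
proof (induction rule: adjoin.induct)
  case (adjoin_emb a)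
  then show ?case by (intro exI[of _ "[:a:]"] bexI[of _ 0]) (auto simp: adjoin_0)
next
  case (adjoin_gen s)
  then consider "s = t" | "s = z" by auto
  then show ?case
  proof cases
    case 1
    then show ?thesis by (intro exI[of _ 0] bexI[of _ 1]) (auto simp: adjoin_1)
  next
    case 2
    then show ?thesis by (intro exI[of _ "monom 1 1"] bexI[of _ 0]) (auto simp: adjoin_0)
  qed
next
  case (adjoin_add u v)
  then obtain p r p' r' where "r \<in> A" "u = ev p z + t * r" "r' \<in> A" "v = ev p' z + t * r'" by blast
  then show ?case
    by (intro exI[of _ "p + p'"] bexI[of _ "r + r'"]) (auto simp: algebra_simps intro: adjoin.intros)
next
  case (adjoin_mult u v)
  then obtain p r p' r' where *: "r \<in> A" "u = ev p z + t * r" "r' \<in> A" "v = ev p' z + t * r'" by blast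
  have "ev p z \<in> A" by (auto intro: adjoin_ev adjoin.intros)
  then have "r * v + ev p z * r' \<in> A"
    using adjoin_mult * by (intro adjoin.adjoin_add adjoin.adjoin_mult)
  moreover have "u * v = ev p z * v + t * (r * v)" "ev p z * v = ev p z * ev p' z + t * (ev p z * r')"
    by (simp_all add: *(2,4) algebra_simps)
  then have "u * v = ev (p * p') z + t * (r * v + ev p z * r')" by (simp add: distrib_left)
  ultimately show ?case by blast
qed

lemma chart_place_at: "chart \<iota> {t, z} t Q \<Longrightarrow> centered P \<Longrightarrow> chart_place \<iota> {t, z} t Q P"
proof -
  assume c: "chart \<iota> {t, z} t Q" and P: "centered P"
  interpret chart \<iota> "{t, z}" t Q by fact
  interpret place_of_ext \<iota> P using P by unfold_locales (auto simp: centered_def)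
  show ?thesis using P by unfold_locales (auto simp: centered_def ord_ge_def)
qed

lemma centered_parameter: "centered P \<Longrightarrow> P t = 1"
  using exists_chart chart_place_at chart_place.P_t by metis

text \<open>
  The minimal polynomial over \<open>k\<close> of the residue of \<open>z\<close> at \<open>P\<close>.
\<close>

definition residue_poly :: "'f place \<Rightarrow> 'k poly" where
  "residue_poly P = (SOME p. monic_irreducible p \<and> (\<forall>g. place_of_ext.ord_ge P 1 (ev g z) \<longleftrightarrow> p dvd g))"

lemma residue_poly:
  assumes "centered P"
  shows "monic_irreducible (residue_poly P)" "place_of_ext.ord_ge P 1 (ev g z) \<longleftrightarrow> residue_poly P dvd g"
    and "residue_poly P dvd \<chi>" "place_degree \<iota> P = degree (residue_poly P)"
proof -
  obtain Q where "chart \<iota> {t, z} t Q" using exists_chart by blast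
  then interpret C: chart_place \<iota> "{t, z}" t Q P using chart_place_at assms by blast
  have z: "C.ord_ge 0 z" using assms by (simp add: centered_def)
  have t: "C.ord_ge 1 t" using C.t_pos by (simp add: C.ord_ge_def)
  have tr: "C.ord_ge 1 (t * r)" if "r \<in> A" for r
    using C.ord_ge_mult0[OF C.R_nonneg[OF that] t] by (simp add: mult.commute)
  have \<chi>: "C.ord_ge 1 (ev \<chi> z)" using \<chi>_t tr by auto
  have "\<exists>p. monic_irreducible p \<and> (\<forall>g. C.ord_ge 1 (ev g z) \<longleftrightarrow> p dvd g)"
    using C.residue_minimal_polynomial z \<chi> separable_nonzero sep by blast
  from someI_ex[OF this, folded residue_poly_def]
  have *: "monic_irreducible (residue_poly P)" "\<And>g. C.ord_ge 1 (ev g z) \<longleftrightarrow> residue_poly P dvd g"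
    by auto
  show "monic_irreducible (residue_poly P)" "C.ord_ge 1 (ev g z) \<longleftrightarrow> residue_poly P dvd g"
    by (fact *)+
  show "residue_poly P dvd \<chi>" using * \<chi> by blast
  have "\<exists>g. C.ord_ge 1 (w - ev g z)" if w: "C.ord_ge 0 w" for w
  proof -
    obtain g where g: "g \<in> A" "C.ord_ge 1 (w - g)" using C.residue_in_R w by blast
    obtain p r where "r \<in> A" "g = ev p z + t * r" using reduce_mod_t g by blast
    then have "w - ev p z = (w - g) + t * r" by simp
    then have "C.ord_ge 1 (w - ev p z)" using g tr[OF \<open>r \<in> A\<close>] by (simp only: C.ord_ge_add)
    then show ?thesis by blast
  qed
  then show "place_degree \<iota> P = degree (residue_poly P)"
    using * z by (intro C.place_degree_eq) auto
qed

text \<open>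
  Modulo \<open>t\<close> an element of \<open>R\<close> is a polynomial in \<open>z\<close>, and such a polynomial vanishes at \<open>P\<close> if
  and only if the residue polynomial divides it.
\<close>

lemma residue_poly_inj:
  assumes "centered P" "centered P'" "residue_poly P = residue_poly P'"
  shows "P = P'"
proof -
  obtain Q where Q: "chart \<iota> {t, z} t Q" using exists_chart by blast
  interpret C: chart_place \<iota> "{t, z}" t Q P using chart_place_at Q assms by blast
  interpret C': chart_place \<iota> "{t, z}" t Q P' using chart_place_at Q assms by blast
  have t: "C.ord_ge 1 t" "C'.ord_ge 1 t" using C.t_pos C'.t_pos by (simp_all add: C.ord_ge_def C'.ord_ge_def)
  show ?thesis
  proof (rule chart_place_unique)
    fix g assume "g \<in> A"
    then obtain p r where r: "r \<in> A" "g = ev p z + t * r" using reduce_mod_t by blast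
    have tr: "C.ord_ge 1 (t * r)" "C'.ord_ge 1 (t * r)"
      using C.ord_ge_mult0[OF C.R_nonneg[OF r(1)] t(1)] C'.ord_ge_mult0[OF C'.R_nonneg[OF r(1)] t(2)]
      by (simp_all add: mult.commute)
    have "ev p z = g - t * r" using r by simp
    then have "C.ord_ge 1 g \<longleftrightarrow> C.ord_ge 1 (ev p z)" "C'.ord_ge 1 g \<longleftrightarrow> C'.ord_ge 1 (ev p z)"
      using tr r(2) C.ord_ge_add C.ord_ge_diff C'.ord_ge_add C'.ord_ge_diff by metis+
    then show "C.ord_ge 1 g \<longleftrightarrow> C'.ord_ge 1 g"
      using residue_poly(2)[OF assms(1)] residue_poly(2)[OF assms(2)] assms(3) by simp
  qed unfold_locales
qed

lemma finite_centered: "finite {P. centered P}"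
proof (rule finite_imageD)
  show "finite (residue_poly ` {P. centered P})"
    by (rule finite_subset[of _ "{p. monic_irreducible p \<and> p dvd \<chi>}"])
       (use residue_poly separable_sum_degree_factors[OF sep] in auto)
  show "inj_on residue_poly {P. centered P}" using residue_poly_inj by (auto intro!: inj_onI)
qed

end

section \<open>Derivations and orders of differentials\<close>

lemma (in field_ext) derivation_power:
  assumes "is_derivation \<iota> \<theta>"
  shows "\<theta> (u ^ m) = of_nat m * u ^ (m - 1) * \<theta> u"
proof (induction m)
  case 0
  then show ?case using assms hom_1 unfolding is_derivation_def by (metis mult_zero_left of_nat_0 power_0)
next
  case (Suc m)
  have "\<theta> (u ^ Suc m) = u * \<theta> (u ^ m) + u ^ m * \<theta> u"
    using assms by (simp add: is_derivation_def)
  then show ?case using Suc by (cases m) (auto simp: algebra_simps)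
qed

lemma (in field_ext) derivation_ev:
  assumes "is_derivation \<iota> \<theta>"
  shows "\<theta> (ev g u) = ev (pderiv g) u * \<theta> u"
proof (induction g)
  case 0
  then show ?case using assms hom_0 unfolding is_derivation_def by (metis ev_0 mult_zero_left pderiv_0)
next
  case (pCons a g)
  have "\<theta> (ev (pCons a g) u) = u * \<theta> (ev g u) + ev g u * \<theta> u"
    using assms by (simp add: is_derivation_def)
  then show ?case using pCons by (simp add: pderiv_pCons algebra_simps)
qed

text \<open>
  \<open>F\<close> is generated by \<open>x\<close> over its subfield of \<open>q\<close>-th powers, so it has dimension at
  most \<open>q\<close> over that subfield. The powers \<open>t ^ i\<close>, \<open>i < q\<close>, of a uniformiser \<open>t\<close> have orders
  that differ modulo \<open>q\<close> and are therefore a basis. In this basis \<open>d/dt\<close> acts by formal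
  differentiation, and orders can be read off term by term.
\<close>

locale frobenius_generated = finite_field_ext \<iota> q for \<iota> :: "'k::{finite,field} \<Rightarrow> 'f::field" and q +
  fixes x :: 'f
  assumes generated: "\<exists>p. w = poly_at (\<lambda>a. a ^ q) p x"
begin

sublocale fr: field_ext "\<lambda>a :: 'f. a ^ q"
  by unfold_locales (rule frobenius_field_embedding)

lemma fr_generated: "\<exists>p. w = fr.ev p x"
  using generated[of w] by (simp add: fr.poly_at_eq)

text \<open>
  Read with each coefficient \<open>a\<close> replaced by \<open>a ^ q\<close>, this is \<open>X ^ q - u ^ q\<close>, which vanishes
  at \<open>u\<close>.
\<close>

definition relation :: "'f \<Rightarrow> 'f poly" where
  "relation u = monom 1 q - [:u:]"

lemma relation_degree: "degree (relation u) = q"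
proof -
  have "degree (monom 1 q - [:u:]) = degree (monom (1 :: 'f) q)"
    unfolding diff_conv_add_uminus by (rule degree_add_eq_left) (simp add: degree_monom_eq)
  then show ?thesis by (simp add: relation_def degree_monom_eq)
qed

lemma relation_ev: "fr.ev (relation u) u = 0"
  by (simp add: relation_def)

lemma relation_pderiv: "pderiv (relation u) = 0"
  by (simp add: relation_def pderiv_diff pderiv_monom)

lemma fr_ev_mod: "fr.ev (p mod relation u) u = fr.ev p u"
proof -
  have "fr.ev p u = fr.ev (p div relation u * relation u + p mod relation u) u"
    by (simp only: div_mult_mod_eq)
  then show ?thesis by (simp only: fr.ev_add fr.ev_mult relation_ev) simp
qed

lemma mod_relation_degree: "degree (p mod relation u) < q"
  using degree_mod_less[of "relation u" p] relation_degree[of u] q_pos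
  by (metis degree_0 less_irrefl)

end

locale frobenius_place = frobenius_generated \<iota> q x + place_of_ext \<iota> P
  for \<iota> :: "'k::{finite,field} \<Rightarrow> 'f::field" and q x P +
  fixes t :: 'f
  assumes t_uniformizer: "P t = 1"
begin

lemma t_neq_0: "t \<noteq> 0"
  using t_uniformizer by auto

text \<open>
  The nonzero terms \<open>a\<^sub>i ^ q t ^ i\<close> have orders congruent to \<open>i\<close> modulo \<open>q\<close>, hence distinct.
\<close>

lemma order_fr_ev:
  assumes "p \<noteq> 0" "degree p < q"
  shows "fr.ev p t \<noteq> 0"
    and "coeff p i \<noteq> 0 \<Longrightarrow> P (fr.ev p t) \<le> int q * P (coeff p i) + int i"
proof -
  let ?I = "{i. i < q \<and> coeff p i \<noteq> 0}" and ?\<tau> = "\<lambda>i. coeff p i ^ q * t ^ i"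
  have ev: "fr.ev p t = (\<Sum>i\<in>?I. ?\<tau> i)"
    unfolding fr.ev_eq_sum[OF assms(2)] by (rule sum.mono_neutral_right) auto
  have ord: "P (?\<tau> i) = int q * P (coeff p i) + int i" if "i \<in> ?I" for i
    using that t_neq_0 t_uniformizer by (simp add: P_mult P_power)
  have "inj_on (\<lambda>i. P (?\<tau> i)) ?I"
  proof (rule inj_onI)
    fix i j assume ij: "i \<in> ?I" "j \<in> ?I" "P (?\<tau> i) = P (?\<tau> j)"
    then have "int q * P (coeff p i) + int i = int q * P (coeff p j) + int j" by (simp only: ord)
    then have "(int q * P (coeff p i) + int i) mod int q = (int q * P (coeff p j) + int j) mod int q"
      by simp
    then have "int i mod int q = int j mod int q" by simp
    then show "i = j" using ij by simp
  qed
  moreover have "degree p \<in> ?I" using assms by auto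
  then have "?I \<noteq> {}" by blast
  ultimately have D: "(\<Sum>i\<in>?I. ?\<tau> i) \<noteq> 0 \<and> (\<exists>j\<in>?I. P (\<Sum>i\<in>?I. ?\<tau> i) = P (?\<tau> j)) \<and> (\<forall>i\<in>?I. P (\<Sum>i\<in>?I. ?\<tau> i) \<le> P (?\<tau> i))"
    using t_neq_0 by (intro distinct_orders) auto
  then show "fr.ev p t \<noteq> 0" unfolding ev by blast
  assume i: "coeff p i \<noteq> 0"
  then have "i \<in> ?I" using assms(2) le_degree[of p i] by auto
  then show "P (fr.ev p t) \<le> int q * P (coeff p i) + int i"
    using D ord[OF \<open>i \<in> ?I\<close>] unfolding ev by (metis (no_types, lifting))
qed

lemma uniformizer_powers_inj: "inj_on (\<lambda>i. t ^ i) {..<q}"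
proof (rule inj_onI)
  fix i j assume "t ^ i = t ^ j"
  then have "P (t ^ i) = P (t ^ j)" by simp
  then show "i = j" using t_neq_0 t_uniformizer by (simp add: P_power)
qed

text \<open>
  The \<open>q\<close> independent powers of \<open>t\<close> live in a space spanned by the \<open>q\<close> elements \<open>x ^ i\<close>.
\<close>

lemma uniformizer_basis: "\<exists>p. degree p < q \<and> w = fr.ev p t"
proof -
  let ?X = "(\<lambda>i. x ^ i) ` {..<q}" and ?T = "(\<lambda>i. t ^ i) ` {..<q}"
  have X: "v \<in> fr.over.span ?X" for v
  proof -
    obtain p where "v = fr.ev p x" using fr_generated by blast
    then have "v = (\<Sum>i<q. coeff (p mod relation x) i ^ q * x ^ i)"
      using fr.ev_eq_sum[OF mod_relation_degree[of p x], of x] fr_ev_mod[of p x] by simp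
    then show ?thesis
      by (auto intro!: fr.over.span_sum fr.over.span_scale fr.over.span_base[OF imageI])
  qed
  have T: "\<not> fr.over.dependent ?T"
  proof (rule fr.over.independent_if_scalars_zero)
    fix c b assume c: "(\<Sum>b\<in>?T. c b ^ q * b) = 0" and "b \<in> ?T"
    then obtain i where i: "i < q" "b = t ^ i" by auto
    let ?g = "\<Sum>i<q. monom (c (t ^ i)) i"
    have "fr.ev ?g t = 0" using c uniformizer_powers_inj by (simp add: sum.reindex)
    moreover have "degree ?g < q"
      by (intro degree_sum_less) (auto intro: le_less_trans[OF degree_monom_le])
    ultimately have "?g = 0" using order_fr_ev(1) by blast
    then have "coeff ?g i = 0" by simp
    then show "c b = 0" using i by (simp add: coeff_sum coeff_monom)
  qed auto
  have "w \<in> fr.over.span ?T"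
  proof (rule ccontr)
    assume w: "w \<notin> fr.over.span ?T"
    then have "\<not> fr.over.dependent (insert w ?T)" using T by (rule fr.over.independent_insertI)
    then have "card (insert w ?T) \<le> card ?X"
      using fr.over.independent_span_bound[of ?X "insert w ?T"] X by auto
    also have "\<dots> \<le> q" using card_image_le[of "{..<q}"] by simp
    finally show False
      using w fr.over.span_base[of w ?T] by (auto simp: card_insert_if card_image uniformizer_powers_inj split: if_splits)
  qed
  then obtain c where "w = (\<Sum>b\<in>?T. c b ^ q * b)"
    using fr.over.span_finite[of ?T] by auto
  also have "\<dots> = fr.ev (\<Sum>i<q. monom (c (t ^ i)) i) t"
    using uniformizer_powers_inj by (simp add: sum.reindex)
  finally have "w = fr.ev (\<Sum>i<q. monom (c (t ^ i)) i) t" .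
  moreover have "degree (\<Sum>i<q. monom (c (t ^ i)) i) < q"
    by (intro degree_sum_less) (auto intro: le_less_trans[OF degree_monom_le])
  ultimately show ?thesis by blast
qed

text \<open>Formal differentiation is well defined because all relations satisfied by \<open>t\<close> are multiples
  of \<open>relation t\<close>, whose derivative vanishes because \<open>q = 0\<close> in \<open>k\<close>.\<close>

lemma pderiv_well_defined:
  assumes "fr.ev p t = 0"
  shows "fr.ev (pderiv p) t = 0"
proof -
  have "p mod relation t = 0"
    using order_fr_ev(1) mod_relation_degree fr_ev_mod assms by metis
  then have p: "p = relation t * (p div relation t)" by (metis add.right_neutral mult_div_mod_eq)
  have "pderiv p = relation t * pderiv (p div relation t)"
    by (subst p) (simp add: pderiv_mult relation_pderiv)
  then show ?thesis by (simp add: relation_ev)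
qed

definition ddt :: "'f \<Rightarrow> 'f" where
  "ddt w = fr.ev (pderiv (SOME p. fr.ev p t = w)) t"

lemma ddt_ev: "ddt (fr.ev p t) = fr.ev (pderiv p) t"
proof -
  let ?p = "SOME p'. fr.ev p' t = fr.ev p t"
  have "fr.ev ?p t = fr.ev p t" by (rule someI[of _ p]) simp
  then have "fr.ev (?p - p) t = 0" by simp
  then have "fr.ev (pderiv (?p - p)) t = 0" by (rule pderiv_well_defined)
  then show ?thesis by (simp add: ddt_def pderiv_diff)
qed

lemma ddt_derivation: "is_derivation \<iota> ddt"
  unfolding is_derivation_def
proof (intro conjI allI)
  fix a
  have "ddt (fr.ev [:\<iota> a:] t) = 0" by (simp only: ddt_ev) simp
  then show "ddt (\<iota> a) = 0" by (simp flip: hom_power)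
next
  fix u v
  obtain p r where pr: "u = fr.ev p t" "v = fr.ev r t" using uniformizer_basis by metis
  show "ddt (u + v) = ddt u + ddt v"
    unfolding pr by (simp only: ddt_ev pderiv_add flip: fr.ev_add)
  show "ddt (u * v) = u * ddt v + v * ddt u"
    unfolding pr by (simp only: ddt_ev flip: fr.ev_mult) (simp add: pderiv_mult)
qed

lemma ddt_t: "ddt t = 1"
  using ddt_ev[of "monom 1 1"] by (simp add: pderiv_monom)

lemma derivation_fr_ev:
  assumes "is_derivation \<iota> \<theta>" "\<theta> t = 1"
  shows "\<theta> (fr.ev p t) = fr.ev (pderiv p) t"
proof (induction p)
  case 0
  then show ?case using derivation_ev[OF assms(1), of 0] by simp
next
  case (pCons a p)
  have "\<theta> (a ^ q) = 0" using derivation_power[OF assms(1), of a q] by simp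
  then have "\<theta> (fr.ev (pCons a p) t) = t * \<theta> (fr.ev p t) + fr.ev p t"
    using assms by (simp add: is_derivation_def)
  then show ?case using pCons by (simp add: pderiv_pCons)
qed

text \<open>
  If \<open>\<Sum> a\<^sub>i ^ q t ^ i\<close> is integral at \<open>P\<close>, then so is every \<open>a\<^sub>i\<close>, since no cancellation can take
  place and \<open>i < q\<close>.
\<close>

lemma derivation_preserves_integers:
  assumes "is_derivation \<iota> \<theta>" "\<theta> t = 1" "ord_ge 0 w"
  shows "ord_ge 0 (\<theta> w)"
proof (cases "w = 0")
  case True
  then show ?thesis using derivation_ev[OF assms(1), of 0] by simp
next
  case False
  obtain p where p: "degree p < q" "w = fr.ev p t" using uniformizer_basis by blast
  have coeff: "ord_ge 0 (coeff p i)" for i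
  proof (cases "coeff p i = 0")
    case nz: False
    have "0 \<le> P w" using assms(3) False by (simp add: ord_ge_def)
    also have "\<dots> \<le> int q * P (coeff p i) + int i"
      using order_fr_ev(2)[of p i] p nz by (metis coeff_0)
    finally have "0 \<le> int q * P (coeff p i) + int i" .
    moreover have "i < q" using p(1) le_degree[OF nz] by simp
    ultimately have "0 < int q * (P (coeff p i) + 1)" by (simp add: distrib_left)
    then have "0 < P (coeff p i) + 1" by (simp add: zero_less_mult_iff)
    then show ?thesis by (simp add: ord_ge_def)
  qed simp
  have nat: "ord_ge 0 (of_nat m)" for m using ord_ge_emb[of "of_nat m"] by simp
  have "fr.ev (pderiv p) t = (\<Sum>i<Suc (degree (pderiv p)). coeff (pderiv p) i ^ q * t ^ i)"
    by (rule fr.ev_eq_sum) simp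
  moreover have "ord_ge 0 (coeff (pderiv p) i ^ q * t ^ i)" for i
  proof -
    have "ord_ge 0 (coeff (pderiv p) i)"
      unfolding coeff_pderiv by (rule ord_ge_mult0[OF nat coeff])
    moreover have "ord_ge 0 t" using t_uniformizer by (simp add: ord_ge_def)
    ultimately show ?thesis by (intro ord_ge_mult0 ord_ge_power)
  qed
  ultimately have "ord_ge 0 (fr.ev (pderiv p) t)"
    by (simp only:) (intro ord_ge_sum)
  then show ?thesis using derivation_fr_ev[OF assms(1,2)] p by simp
qed

text \<open>
  Write \<open>w = t ^ N u\<close> with a unit \<open>u\<close>; then \<open>\<theta> w = N t ^ (N - 1) u + t ^ N \<theta> u\<close>, and \<open>\<theta> u\<close> is
  integral.
\<close>

lemma derivation_order:
  assumes \<theta>: "is_derivation \<iota> \<theta>" "\<theta> t = 1"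
    and w: "w \<noteq> 0" "P w = int N" and N: "of_nat N \<noteq> (0 :: 'k)"
  shows "\<theta> w \<noteq> 0 \<and> P (\<theta> w) = int N - 1"
proof -
  define u where "u = w / t ^ N"
  have wu: "w = t ^ N * u" using t_neq_0 by (simp add: u_def)
  have u: "u \<noteq> 0" "P u = 0"
    using w t_neq_0 t_uniformizer by (auto simp: u_def P_divide P_power)
  have "N > 0" using N by (cases N) auto
  have N': "of_nat N \<noteq> (0 :: 'f)" "P (of_nat N) = 0"
    using N emb_eq_0_iff[of "of_nat N"] P_emb[of "of_nat N"] by simp_all
  have lead: "of_nat N * t ^ (N - 1) * u \<noteq> 0" "P (of_nat N * t ^ (N - 1) * u) = int N - 1"
    using N' u t_neq_0 t_uniformizer \<open>N > 0\<close> by (auto simp: P_mult P_power of_nat_diff)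
  have "\<theta> w = t ^ N * \<theta> u + u * \<theta> (t ^ N)"
    using \<theta>(1) unfolding wu by (simp add: is_derivation_def)
  also have "\<dots> = of_nat N * t ^ (N - 1) * u + \<theta> u * t ^ N"
    using derivation_power[OF \<theta>(1), of t N] \<theta>(2) by (simp add: algebra_simps)
  finally have sum: "\<theta> w = of_nat N * t ^ (N - 1) * u + \<theta> u * t ^ N" .
  have "ord_ge 0 (\<theta> u)" by (rule derivation_preserves_integers[OF \<theta>]) (simp add: u ord_ge_def)
  moreover have "ord_ge (int N) (t ^ N)" using t_neq_0 t_uniformizer by (simp add: ord_ge_def P_power)
  ultimately have "ord_ge (int N) (\<theta> u * t ^ N)" by (rule ord_ge_mult0)
  then show ?thesis
    unfolding sum using P_add_lt[OF lead(1)] lead(2) by simp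
qed

end

lemma (in frobenius_generated) differential_order_eq:
  assumes "is_place \<iota> P" "h \<noteq> 0"
    and ord: "\<And>t \<theta>. P t = 1 \<Longrightarrow> is_derivation \<iota> \<theta> \<Longrightarrow> \<theta> t = 1 \<Longrightarrow> \<theta> g \<noteq> 0 \<and> P (\<theta> g) = m"
  shows "differential_order \<iota> P h g = P h + m"
proof -
  interpret place_of_ext \<iota> P using assms(1) by unfold_locales
  obtain t where t: "P t = 1" using exists_uniformizer by blast
  interpret frobenius_place \<iota> q x P t using t by unfold_locales
  have P_h: "P (h * \<theta> g) = P h + m" if "P t = 1" "is_derivation \<iota> \<theta>" "\<theta> t = 1" for t \<theta>
    using ord[OF that] assms(2) by (simp add: P_mult)
  show ?thesis
    unfolding differential_order_def
  proof (rule the_equality)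
    show "\<exists>t \<theta>. P t = 1 \<and> is_derivation \<iota> \<theta> \<and> \<theta> t = 1 \<and> P h + m = P (h * \<theta> g)"
      using t ddt_derivation ddt_t P_h by metis
  qed (use P_h in auto)
qed

section \<open>Linear independence of the powers of y\<close>

text \<open>
  Gaussian elimination without division.
\<close>

lemma linear_dependence:
  fixes v :: "'b \<Rightarrow> nat \<Rightarrow> 'a::idom"
  assumes "finite J" "card J > m"
  shows "\<exists>c. (\<exists>j\<in>J. c j \<noteq> 0) \<and> (\<forall>i<m. (\<Sum>j\<in>J. c j * v j i) = 0)"
  using assms
proof (induction m arbitrary: J v)
  case 0
  then show ?case by (intro exI[of _ "\<lambda>_. 1"]) (auto simp: card_gt_0_iff)
next
  case (Suc m)
  show ?case
  proof (cases "\<forall>j\<in>J. v j m = 0")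
    case True
    obtain c where "\<exists>j\<in>J. c j \<noteq> 0" "\<forall>i<m. (\<Sum>j\<in>J. c j * v j i) = 0"
      using Suc.IH[of J v] Suc.prems by auto
    then show ?thesis using True by (intro exI[of _ c]) (auto simp: less_Suc_eq)
  next
    case False
    then obtain j0 where j0: "j0 \<in> J" "v j0 m \<noteq> 0" by blast
    define a where "a = v j0 m"
    define J' where "J' = J - {j0}"
    have J': "finite J'" "card J' > m" "J = insert j0 J'" "j0 \<notin> J'"
      using Suc.prems j0 by (auto simp: J'_def)
    obtain c' where c': "\<exists>j\<in>J'. c' j \<noteq> 0"
      "\<And>i. i < m \<Longrightarrow> (\<Sum>j\<in>J'. c' j * (a * v j i - v j m * v j0 i)) = 0"
      using Suc.IH[OF J'(1,2), of "\<lambda>j i. a * v j i - v j m * v j0 i"] by blast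
    define c where "c = (\<lambda>j. if j = j0 then - (\<Sum>j\<in>J'. c' j * v j m) else a * c' j)"
    have sum: "(\<Sum>j\<in>J. c j * v j i) = (\<Sum>j\<in>J'. c' j * (a * v j i - v j m * v j0 i))" for i
    proof -
      have "(\<Sum>j\<in>J'. c j * v j i) = (\<Sum>j\<in>J'. a * c' j * v j i)"
        using J'(4) by (intro sum.cong) (auto simp: c_def)
      then show ?thesis using J'
        by (simp add: c_def sum_distrib_left sum_distrib_right sum_subtractf algebra_simps)
    qed
    have "(\<Sum>j\<in>J. c j * v j i) = 0" if "i < Suc m" for i
    proof (cases "i = m")
      case True
      then show ?thesis unfolding sum by (simp add: a_def mult.commute)
    next
      case False
      then show ?thesis unfolding sum using c'(2) that by simp
    qed
    moreover have "\<exists>j\<in>J. c j \<noteq> 0" using c'(1) j0 J' by (auto simp: c_def a_def)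
    ultimately show ?thesis by blast
  qed
qed

lemma (in finite_field_ext) frobenius_sum: "(\<Sum>i\<in>I. g i :: 'f) ^ q = (\<Sum>i\<in>I. g i ^ q)"
  by (induction I rule: infinite_finite_induct) (auto simp: power_0_left)

lemma irreducible_decompose:
  fixes p a :: "'a::field poly"
  assumes "irreducible p" "a \<noteq> 0"
  shows "\<exists>k b. a = p ^ k * b \<and> \<not> p dvd b"
  using assms(2)
proof (induction "degree a" arbitrary: a rule: less_induct)
  case less
  show ?case
  proof (cases "p dvd a")
    case False
    then show ?thesis by (intro exI[of _ 0] exI[of _ a]) auto
  next
    case True
    then obtain c where c: "a = p * c" by auto
    then have "c \<noteq> 0" "degree c < degree a"
      using less.prems irreducible_degree_pos[OF assms(1)] by (auto simp: degree_mult_eq)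
    then obtain k b where "c = p ^ k * b" "\<not> p dvd b" using less.hyps by blast
    then show ?thesis using c by (intro exI[of _ "Suc k"] exI[of _ b]) (auto simp: mult_ac)
  qed
qed

lemma irreducible_power_cancel:
  fixes p b c :: "'a::field poly"
  assumes irr: "irreducible p" and "p ^ k * b = p ^ l * c" "\<not> p dvd b" "\<not> p dvd c"
  shows "k = l"
proof -
  have "\<not> k < l" if "p ^ k * b = p ^ l * c" "\<not> p dvd b" for k l and b c :: "'a poly"
  proof
    assume "k < l"
    then have "p ^ l = p ^ k * (p * p ^ (l - Suc k))"
      by (metis Suc_diff_Suc le_add_diff_inverse less_imp_le power_Suc power_add)
    then have "b = p * p ^ (l - Suc k) * c" using that(1) irr by (auto simp: mult.assoc)
    then show False using that(2) by (metis dvd_mult2 dvd_triv_left)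
  qed
  then show ?thesis using assms by (metis linorder_neqE_nat)
qed

locale kummer_point = finite_field_ext \<iota> q for \<iota> :: "'k::{finite,field} \<Rightarrow> 'f::field" and q +
  fixes x y :: 'f and n :: nat and f :: "'k poly"
  assumes transcendental: "\<And>p. p \<noteq> 0 \<Longrightarrow> ev p x \<noteq> 0"
    and equation: "y ^ n = ev f x"
    and n_pos: "n > 0" and n_dvd: "n dvd q - 1"
    and f_sep: "separable f" and f_deg: "degree f > 0"
begin

lemma ev_eq_0_iff [simp]: "ev p x = 0 \<longleftrightarrow> p = 0"
  using transcendental by (cases "p = 0") auto

lemma y_nonzero: "y \<noteq> 0"
proof
  assume "y = 0"
  then have "ev f x = 0" using equation n_pos by (metis zero_power)
  then show False using f_deg by auto
qed

lemma y_frobenius: "y ^ q = ev (f ^ ((q - 1) div n)) x * y"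
proof -
  have "y ^ q = y ^ (n * ((q - 1) div n)) * y"
    using n_dvd q_pos by (metis Suc_diff_1 dvd_mult_div_cancel power_Suc2)
  also have "y ^ (n * ((q - 1) div n)) = ev (f ^ ((q - 1) div n)) x"
    by (simp add: power_mult equation)
  finally show ?thesis .
qed

text \<open>
  Compare a shortest relation \<open>\<Sum> g\<^sub>i y ^ i = 0\<close> with its \<open>q\<close>-th power, in which
  \<open>y ^ (q i) = f ^ (i (q - 1) / n) y ^ i\<close>. They must be proportional, so that
  \<open>(g\<^sub>i / g\<^sub>j) ^ (q - 1) = f ^ ((j - i) (q - 1) / n)\<close>, and the multiplicity of a
  simple factor of \<open>f\<close> shows that \<open>n\<close> divides \<open>j - i\<close>.
\<close>

lemma powers_independent:
  fixes G :: "'k poly poly"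
  assumes "degree G < n" "two.ev x G y = 0"
  shows "G = 0"
  using assms
proof (induction "card {i. coeff G i \<noteq> 0}" arbitrary: G rule: less_induct)
  case less
  show ?case
  proof (rule ccontr)
    assume "G \<noteq> 0"
    define j where "j = degree G"
    define m where "m = (q - 1) div n"
    have nm: "n * m = q - 1" using n_dvd by (simp add: m_def)
    have m: "m > 0" using nm q_ge_2 by (cases m) auto
    have gj: "coeff G j \<noteq> 0" using \<open>G \<noteq> 0\<close> by (simp add: j_def)
    define G' where "G' = (\<Sum>i<n. monom (coeff G i ^ q * f ^ (i * m)) i)"
    have coeff_G': "coeff G' i = (if i < n then coeff G i ^ q * f ^ (i * m) else 0)" for i
      by (simp add: G'_def coeff_sum coeff_monom)
    have "two.ev x G' y = (\<Sum>i<n. ev (coeff G i) x ^ q * (ev (f ^ m) x ^ i * y ^ i))"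
      by (simp add: G'_def power_mult mult.commute[of _ m] mult.assoc)
    also have "\<dots> = (\<Sum>i<n. (ev (coeff G i) x * y ^ i) ^ q)"
    proof (rule sum.cong[OF refl])
      fix i
      have "(y ^ i) ^ q = (y ^ q) ^ i" by (simp add: mult.commute flip: power_mult)
      then show "ev (coeff G i) x ^ q * (ev (f ^ m) x ^ i * y ^ i) = (ev (coeff G i) x * y ^ i) ^ q"
        by (simp only: power_mult_distrib y_frobenius m_def)
    qed
    also have "\<dots> = two.ev x G y ^ q"
      by (simp add: two.ev_eq_sum[OF less.prems(1)] frobenius_sum)
    finally have G': "two.ev x G' y = 0" using less.prems(2) by (simp add: power_0_left)
    define H where "H = smult (coeff G j ^ q * f ^ (j * m)) G - smult (coeff G j) G'"
    have coeff_H: "coeff H i = (if i < n then coeff G j * coeff G i * (coeff G j ^ (q - 1) * f ^ (j * m) - coeff G i ^ (q - 1) * f ^ (i * m)) else 0)" for i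
    proof -
      have pw: "g ^ q = g * g ^ (q - 1)" for g :: "'k poly"
        using q_pos by (metis Suc_diff_1 power_Suc)
      show ?thesis
        using less.prems(1) by (auto simp: H_def coeff_G' coeff_eq_0 pw right_diff_distrib mult_ac)
    qed
    have "H = 0"
    proof (rule less.hyps)
      have "{i. coeff H i \<noteq> 0} \<subset> {i. coeff G i \<noteq> 0}"
        using gj by (auto simp: coeff_H split: if_splits)
      moreover have "finite {i. coeff G i \<noteq> 0}"
        by (rule finite_subset[of _ "{..degree G}"]) (auto intro: le_degree)
      ultimately show "card {i. coeff H i \<noteq> 0} < card {i. coeff G i \<noteq> 0}" by (rule psubset_card_mono[rotated])
      show "degree H < n"
        by (rule degree_lessI) (use n_pos coeff_H in auto)
      show "two.ev x H y = 0" by (simp add: H_def less.prems(2) G')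
    qed
    then have proportional: "coeff G j ^ (q - 1) * f ^ (j * m) = coeff G i ^ (q - 1) * f ^ (i * m)"
      if "coeff G i \<noteq> 0" for i
      using coeff_H[of i] that gj less.prems(1) le_degree[OF that] by auto
    have single: "i = j" if i: "coeff G i \<noteq> 0" for i
    proof -
      obtain p where p: "monic_irreducible p" "p dvd f"
        using exists_monic_irreducible_factor f_deg by blast
      then obtain s where s: "f = p * s" by auto
      have irr: "irreducible p" using p by blast
      have s0: "\<not> p dvd s" using separable_irreducible_factor f_sep s p by blast
      obtain a b where ab: "coeff G j = p ^ a * b" "\<not> p dvd b"
        using irreducible_decompose irr gj by blast
      obtain a' b' where ab': "coeff G i = p ^ a' * b'" "\<not> p dvd b'"
        using irreducible_decompose irr i by blast
      have shape: "(p ^ k * r) ^ (q - 1) * f ^ l = p ^ (n * m * k + l) * (r ^ (q - 1) * s ^ l)" for k r l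
      proof -
        have "(p ^ k * r) ^ (q - 1) = p ^ (n * m * k) * r ^ (q - 1)"
          unfolding nm by (metis power_mult_distrib power_mult mult.commute)
        moreover have "f ^ l = p ^ l * s ^ l" by (simp add: s power_mult_distrib)
        ultimately show ?thesis by (simp only: power_add mult_ac)
      qed
      have "p ^ (n * m * a + j * m) * (b ^ (q - 1) * s ^ (j * m)) = p ^ (n * m * a' + i * m) * (b' ^ (q - 1) * s ^ (i * m))"
        using proportional[OF i] by (simp only: ab(1) ab'(1) shape)
      moreover have "\<not> p dvd r ^ (q - 1) * s ^ l" if "\<not> p dvd r" for r l
        using irreducible_dvd_power[OF irr] irreducible_dvd_mult[OF irr] s0 that by blast
      ultimately have "n * m * a + j * m = n * m * a' + i * m"
        using irreducible_power_cancel[OF irr] ab(2) ab'(2) by blast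
      then have "m * (n * a + j) = m * (n * a' + i)"
        by (simp add: algebra_simps)
      then have "(n * a + j) mod n = (n * a' + i) mod n"
        using m by simp
      then have "j mod n = i mod n" by simp
      moreover have "i \<le> j" using le_degree[OF i] by (simp add: j_def)
      ultimately show "i = j" using less.prems(1) by (simp add: j_def)
    qed
    have "G = monom (coeff G j) j"
      by (rule poly_eqI) (use single in \<open>auto simp: coeff_monom\<close>)
    then have "two.ev x G y = ev (coeff G j) x * y ^ j" by (metis two.ev_monom)
    then show False using less.prems(2) gj y_nonzero by simp
  qed
qed

abbreviation curve :: "'k poly poly" where
  "curve \<equiv> monom 1 n - [:f:]"

lemma curve_ev: "two.ev x curve y = 0"
  by (simp add: equation)

lemma reduce_mod_curve: "\<exists>H. degree H < n \<and> curve dvd G - H"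
proof (induction G)
  case 0
  then show ?case using n_pos by (intro exI[of _ 0]) auto
next
  case (pCons g G)
  then obtain H B where H: "degree H < n" "G - H = curve * B" by (meson dvdE)
  define c where "c = coeff H (n - 1)"
  define K where "K = pCons g H - smult c curve"
  have "degree K < n"
  proof (rule degree_lessI)
    show "\<forall>i\<ge>n. coeff K i = 0"
    proof (intro allI impI)
      fix i assume i: "i \<ge> n"
      then obtain i' where i': "i = Suc i'" using n_pos by (cases i) auto
      have f: "coeff [:f:] i = 0" using i' by simp
      show "coeff K i = 0"
      proof (cases "i = n")
        case True
        then show ?thesis using i' f by (auto simp: K_def c_def coeff_pCons split: nat.splits)
      next
        case False
        then have "coeff H i' = 0" using i i' H(1) by (intro coeff_eq_0) simp
        then show ?thesis using i' f False by (simp add: K_def)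
      qed
    qed
  qed (use n_pos in auto)
  have "pCons g G - K = pCons 0 (G - H) + smult c curve" by (simp add: K_def)
  moreover have "pCons 0 (curve * B) = curve * pCons 0 B" "smult c curve = curve * [:c:]"
    by (simp_all only: mult_pCons_right) simp_all
  ultimately have "pCons g G - K = curve * (pCons 0 B + [:c:])"
    by (simp only: H(2) distrib_left)
  then have "curve dvd pCons g G - K" by (rule dvdI)
  then show ?case using \<open>degree K < n\<close> by blast
qed

text \<open>
  Division by the monic polynomial \<open>Y ^ n - f(X)\<close> reduces a relation to one of degree below \<open>n\<close> in
  \<open>Y\<close>, which is trivial.
\<close>

lemma vanishes_iff: "two.ev x G y = 0 \<longleftrightarrow> curve dvd G"
proof
  assume "two.ev x G y = 0"
  obtain H where H: "degree H < n" "curve dvd G - H" using reduce_mod_curve by blast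
  have "two.ev x (G - H) y = 0" using two.ev_dvd[OF H(2), of x y] by (simp only: curve_ev) simp
  then have "two.ev x H y = 0" using \<open>two.ev x G y = 0\<close> by simp
  then have "H = 0" using powers_independent H by blast
  then show "curve dvd G" using H by simp
next
  assume "curve dvd G"
  then show "two.ev x G y = 0" using two.ev_dvd[of curve G x y] by (simp only: curve_ev) simp
qed

lemma reduced_representation: "\<exists>H. degree H < n \<and> two.ev x G y = two.ev x H y"
proof -
  obtain H where H: "degree H < n" "curve dvd G - H" using reduce_mod_curve by blast
  have "two.ev x (G - H) y = 0" using H vanishes_iff by blast
  then show ?thesis using H by (intro exI[of _ H]) simp
qed

end

section \<open>The places of a superelliptic function field\<close>

text \<open>
  The cofactor \<open>1 + a + \<dots> + a ^ (n - 1)\<close> of \<open>a - 1\<close> in \<open>a ^ n - 1\<close> has \<open>n\<close> summands, each congruent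
  to \<open>1\<close> modulo \<open>n\<close>.
\<close>

lemma mult_dvd_power_minus_1:
  fixes a :: int
  assumes "int n dvd a - 1"
  shows "int n * (a - 1) dvd a ^ n - 1"
proof -
  have "int n dvd (\<Sum>i<n. a ^ i - 1)"
  proof (rule dvd_sum)
    fix i
    have "a - 1 dvd a ^ i - 1" by (simp add: power_diff_1_eq)
    then show "int n dvd a ^ i - 1" using assms dvd_trans by blast
  qed
  moreover have "(\<Sum>i<n. a ^ i) = (\<Sum>i<n. a ^ i - 1) + int n" by (simp add: sum_subtractf)
  ultimately have "int n dvd (\<Sum>i<n. a ^ i)" by simp
  then show ?thesis by (simp add: power_diff_1_eq mult.commute mult_dvd_mono)
qed

lemma (in finite_field_ext) dvd_frobenius_all:
  fixes p g :: "'k poly"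
  assumes "p dvd monom 1 (q ^ j) - monom 1 1"
  shows "p dvd g ^ (q ^ j) - g"
proof (induction g)
  case 0
  then show ?case by (simp add: zero_power)
next
  case (pCons a g)
  let ?Q = "q ^ j" and ?X = "monom (1 :: 'k) 1"
  have X: "?X ^ ?Q = monom 1 ?Q" by (simp add: monom_power)
  have "pCons a g = [:a:] + ?X * g" by (simp add: monom_Suc monom_0)
  then have "pCons a g ^ ?Q - pCons a g = [:a:] ^ ?Q + ?X ^ ?Q * g ^ ?Q - ([:a:] + ?X * g)"
    by (simp only: frobenius_poly_iter power_mult_distrib)
  also have "[:a:] ^ ?Q = [:a:]" by (simp add: poly_const_pow)
  finally have "pCons a g ^ ?Q - pCons a g = monom 1 ?Q * (g ^ ?Q - g) + g * (monom 1 ?Q - ?X)"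
    unfolding X by (simp add: algebra_simps)
  then show ?case using pCons assms by (simp only:) (intro dvd_add dvd_mult)
qed

locale superelliptic = kummer_point \<iota> q x y n f
  for \<iota> :: "'k::{finite,field} \<Rightarrow> 'f::field" and q x y n f +
  assumes no_root: "poly f a \<noteq> 0"
    and function_field: "\<exists>p r. two.ev x r y \<noteq> 0 \<and> z = two.ev x p y / two.ev x r y"
begin

lemma x_minus_nonzero: "x - \<iota> a \<noteq> 0"
proof -
  have "ev [:- a, 1:] x \<noteq> 0" by (rule transcendental) simp
  then show ?thesis by (simp add: add.commute)
qed

lemma x_nonzero: "x \<noteq> 0"
  using x_minus_nonzero[of 0] by simp

lemma of_nat_nonzero: "m dvd n \<Longrightarrow> of_nat m \<noteq> (0 :: 'k)"
proof
  assume "m dvd n" "of_nat m = (0 :: 'k)"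
  then obtain k where "q - 1 = m * k" using n_dvd dvd_trans by blast
  then have "of_nat (q - 1) = (0 :: 'k)" using \<open>of_nat m = 0\<close> by simp
  then have "of_nat q = (1 :: 'k)" using q_pos by (metis Suc_diff_1 of_nat_Suc add.right_neutral)
  then show False by simp
qed

lemma subfield_eq_UNIV:
  assumes emb: "\<And>a. \<iota> a \<in> T" and add: "\<And>u v. u \<in> T \<Longrightarrow> v \<in> T \<Longrightarrow> u + v \<in> T"
    and mult: "\<And>u v. u \<in> T \<Longrightarrow> v \<in> T \<Longrightarrow> u * v \<in> T"
    and inv: "\<And>u. u \<in> T \<Longrightarrow> inverse u \<in> T" and "x \<in> T" "y \<in> T"
  shows "z \<in> T"
proof -
  have 0: "0 \<in> T" using emb[of 0] by simp
  have 1: "ev p x \<in> T" for p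
    using 0 \<open>x \<in> T\<close> by (induction p) (auto intro: emb add mult)
  have "two.ev x p y \<in> T" for p
    using 0 1 \<open>y \<in> T\<close> by (induction p) (auto intro: add mult)
  moreover obtain p r where "z = two.ev x p y / two.ev x r y" using function_field by blast
  ultimately show ?thesis by (auto simp: divide_inverse intro: mult inv)
qed

lemma fraction_field_adjoin:
  assumes "\<exists>g\<in>adjoin \<iota> S. \<exists>h\<in>adjoin \<iota> S. h \<noteq> 0 \<and> x = g / h"
    and "\<exists>g\<in>adjoin \<iota> S. \<exists>h\<in>adjoin \<iota> S. h \<noteq> 0 \<and> y = g / h"
  shows "\<exists>g\<in>adjoin \<iota> S. \<exists>h\<in>adjoin \<iota> S. h \<noteq> 0 \<and> z = g / h"
proof -
  let ?T = "{z. \<exists>g\<in>adjoin \<iota> S. \<exists>h\<in>adjoin \<iota> S. h \<noteq> 0 \<and> z = g / h}"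
  have "z \<in> ?T"
  proof (rule subfield_eq_UNIV)
    show "\<iota> a \<in> ?T" for a
      by (rule CollectI, rule bexI[of _ "\<iota> a"], rule bexI[of _ 1])
        (auto intro: adjoin_1 adjoin.intros)
    fix u v assume "u \<in> ?T" "v \<in> ?T"
    then obtain g h g' h' where gh: "g \<in> adjoin \<iota> S" "h \<in> adjoin \<iota> S" "h \<noteq> 0" "u = g / h"
      "g' \<in> adjoin \<iota> S" "h' \<in> adjoin \<iota> S" "h' \<noteq> 0" "v = g' / h'" by blast
    show "u + v \<in> ?T"
      by (rule CollectI, rule bexI[of _ "g * h' + g' * h"], rule bexI[of _ "h * h'"])
        (use gh in \<open>auto simp: add_frac_eq intro: adjoin.adjoin_add adjoin.adjoin_mult\<close>)
    show "u * v \<in> ?T"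
      by (rule CollectI, rule bexI[of _ "g * g'"], rule bexI[of _ "h * h'"])
        (use gh in \<open>auto intro: adjoin.adjoin_mult\<close>)
  next
    fix u assume "u \<in> ?T"
    then obtain g h where gh: "g \<in> adjoin \<iota> S" "h \<in> adjoin \<iota> S" "h \<noteq> 0" "u = g / h" by blast
    show "inverse u \<in> ?T"
    proof (cases "g = 0")
      case True
      show ?thesis
        by (rule CollectI, rule bexI[of _ 0], rule bexI[of _ 1])
          (use gh True in \<open>auto intro: adjoin_0 adjoin_1\<close>)
    next
      case False
      show ?thesis
        by (rule CollectI, rule bexI[of _ h], rule bexI[of _ g]) (use gh False in auto)
    qed
  qed (use assms in auto)
  then show ?thesis by blast
qed

lemma fraction_field_adjoin_xy:
  assumes "x \<in> adjoin \<iota> S" "y \<in> adjoin \<iota> S"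
  shows "\<exists>g\<in>adjoin \<iota> S. \<exists>h\<in>adjoin \<iota> S. h \<noteq> 0 \<and> z = g / h"
  by (rule fraction_field_adjoin) (use assms adjoin_1 in \<open>force intro: bexI[of _ 1]\<close>)+

text \<open>
  The elements that are polynomials in \<open>x\<close> over the \<open>q\<close>-th powers form a field, because
  \<open>1 / z = (1 / z) ^ q z ^ (q - 1)\<close>. It contains \<open>k\<close>, whose elements are their own \<open>q\<close>-th powers, and
  \<open>y\<close>, since \<open>y ^ q\<close> differs from \<open>y\<close> by a factor in \<open>k[x]\<close>.
\<close>

lemma frobenius_generated: "frobenius_generated \<iota> q x"
proof -
  interpret fr: field_ext "\<lambda>a :: 'f. a ^ q"
    by unfold_locales (rule frobenius_field_embedding)
  define T where "T = {w. \<exists>p. w = fr.ev p x}"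
  have emb: "\<iota> a \<in> T" for a
    unfolding T_def mem_Collect_eq by (rule exI[of _ "[:\<iota> a:]"]) (simp flip: hom_power)
  have add: "u + v \<in> T" if "u \<in> T" "v \<in> T" for u v 
    using that unfolding T_def mem_Collect_eq by (metis fr.ev_add)
  have mult: "u * v \<in> T" if "u \<in> T" "v \<in> T" for u v 
    using that unfolding T_def mem_Collect_eq by (metis fr.ev_mult)
  have const: "a ^ q \<in> T" for a by (auto simp: T_def intro!: exI[of _ "[:a:]"])
  have inv: "inverse u \<in> T" if u: "u \<in> T" for u
  proof -
    obtain p where p: "u = fr.ev p x" using u by (auto simp: T_def)
    have "u ^ (q - 1) \<in> T" unfolding p T_def mem_Collect_eq by (metis fr.ev_power)
    moreover have "inverse u = inverse u ^ q * u ^ (q - 1)"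
    proof (cases "u = 0")
      case False
      have "u ^ q = u * u ^ (q - 1)" using q_pos by (metis Suc_diff_1 power_Suc)
      then show ?thesis using False by (simp add: power_inverse field_simps)
    qed (use q_ge_2 in \<open>auto simp: power_0_left\<close>)
    ultimately show ?thesis using mult[OF const] by metis
  qed
  have x: "x \<in> T" by (auto simp: T_def intro!: exI[of _ "monom 1 1"])
  have "0 \<in> T" using emb[of 0] by simp
  then have evx: "ev p x \<in> T" for p
    using emb x by (induction p) (auto intro: add mult)
  have "ev (f ^ ((q - 1) div n)) x \<noteq> 0" using f_deg by auto
  then have "y = y ^ q * inverse (ev (f ^ ((q - 1) div n)) x)"
    by (metis y_frobenius mult.commute mult.assoc right_inverse mult_1_left)
  then have "y \<in> T" using mult[OF const inv[OF evx]] by metis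
  then have "w \<in> T" for w using subfield_eq_UNIV[of T w] emb add mult inv x by blast
  then show ?thesis
    by unfold_locales (auto simp: T_def fr.poly_at_eq)
qed

sublocale frobenius_generated \<iota> q x
  by (rule frobenius_generated)

subsection \<open>Charts over finite values of x\<close>

sublocale ram: plane_chart \<iota> q y x f
proof
  show "\<exists>g\<in>adjoin \<iota> {y, x}. \<exists>h\<in>adjoin \<iota> {y, x}. h \<noteq> 0 \<and> w = g / h" for w
    by (rule fraction_field_adjoin_xy) (auto intro: adjoin.intros)
  show "y \<noteq> 0" by (rule y_nonzero)
  show "separable f" by (rule f_sep)
  have "ev f x = y * y ^ (n - 1)"
    using equation n_pos by (metis Suc_diff_1 power_Suc)
  then show "\<exists>r\<in>adjoin \<iota> {y, x}. ev f x = y * r"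
    by (intro bexI[of _ "y ^ (n - 1)"] adjoin_power) (auto intro: adjoin.intros)
qed

sublocale rat: plane_chart \<iota> q "x - \<iota> a" y "monom 1 n - [:poly f a:]" for a
proof
  let ?S = "{x - \<iota> a, y}"
  have "(x - \<iota> a) + \<iota> a \<in> adjoin \<iota> ?S" by (rule adjoin_add) (auto intro: adjoin.intros)
  then have x: "x \<in> adjoin \<iota> ?S" by simp
  then show "\<exists>g\<in>adjoin \<iota> ?S. \<exists>h\<in>adjoin \<iota> ?S. h \<noteq> 0 \<and> w = g / h" for w
    by (rule fraction_field_adjoin_xy) (auto intro: adjoin.intros)
  show "x - \<iota> a \<noteq> 0" by (rule x_minus_nonzero)
  show "separable (monom 1 n - [:poly f a:])"
    by (rule separable_binomial) (auto simp: no_root of_nat_nonzero)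
  have "poly (f - [:poly f a:]) a = 0" by simp
  then obtain s where s: "f - [:poly f a:] = [:- a, 1:] * s" by (metis poly_eq_0_iff_dvd dvdE)
  have "ev (monom 1 n - [:poly f a:]) y = ev (f - [:poly f a:]) x" by (simp add: equation)
  also have "\<dots> = (x - \<iota> a) * ev s x" unfolding s by (simp add: algebra_simps)
  finally show "\<exists>r\<in>adjoin \<iota> ?S. ev (monom 1 n - [:poly f a:]) y = (x - \<iota> a) * r"
    using adjoin_ev[OF x] by blast
qed

text \<open>Every element of \<open>k[x, y]\<close> is algebraic over \<open>k(x)\<close>, so a nonzero ideal of it meets \<open>k[x]\<close>.\<close>

lemma ideal_meets_base:
  assumes "z \<in> adjoin \<iota> {x, y}" "z \<noteq> 0"
  shows "\<exists>g. g \<noteq> 0 \<and> (\<exists>r\<in>adjoin \<iota> {x, y}. ev g x = z * r)"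
proof -
  let ?R = "adjoin \<iota> {x, y}"
  have rep: "\<exists>G. u = two.ev x G y" if "u \<in> ?R" for u
    using that
  proof induction
    case (adjoin_emb a)
    show ?case by (intro exI[of _ "[:[:a:]:]"]) simp
  next
    case (adjoin_gen s)
    have "x = two.ev x [:monom 1 1:] y" "y = two.ev x (monom 1 1) y" by simp_all
    then show ?case using adjoin_gen by blast
  next
    case (adjoin_add u v)
    then show ?case by (metis two.ev_add)
  next
    case (adjoin_mult u v)
    then show ?case by (metis two.ev_mult)
  qed
  have "\<exists>H. degree H < n \<and> z ^ j = two.ev x H y" for j
    using rep[OF adjoin_power[OF assms(1)], of j] reduced_representation by metis
  then obtain V where V: "\<And>j. degree (V j) < n" "\<And>j. z ^ j = two.ev x (V j) y" by metis
  obtain c where c: "\<exists>j\<in>{..n}. c j \<noteq> 0" "\<And>i. i < n \<Longrightarrow> (\<Sum>j\<le>n. c j * coeff (V j) i) = 0"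
    using linear_dependence[of "{..n}" n "\<lambda>j i. coeff (V j) i"] by auto
  define C where "C = (\<Sum>j\<le>n. monom (c j) j)"
  have "coeff C j = (if j \<le> n then c j else 0)" for j
    by (simp add: C_def coeff_sum coeff_monom)
  then have "C \<noteq> 0" using c(1) by (metis atMost_iff coeff_0)
  have "two.ev x C z = (\<Sum>j\<le>n. \<Sum>i<n. ev (c j * coeff (V j) i) x * y ^ i)"
    by (simp add: C_def V(2) two.ev_eq_sum[OF V(1)] sum_distrib_left mult.assoc)
  also have "\<dots> = (\<Sum>i<n. ev (\<Sum>j\<le>n. c j * coeff (V j) i) x * y ^ i)"
    by (subst sum.swap) (simp only: ev_sum sum_distrib_right)
  also have "\<dots> = 0" using c(2) by simp
  finally have "two.ev x C z = 0" .
  then show ?thesis using \<open>C \<noteq> 0\<close>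
  proof (induction C)
    case (pCons a C)
    have sum: "ev a x + z * two.ev x C z = 0" using pCons.prems by simp
    show ?case
    proof (cases "a = 0")
      case True
      then have "two.ev x C z = 0" "C \<noteq> 0" using sum assms(2) pCons.prems by auto
      then show ?thesis by (rule pCons.IH)
    next
      case False
      have "x \<in> ?R" by (auto intro: adjoin.intros)
      then have "two.ev x C z \<in> ?R"
        by (induction C) (auto intro: adjoin_0 adjoin_ev adjoin.adjoin_add adjoin.adjoin_mult assms(1))
      moreover have "ev a x = z * (- two.ev x C z)" using sum by (simp add: eq_neg_iff_add_eq_0)
      ultimately show ?thesis using False adjoin_minus by blast
    qed
  qed auto
qed

lemma y_nonneg:
  assumes "is_place \<iota> P" "place_of_ext.ord_ge P 0 x"
  shows "place_of_ext.ord_ge P 0 y"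
proof -
  interpret place_of_ext \<iota> P by unfold_locales fact
  have "ord_ge 0 (y ^ n)" unfolding equation using assms(2) by (rule ord_ge_ev)
  then show ?thesis using n_pos y_nonzero by (auto simp: ord_ge_def P_power zero_le_mult_iff)
qed

text \<open>
  The place is positive at the numerator of a uniformiser, hence at a nonzero polynomial in \<open>x\<close>
  divisible by this numerator.
\<close>

lemma finite_place_polynomial:
  assumes P: "is_place \<iota> P" "place_of_ext.ord_ge P 0 x"
  shows "\<exists>p. monic_irreducible p \<and> (\<forall>g. place_of_ext.ord_ge P 1 (ev g x) \<longleftrightarrow> p dvd g)"
proof -
  interpret place_of_ext \<iota> P by unfold_locales fact
  have S: "ord_ge 0 s" if "s \<in> {x, y}" for s using that P y_nonneg by auto
  obtain t where t: "P t = 1" using exists_uniformizer by blast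
  obtain g h where gh: "g \<in> adjoin \<iota> {x, y}" "h \<in> adjoin \<iota> {x, y}" "h \<noteq> 0" "t = g / h"
    using fraction_field_adjoin_xy[of "{x, y}" t] by (auto intro: adjoin.intros)
  have "g \<noteq> 0" using t gh by auto
  then have "P g = 1 + P h" using t gh P_divide by simp
  moreover have "ord_ge 0 h" using adjoin_ord_ge_0[OF S gh(2)] by blast
  ultimately have "ord_ge 1 g" using gh by (auto simp: ord_ge_def)
  obtain a r where a: "a \<noteq> 0" "r \<in> adjoin \<iota> {x, y}" "ev a x = g * r"
    using ideal_meets_base gh(1) \<open>g \<noteq> 0\<close> by blast
  have "ord_ge 0 r" using adjoin_ord_ge_0[OF S a(2)] by blast
  then have "ord_ge 1 (ev a x)"
    unfolding a(3) using ord_ge_mult0 \<open>ord_ge 1 g\<close> by (metis mult.commute)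
  then show ?thesis using residue_minimal_polynomial P(2) a(1) by blast
qed

text \<open>
  Away from the roots of \<open>f\<close> the map \<open>x\<close> is unramified: modulo \<open>p(x)\<close> both \<open>x\<close> and
  \<open>y\<close> are fixed by the \<open>Q\<close>-power map when \<open>Q\<close> is the \<open>n\<close>-th power of a \<open>Q0\<close>
  that works for \<open>x\<close>, since then \<open>n (Q0 - 1)\<close> divides \<open>Q - 1\<close> and
  \<open>f ^ (Q0 - 1) = 1\<close> modulo \<open>p\<close>.
\<close>

lemma unramified:
  assumes P: "is_place \<iota> P" "place_of_ext.ord_ge P 0 x"
    and p: "monic_irreducible p" "place_of_ext.ord_ge P 1 (ev p x)" "\<not> p dvd f"
  shows "P (ev p x) = 1"
proof -
  interpret place_of_ext \<iota> P by unfold_locales fact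
  have irr: "irreducible p" using p by blast
  obtain j where j: "j \<ge> 1" "p dvd monom 1 (q ^ j) - monom 1 1"
    using irreducible_dvd_frobenius irr by blast
  define Q0 where "Q0 = q ^ j"
  define Q where "Q = q ^ (j * n)"
  have Q0: "Q0 \<ge> 2" using j q_ge_2 self_le_power[of q j] by (simp add: Q0_def)
  have Q: "Q = Q0 ^ n" by (simp add: Q_def Q0_def power_mult)
  have Q2: "Q \<ge> 2" unfolding Q using Q0 n_pos self_le_power[of Q0 n] by simp
  obtain s where s: "monom 1 Q - monom 1 1 = p * s"
    using dvd_frobenius_iter[OF j(2), of n] by (auto simp: Q_def)
  have "int n dvd int Q0 - 1"
  proof -
    have "int q - 1 dvd int q ^ j - 1" by (simp add: power_diff_1_eq)
    moreover have "int n dvd int q - 1" using n_dvd q_pos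
      by (metis Suc_leI int_dvd_int_iff of_nat_1 of_nat_diff One_nat_def)
    ultimately show ?thesis unfolding Q0_def by (auto intro: dvd_trans)
  qed
  then have "int n * (int Q0 - 1) dvd int Q0 ^ n - 1" by (rule mult_dvd_power_minus_1)
  moreover have "int Q0 - 1 = int (Q0 - 1)" "int Q0 ^ n - 1 = int (Q - 1)"
    using Q0 Q2 by (simp_all add: Q of_nat_diff)
  ultimately have "n * (Q0 - 1) dvd Q - 1" by (metis int_dvd_int_iff of_nat_mult)
  then obtain m where "Q - 1 = n * (Q0 - 1) * m" by (rule dvdE)
  then have m: "Q - 1 = n * ((Q0 - 1) * m)" by (simp only: mult.assoc)
  have "p dvd f ^ Q0 - f" unfolding Q0_def by (rule dvd_frobenius_all[OF j(2)])
  also have "f ^ Q0 = f * f ^ (Q0 - 1)" using Q0 by (metis Suc_diff_1 le_trans not_gr_zero one_le_numeral not_one_le_zero power_Suc)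
  then have "f ^ Q0 - f = f * (f ^ (Q0 - 1) - 1)" by (simp add: right_diff_distrib)
  finally have "p dvd f ^ (Q0 - 1) - 1" using p(3) irreducible_dvd_mult[OF irr] by blast
  moreover have "f ^ (Q0 - 1) - 1 dvd (f ^ (Q0 - 1)) ^ m - 1" by (simp add: power_diff_1_eq)
  ultimately have "p dvd f ^ ((Q0 - 1) * m) - 1" by (metis dvd_trans power_mult)
  then obtain r where r: "f ^ ((Q0 - 1) * m) - 1 = p * r" by auto
  let ?R = "adjoin \<iota> {x, y}"
  have xy: "x \<in> ?R" "y \<in> ?R" by (auto intro: adjoin.intros)
  have "x ^ Q - x = ev (monom 1 Q - monom 1 1) x" by simp
  also have "\<dots> = ev p x * ev s x" by (simp only: s ev_mult)
  finally have Qx: "x ^ Q - x = ev p x * ev s x" .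
  have "y ^ Q = y * y ^ (Q - 1)" using Q2 by (metis Suc_diff_1 le_trans not_gr_zero one_le_numeral not_one_le_zero power_Suc)
  also have "y ^ (Q - 1) = ev f x ^ ((Q0 - 1) * m)" by (simp only: m power_mult equation)
  finally have "y ^ Q - y = y * ev (f ^ ((Q0 - 1) * m) - 1) x"
    by (simp add: right_diff_distrib)
  also have "\<dots> = ev p x * (y * ev r x)" unfolding r by simp
  finally have Qy: "y ^ Q - y = ev p x * (y * ev r x)" .
  have gen: "\<exists>r\<in>?R. s ^ Q - s = ev p x * r" if "s \<in> {x, y}" for s
  proof -
    consider "s = x" | "s = y" using \<open>s \<in> {x, y}\<close> by auto
    then show ?thesis
    proof cases
      case 1
      then show ?thesis using Qx xy adjoin_ev by blast
    next
      case 2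
      then show ?thesis using Qy xy adjoin_ev adjoin_mult by blast
    qed
  qed
  interpret chart_place \<iota> "{x, y}" "ev p x" Q P
  proof unfold_locales
    show "\<exists>g\<in>?R. \<exists>h\<in>?R. h \<noteq> 0 \<and> z = g / h" for z
      using fraction_field_adjoin_xy xy by blast
    show "ev p x \<in> ?R" using xy by (intro adjoin_ev)
    show "ev p x \<noteq> 0" using p(1) by auto
    show "2 \<le> Q" by (rule Q2)
    show "\<exists>r\<in>?R. g ^ Q - g = ev p x * r" if "g \<in> ?R" for g
      using adjoin_frobenius[of "{x, y}" "j * n"] gen that unfolding Q_def by blast
    show "ord_ge 0 s" if "s \<in> {x, y}" for s using that P y_nonneg by auto
    show "0 < P (ev p x)" using p by (auto simp: ord_ge_def)
  qed
  show ?thesis by (rule P_t)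
qed

end

context superelliptic
begin

text \<open>
  The coefficient of \<open>K\<close> at \<open>P\<close>.
\<close>

abbreviation \<omega> :: "'f place \<Rightarrow> int" where
  "\<omega> P \<equiv> differential_order \<iota> P (- 1 / (x ^ q - x)) x"

lemma xq_eq: "x ^ q - x = ev (monom 1 q - monom 1 1) x"
  by simp

lemma xq_nonzero: "x ^ q - x \<noteq> 0"
proof -
  have "coeff (monom 1 q - monom (1 :: 'k) 1) q = 1" using q_ge_2 by (simp add: coeff_monom)
  then have "monom 1 q - monom (1 :: 'k) 1 \<noteq> 0" by (metis coeff_0 zero_neq_one)
  then show ?thesis unfolding xq_eq by (rule transcendental)
qed

end

locale finite_place = superelliptic \<iota> q x y n f + place_of_ext \<iota> P
  for \<iota> :: "'k::{finite,field} \<Rightarrow> 'f::field" and q x y n f P +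
  fixes p :: "'k poly"
  assumes x_nonneg: "ord_ge 0 x" and p_irr: "monic_irreducible p"
    and over_p: "ord_ge 1 (ev g x) \<longleftrightarrow> p dvd g"
begin

lemma unit_at: "\<not> p dvd g \<Longrightarrow> ev g x \<noteq> 0 \<and> P (ev g x) = 0"
  using not_pos_unit[OF ord_ge_ev[OF x_nonneg]] over_p by blast

lemma P_x_minus: "p \<noteq> [:- a, 1:] \<Longrightarrow> P (x - \<iota> a) = 0"
proof -
  assume "p \<noteq> [:- a, 1:]"
  then have "\<not> p dvd [:- a, 1:]"
    using monic_irreducible_dvd_eq[of p "[:- a, 1:]"] p_irr irreducible_linear_field_poly[of 1 "- a"] by auto
  then have "P (ev [:- a, 1:] x) = 0" using unit_at by blast
  then show ?thesis by simp
qed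

lemma P_xq: "(\<And>a. p \<noteq> [:- a, 1:]) \<Longrightarrow> P (x ^ q - x) = 0"
  unfolding xq_eq using unit_at irreducible_dvd_prod_linear p_irr by blast

lemma \<omega>_eq:
  assumes "\<And>t \<theta>. P t = 1 \<Longrightarrow> is_derivation \<iota> \<theta> \<Longrightarrow> \<theta> t = 1 \<Longrightarrow> \<theta> x \<noteq> 0 \<and> P (\<theta> x) = m"
  shows "\<omega> P = m - P (x ^ q - x)"
proof -
  have "\<omega> P = P (- 1 / (x ^ q - x)) + m"
    by (rule differential_order_eq[OF place _ assms]) (use xq_nonzero in auto)
  then show ?thesis using xq_nonzero by (simp add: P_divide)
qed

text \<open>\<open>\<theta> (g(x)) = g'(x) \<theta> x\<close>, and \<open>\<theta>\<close> lowers the order \<open>N\<close> of \<open>g(x)\<close> by one.\<close>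

lemma dx_order:
  assumes "g \<noteq> 0" "P (ev g x) = int N" "of_nat N \<noteq> (0 :: 'k)" "\<not> p dvd pderiv g"
    and "P t = 1" "is_derivation \<iota> \<theta>" "\<theta> t = 1"
  shows "\<theta> x \<noteq> 0 \<and> P (\<theta> x) = int N - 1"
proof -
  interpret frobenius_place \<iota> q x P t using assms(5) by unfold_locales
  have nz: "ev g x \<noteq> 0" using assms(1) by simp
  have "\<theta> (ev g x) \<noteq> 0 \<and> P (\<theta> (ev g x)) = int N - 1"
    by (rule derivation_order[OF assms(6,7) nz assms(2,3)])
  then show ?thesis
    unfolding derivation_ev[OF assms(6)] using unit_at[OF assms(4)] by (auto simp: P_mult)
qed

lemma y_unit: "\<not> p dvd f \<Longrightarrow> P y = 0"
proof -
  assume "\<not> p dvd f"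
  then have "P (y ^ n) = 0" unfolding equation using unit_at by blast
  then show ?thesis using n_pos y_nonzero by (simp add: P_power)
qed

lemma ramified:
  assumes "p dvd f"
  shows "P y = 1" "\<omega> P = int n - 1" "P (x - \<iota> a) = 0"
proof -
  have lin: "p \<noteq> [:- a, 1:]" for a
  proof
    assume "p = [:- a, 1:]"
    then show False using assms no_root[of a] by (simp add: poly_eq_0_iff_dvd)
  qed
  then show "P (x - \<iota> a) = 0" by (rule P_x_minus)
  have "ord_ge 1 (y ^ n)" unfolding equation using assms over_p by blast
  then have "0 < int n * P y" using y_nonzero by (auto simp: ord_ge_def P_power)
  then have "P y > 0" by (simp add: zero_less_mult_iff)
  then have "ram.centered P" using place x_nonneg by (simp add: ram.centered_def)
  then show y: "P y = 1" by (rule ram.centered_parameter)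
  have "f \<noteq> 0" using f_deg by auto
  moreover have "P (ev f x) = int n" using y y_nonzero by (simp add: P_power flip: equation)
  moreover have "\<not> p dvd pderiv f"
    using f_sep assms p_irr unfolding separable_def coprime_def Factorial_Ring.irreducible_def by blast
  ultimately have "\<omega> P = (int n - 1) - P (x ^ q - x)"
    using of_nat_nonzero by (intro \<omega>_eq dx_order) auto
  then show "\<omega> P = int n - 1" using P_xq lin by simp
qed

lemma over_unramified:
  assumes "\<not> p dvd f"
  shows "P (ev p x) = 1" "\<omega> P = - P (x ^ q - x)"
proof -
  show 1: "P (ev p x) = 1"
    by (rule unramified[OF place x_nonneg p_irr _ assms]) (simp add: over_p)
  have "\<omega> P = (int 1 - 1) - P (x ^ q - x)"
    using 1 p_irr irreducible_not_dvd_pderiv by (intro \<omega>_eq dx_order) auto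
  then show "\<omega> P = - P (x ^ q - x)" by simp
qed

lemma inert:
  assumes "\<not> p dvd f" "\<And>a. p \<noteq> [:- a, 1:]"
  shows "\<omega> P = 0" "P y = 0" "P (x - \<iota> a) = 0"
  using over_unramified(2)[OF assms(1)] P_xq[OF assms(2)] y_unit[OF assms(1)] P_x_minus[OF assms(2)] by simp_all

lemma rational_value:
  assumes "p = [:- a, 1:]"
  shows "P (x - \<iota> a) = 1" "\<omega> P = - 1" "P y = 0" "rat.centered a P"
proof -
  have nf: "\<not> p dvd f" using no_root[of a] assms by (simp add: poly_eq_0_iff_dvd)
  show "P y = 0" by (rule y_unit[OF nf])
  have "ev p x = x - \<iota> a" using assms by simp
  then show 1: "P (x - \<iota> a) = 1" using over_unramified(1)[OF nf] by simp
  show "rat.centered a P"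
    using 1 place \<open>P y = 0\<close> by (simp add: rat.centered_def ord_ge_def)
  define w where "w = x - \<iota> a"
  have w: "w \<noteq> 0" "P w = 1" using 1 x_minus_nonzero by (simp_all add: w_def)
  \<comment> \<open>By additivity of Frobenius and \<open>a ^ q = a\<close>; the term \<open>w ^ q\<close> has the larger order.\<close>
  have "x ^ q - x = - w + w ^ q"
    using frobenius_diff_iter[of x "\<iota> a" 1] by (simp add: w_def flip: hom_power)
  moreover have "ord_ge (P (- w) + 1) (w ^ q)"
    using w q_ge_2 by (simp add: ord_ge_def P_power)
  then have "P (- w + w ^ q) = P (- w)" using P_add_lt[of "- w"] w by simp
  ultimately have "P (x ^ q - x) = 1" using w by simp
  then show "\<omega> P = - 1" using over_unramified(2)[OF nf] by simp
qed

end

context superelliptic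
begin

lemma finite_place_cases:
  assumes "is_place \<iota> P" "\<not> P x < 0"
  shows "\<exists>p. finite_place \<iota> q x y n f P p"
proof -
  interpret place_of_ext \<iota> P by unfold_locales fact
  have "ord_ge 0 x" using assms(2) by (simp add: ord_ge_def)
  then obtain p where "monic_irreducible p" "\<And>g. ord_ge 1 (ev g x) \<longleftrightarrow> p dvd g"
    using finite_place_polynomial[OF assms(1)] by blast
  then show ?thesis using \<open>ord_ge 0 x\<close> by (intro exI[of _ p]) unfold_locales
qed

text \<open>
  Over \<open>x = a\<close> the residue of \<open>y\<close> is a root of \<open>Y ^ n - f(a)\<close>, and all \<open>n\<close>-th roots
  of unity lie in \<open>k\<close>. So either all places over \<open>a\<close> are rational or none is.
\<close>

lemma rational_iff_power:
  assumes "rat.centered a P"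
  shows "place_degree \<iota> P = 1 \<longleftrightarrow> poly f a \<in> {b ^ n | b. b \<noteq> 0}"
proof -
  let ?p = "rat.residue_poly P"
  note rp = rat.residue_poly[OF assms]
  have eval: "poly (monom 1 n - [:poly f a:]) b = b ^ n - poly f a" for b
    by (simp add: poly_monom)
  show ?thesis
  proof
    assume "place_degree \<iota> P = 1"
    then have "degree ?p = 1" using rp(4) by simp
    then obtain b where "?p = [:- b, 1:]"
      using rp(1) degree1_coeffs[of ?p] by (metis coeff_pCons_0 coeff_pCons_Suc One_nat_def minus_minus)
    then have "b ^ n = poly f a" using rp(3) eval[of b] by (simp flip: poly_eq_0_iff_dvd)
    moreover have "b \<noteq> 0" using no_root[of a] n_pos \<open>b ^ n = poly f a\<close> by (auto simp: zero_power)
    ultimately show "poly f a \<in> {b ^ n | b. b \<noteq> 0}" using \<open>b ^ n = poly f a\<close>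
      by (intro CollectI exI[of _ b] conjI) (rule sym)
  next
    assume "poly f a \<in> {b ^ n | b. b \<noteq> 0}"
    then obtain b where b: "poly f a = b ^ n" "b \<noteq> 0" by auto
    obtain m where m: "q - 1 = n * m" using n_dvd by auto
    have "poly f a ^ m = 1" using power_q_minus_1[OF b(2)] by (metis b(1) m power_mult)
    then have "[:poly f a:] ^ m = 1" by (simp add: poly_const_pow one_pCons)
    then have pw: "monom 1 (q - 1) - 1 = monom 1 n ^ m - [:poly f a:] ^ m"
      by (simp only: m monom_power power_one)
    \<comment> \<open>The divisors of \<open>Y ^ (q - 1) - 1\<close> split into linear factors over \<open>k\<close>.\<close>
    have "monom 1 n - [:poly f a:] dvd monom 1 (q - 1) - 1"
      unfolding pw power_diff_sumr2 by (rule dvd_triv_left)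
    then have "?p dvd (monom 1 (q - 1) - 1) * monom 1 1" using rp(3) dvd_trans dvd_mult2 by blast
    also have "(monom 1 (q - 1) - 1) * monom 1 1 = monom 1 q - monom (1 :: 'k) 1"
      using q_pos by (simp add: left_diff_distrib mult_monom)
    finally obtain b' where "?p = [:- b', 1:]" using irreducible_dvd_prod_linear rp(1) by blast
    then show "place_degree \<iota> P = 1" using rp(4) by simp
  qed
qed

end

section \<open>The places at infinity\<close>

lemma (in field_ext) leading_term:
  assumes "u \<noteq> 0"
  shows "degree g \<le> N \<Longrightarrow> \<exists>r\<in>adjoin \<iota> {1 / u}. ev g u / u ^ N - \<iota> (coeff g N) = 1 / u * r"
proof (induction g arbitrary: N)
  case 0
  then show ?case by (intro bexI[of _ 0]) (auto simp: adjoin_0)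
next
  case (pCons a g)
  show ?case
  proof (cases N)
    case 0
    then have "g = 0" using pCons.prems by (auto split: if_splits)
    then show ?thesis using 0 by (intro bexI[of _ 0]) (auto simp: adjoin_0)
  next
    case (Suc N')
    then have "degree g \<le> N'" using pCons.prems by (auto split: if_splits)
    then obtain r where r: "r \<in> adjoin \<iota> {1 / u}" "ev g u / u ^ N' - \<iota> (coeff g N') = 1 / u * r"
      using pCons.IH by blast
    have "ev (pCons a g) u / u ^ N - \<iota> (coeff (pCons a g) N)
        = \<iota> a * (1 / u) ^ N + (ev g u / u ^ N' - \<iota> (coeff g N'))"
      using assms by (simp add: Suc field_simps)
    also have "\<dots> = 1 / u * (\<iota> a * (1 / u) ^ N' + r)"
      unfolding r(2) by (simp add: Suc algebra_simps)
    finally show ?thesis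
      using r(1) by (intro bexI[of _ "\<iota> a * (1 / u) ^ N' + r"])
        (auto intro: adjoin.intros adjoin_power)
  qed
qed

text \<open>
  With \<open>n = u c\<close>, \<open>deg f = v c\<close> and \<open>j v - i u = 1\<close>, the functions \<open>t = x ^ i / y ^ j\<close>
  and \<open>w = y ^ u / x ^ v\<close> satisfy \<open>1 / x = t ^ u w ^ j\<close> and \<open>1 / y = t ^ v w ^ i\<close>,
  and \<open>w ^ c\<close> takes the leading coefficient of \<open>f\<close> as its value at infinity.
\<close>

locale superelliptic_infinity = superelliptic \<iota> q x y n f
  for \<iota> :: "'k::{finite,field} \<Rightarrow> 'f::field" and q x y n f +
  fixes u v c i j :: nat
  assumes n_eq: "n = u * c" and deg_eq: "degree f = v * c" and bezout: "j * v = i * u + 1"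
begin

definition t where "t = x ^ i / y ^ j"
definition w where "w = y ^ u / x ^ v"

abbreviation "l \<equiv> lead_coeff f"

lemma u_pos: "u > 0" and c_pos: "c > 0"
  using n_eq n_pos by (auto intro: Nat.gr0I)

lemma inverse_x: "1 / x = t ^ u * w ^ j"
proof -
  have "t ^ u * w ^ j = (x ^ (i * u) * y ^ (u * j)) / (y ^ (u * j) * x ^ (j * v))"
    by (simp add: t_def w_def power_divide mult.commute flip: power_mult)
  then show ?thesis using x_nonzero y_nonzero by (simp add: bezout)
qed

lemma inverse_y: "1 / y = t ^ v * w ^ i"
proof -
  have "t ^ v * w ^ i = (x ^ (i * v) * y ^ (i * u)) / (y ^ (j * v) * x ^ (i * v))"
    by (simp add: t_def w_def power_divide mult.commute flip: power_mult)
  then show ?thesis using x_nonzero y_nonzero by (simp add: bezout)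
qed

lemma w_power_c: "w ^ c = ev f x / x ^ degree f"
proof -
  have "w ^ c = y ^ n / x ^ degree f"
    by (simp add: w_def power_divide n_eq deg_eq flip: power_mult)
  then show ?thesis by (simp only: equation)
qed

sublocale inf: plane_chart \<iota> q t w "monom 1 c - [:l:]"
proof
  let ?A = "adjoin \<iota> {t, w}"
  have tw: "t \<in> ?A" "w \<in> ?A" by (auto intro: adjoin.intros)
  have x: "1 / x \<in> ?A" unfolding inverse_x by (intro adjoin_mult adjoin_power tw)
  have y: "1 / y \<in> ?A" unfolding inverse_y by (intro adjoin_mult adjoin_power tw)
  show "\<exists>g\<in>?A. \<exists>h\<in>?A. h \<noteq> 0 \<and> z = g / h" for z
  proof (rule fraction_field_adjoin)
    show "\<exists>g\<in>?A. \<exists>h\<in>?A. h \<noteq> 0 \<and> x = g / h"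
      using x x_nonzero by (intro bexI[of _ 1] bexI[of _ "1 / x"]) (auto simp: adjoin_1)
    show "\<exists>g\<in>?A. \<exists>h\<in>?A. h \<noteq> 0 \<and> y = g / h"
      using y y_nonzero by (intro bexI[of _ 1] bexI[of _ "1 / y"]) (auto simp: adjoin_1)
  qed
  show "t \<noteq> 0" using x_nonzero y_nonzero by (simp add: t_def)
  show "separable (monom 1 c - [:l:])"
    by (rule separable_binomial) (use f_deg of_nat_nonzero n_eq in auto)
  obtain r where r: "r \<in> adjoin \<iota> {1 / x}" "ev f x / x ^ degree f - \<iota> l = 1 / x * r"
    using leading_term[OF x_nonzero, of f "degree f"] by auto
  have "r \<in> ?A"
    using r(1) by induction (use x in \<open>auto intro: adjoin.adjoin_emb adjoin.adjoin_add adjoin.adjoin_mult\<close>)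
  have "ev (monom 1 c - [:l:]) w = 1 / x * r" using r(2) by (simp add: w_power_c)
  also have "1 / x = t * (t ^ (u - 1) * w ^ j)"
    unfolding inverse_x using u_pos by (metis Suc_diff_1 mult.assoc power_Suc)
  finally have "ev (monom 1 c - [:l:]) w = t * (t ^ (u - 1) * w ^ j * r)" by (simp only: mult.assoc)
  moreover have "t ^ (u - 1) * w ^ j * r \<in> ?A" by (intro adjoin_mult adjoin_power tw \<open>r \<in> ?A\<close>)
  ultimately show "\<exists>r\<in>?A. ev (monom 1 c - [:l:]) w = t * r" by blast
qed

lemma w_nonzero: "w \<noteq> 0"
  using x_nonzero y_nonzero by (simp add: w_def)

text \<open>
  From \<open>y ^ n = f(x)\<close> one gets \<open>u P(y) = v P(x)\<close>. Therefore \<open>P w = 0\<close> and \<open>u P(t) = - P(x) > 0\<close>, so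
  that the chart applies, gives \<open>P t = 1\<close>, and fixes the orders of \<open>x\<close> and \<open>y\<close>. For \<open>dx\<close> one
  differentiates \<open>1 / x\<close>, whose order \<open>u\<close> is positive and prime to the characteristic.
\<close>

lemma infinite_place:
  assumes "is_place \<iota> P" "P x < 0"
  shows "inf.centered P" "P x = - int u" "P y = - int v" "\<omega> P = int (q * u) - int u - 1"
proof -
  interpret place_of_ext \<iota> P by unfold_locales fact
  have "P (y ^ n) = int (degree f) * P x"
    unfolding equation using ev_pole[OF assms(2), of f] f_deg by (metis degree_0 less_irrefl)
  then have "int c * (int u * P y) = int c * (int v * P x)"
    using y_nonzero by (simp add: P_power n_eq deg_eq mult_ac)
  then have uv: "int u * P y = int v * P x" using c_pos by simp
  have Pt: "P t = int i * P x - int j * P y" and Pw: "P w = int u * P y - int v * P x"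
    using x_nonzero y_nonzero by (simp_all add: t_def w_def P_divide P_power)
  have bez: "int j * int v = int i * int u + 1" using bezout by (metis of_nat_1 of_nat_add of_nat_mult)
  have "int u * P t = int i * int u * P x - int j * (int u * P y)"
    unfolding Pt by (simp add: algebra_simps)
  also have "\<dots> = (int i * int u - int j * int v) * P x" unfolding uv by (simp add: algebra_simps)
  finally have ut: "int u * P t = - P x" by (simp add: bez)
  then have "int u * P t > 0" using assms(2) by simp
  then have "P t > 0" using u_pos by (simp add: zero_less_mult_iff)
  then show cen: "inf.centered P"
    using assms(1) Pw uv by (simp add: inf.centered_def ord_ge_def)
  then have "P t = 1" by (rule inf.centered_parameter)
  then show Px: "P x = - int u" using ut by simp
  then have "int u * P y = int u * (- int v)" using uv by simp
  then show "P y = - int v" using u_pos by (metis mult_left_cancel of_nat_0_less_iff less_irrefl)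
  have xq: "P (x ^ q - x) = int q * P x"
  proof -
    have "degree (monom 1 q - monom (1 :: 'k) 1) = q"
      unfolding diff_conv_add_uminus
      by (subst degree_add_eq_left) (use q_ge_2 in \<open>auto simp: degree_monom_eq\<close>)
    then show ?thesis
      unfolding xq_eq using ev_pole[OF assms(2), of "monom 1 q - monom 1 1"] q_ge_2 by fastforce
  qed
  have "\<theta> x \<noteq> 0 \<and> P (\<theta> x) = - int u - 1"
    if t': "P t' = 1" and \<theta>: "is_derivation \<iota> \<theta>" "\<theta> t' = 1" for t' \<theta>
  proof -
    interpret frobenius_place \<iota> q x P t' using t' by unfold_locales
    have d: "\<theta> (1 / x) \<noteq> 0 \<and> P (\<theta> (1 / x)) = int u - 1"
      by (rule derivation_order[OF \<theta>]) (use x_nonzero Px of_nat_nonzero n_eq in \<open>auto simp: P_divide\<close>)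
    have "\<theta> (x * (1 / x)) = x * \<theta> (1 / x) + 1 / x * \<theta> x" using \<theta>(1) unfolding is_derivation_def by blast
    moreover have "\<theta> (x * (1 / x)) = 0" using derivation_power[OF \<theta>(1), of 1 0] x_nonzero by simp
    ultimately have "\<theta> x = - (x * x * \<theta> (1 / x))" using x_nonzero by (simp add: field_simps eq_neg_iff_add_eq_0)
    then show ?thesis using d x_nonzero Px by (simp add: P_mult)
  qed
  then have "\<omega> P = P (- 1 / (x ^ q - x)) + (- int u - 1)"
    by (intro differential_order_eq assms(1)) (use xq_nonzero in auto)
  then show "\<omega> P = int (q * u) - int u - 1" using xq_nonzero xq Px by (simp add: P_divide)
qed

lemma centered_infinite:
  assumes "inf.centered P"
  shows "is_place \<iota> P" "P x < 0"
proof -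
  show P: "is_place \<iota> P" using assms by (simp add: inf.centered_def)
  interpret place_of_ext \<iota> P by unfold_locales fact
  have "P (1 / x) = int u * P t + int j * P w"
    unfolding inverse_x using inf.t_nonzero w_nonzero by (simp add: P_mult P_power)
  moreover have "P t > 0" "P w \<ge> 0" using assms w_nonzero by (auto simp: inf.centered_def ord_ge_def)
  ultimately have "P (1 / x) > 0" using u_pos by (simp add: add_pos_nonneg)
  then show "P x < 0" using x_nonzero by (simp add: P_divide)
qed

lemma centered_iff: "inf.centered P \<longleftrightarrow> is_place \<iota> P \<and> P x < 0"
  using centered_infinite infinite_place by blast

end

section \<open>Power series roots\<close>

lemma power_add_square:
  fixes a h :: "'a::comm_ring_1"
  shows "\<exists>r. (a + h) ^ m = a ^ m + of_nat m * a ^ (m - 1) * h + h ^ 2 * r"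
proof (induction m)
  case 0
  then show ?case by (intro exI[of _ 0]) simp
next
  case (Suc m)
  then obtain r where r: "(a + h) ^ m = a ^ m + of_nat m * a ^ (m - 1) * h + h ^ 2 * r" by blast
  have "(a + h) ^ Suc m = (a + h) * (a ^ m + of_nat m * a ^ (m - 1) * h + h ^ 2 * r)"
    by (simp add: r)
  also have "\<dots> = a ^ Suc m + of_nat (Suc m) * a ^ m * h + h ^ 2 * (of_nat m * a ^ (m - 1) + (a + h) * r)"
    by (cases m) (simp_all add: algebra_simps power2_eq_square)
  finally show ?case by auto
qed

text \<open>Hensel's lemma for \<open>Z ^ n = g\<close>: the coefficients of \<open>Z\<close> are determined one at a time,
  since \<open>n Z ^ (n - 1)\<close> is a unit.\<close>

lemma fps_nth_root_exists:
  fixes g :: "'a::field fps"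
  assumes "of_nat n \<noteq> (0 :: 'a)" "l ^ n = fps_nth g 0" "l \<noteq> 0"
  shows "\<exists>Z. Z ^ n = g \<and> fps_nth Z 0 = l"
proof -
  let ?ok = "\<lambda>m s. fps_nth s 0 = l \<and> (\<exists>e. s ^ n - g = fps_X ^ Suc m * e)"
  have start: "\<exists>s. ?ok 0 s"
  proof (rule exI[of _ "fps_const l"], rule conjI)
    have "fps_nth (fps_const l ^ n - g) 0 = 0" using assms by (simp add: fps_const_power)
    then have "fps_const l ^ n - g = fps_X ^ Suc 0 * fps_shift 1 (fps_const l ^ n - g)"
      by (intro fps_ext) (auto simp: fps_X_power_mult_nth)
    then show "\<exists>e. fps_const l ^ n - g = fps_X ^ Suc 0 * e" by blast
  qed simp
  have step: "\<exists>s'. ?ok (Suc m) s' \<and> (\<exists>c. s' = s + fps_const c * fps_X ^ Suc m)" if s: "?ok m s" for m s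
  proof -
    obtain e where e: "s ^ n - g = fps_X ^ Suc m * e" using s by blast
    define c where "c = - fps_nth e 0 / (of_nat n * l ^ (n - 1))"
    define s' where "s' = s + fps_const c * fps_X ^ Suc m"
    obtain r where r: "s' ^ n = s ^ n + of_nat n * s ^ (n - 1) * (fps_const c * fps_X ^ Suc m) + (fps_const c * fps_X ^ Suc m) ^ 2 * r"
      unfolding s'_def using power_add_square by blast
    define E where "E = e + of_nat n * s ^ (n - 1) * fps_const c + fps_X ^ Suc m * (fps_const c ^ 2 * r)"
    have sn: "s ^ n = g + fps_X ^ Suc m * e" using e by (simp add: algebra_simps)
    have "s' ^ n - g = fps_X ^ Suc m * E"
      unfolding r sn E_def by (simp add: algebra_simps power2_eq_square)
    moreover have "fps_nth E 0 = 0"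
      using s assms by (simp add: E_def c_def fps_power_zeroth fps_of_nat[symmetric] del: fps_of_nat)
    then have "E = fps_X * fps_shift 1 E" by (intro fps_ext) (auto simp: fps_X_mult_nth)
    ultimately have "s' ^ n - g = fps_X ^ Suc (Suc m) * fps_shift 1 E"
      by (metis mult.assoc power_Suc2)
    moreover have "fps_nth s' 0 = l" using s by (simp add: s'_def)
    ultimately show ?thesis using s'_def by blast
  qed
  obtain S where S: "\<And>m. ?ok m (S m)" and S_Suc: "\<And>m. \<exists>c. S (Suc m) = S m + fps_const c * fps_X ^ Suc m"
    using dependent_nat_choice[of ?ok "\<lambda>m s s'. \<exists>c. s' = s + fps_const c * fps_X ^ Suc m"] start step by blast
  have stable: "fps_nth (S (m + k)) i = fps_nth (S m) i" if "i \<le> m" for m k i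
  proof (induction k)
    case (Suc k)
    obtain c where "S (Suc (m + k)) = S (m + k) + fps_const c * fps_X ^ Suc (m + k)" using S_Suc by blast
    then show ?case using Suc that by (simp add: fps_X_power_mult_right_nth del: power_Suc)
  qed simp
  define Z where "Z = Abs_fps (\<lambda>i. fps_nth (S i) i)"
  have Z_S: "\<exists>r. Z - S m = fps_X ^ Suc m * r" for m
  proof -
    have "fps_nth (Z - S m) i = 0" if "i < Suc m" for i
      using stable[of i i "m - i"] that by (simp add: Z_def)
    then have "Z - S m = fps_X ^ Suc m * fps_shift (Suc m) (Z - S m)"
      by (intro fps_ext) (auto simp: fps_X_power_mult_nth simp del: power_Suc)
    then show ?thesis by blast
  qed
  have "fps_nth (Z ^ n) m = fps_nth g m" for m
  proof -
    obtain r where r: "Z - S m = fps_X ^ Suc m * r" using Z_S by blast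
    obtain e where e: "S m ^ n - g = fps_X ^ Suc m * e" using S by blast
    have "Z ^ n - g = (Z ^ n - S m ^ n) + (S m ^ n - g)" by simp
    also have "Z ^ n - S m ^ n = fps_X ^ Suc m * (r * (\<Sum>i<n. S m ^ (n - Suc i) * Z ^ i))"
      by (simp only: power_diff_sumr2 r mult.assoc)
    finally have "Z ^ n - g = fps_X ^ Suc m * (r * (\<Sum>i<n. S m ^ (n - Suc i) * Z ^ i) + e)"
      by (simp only: e distrib_left)
    then have "fps_nth (Z ^ n - g) m = 0" by (simp only: fps_X_power_mult_nth) simp
    then show ?thesis by simp
  qed
  then have "Z ^ n = g" by (intro fps_ext)
  moreover have "fps_nth Z 0 = l" using S[of 0] by (simp add: Z_def)
  ultimately show ?thesis by blast
qed

section \<open>Laurent series at infinity\<close>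

text \<open>The pairs \<open>(x, y)\<close> and \<open>(x', y')\<close> satisfy the same polynomial relations, the multiples
  of \<open>Y ^ n - f(X)\<close>.\<close>

lemma superelliptic_embedding:
  assumes "superelliptic \<iota> q x y n f" "kummer_point \<iota>' q x' y' n f"
  shows "\<exists>\<phi>. field_embedding \<phi> \<and> (\<forall>a. \<phi> (\<iota> a) = \<iota>' a) \<and> \<phi> x = x' \<and> \<phi> y = y'"
proof -
  interpret A: superelliptic \<iota> q x y n f by fact
  interpret B: kummer_point \<iota>' q x' y' n f by fact
  have iff: "A.two.ev x G y = 0 \<longleftrightarrow> B.two.ev x' G y' = 0" for G
    by (simp only: A.vanishes_iff B.vanishes_iff)
  define \<phi> where "\<phi> z = (SOME z'. \<exists>p r. A.two.ev x r y \<noteq> 0 \<and> z = A.two.ev x p y / A.two.ev x r y \<and>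
    z' = B.two.ev x' p y' / B.two.ev x' r y')" for z
  have \<phi>: "\<phi> (A.two.ev x p y / A.two.ev x r y) = B.two.ev x' p y' / B.two.ev x' r y'"
    if r: "A.two.ev x r y \<noteq> 0" for p r
    unfolding \<phi>_def
  proof (rule some_equality)
    fix z' assume "\<exists>p' r'. A.two.ev x r' y \<noteq> 0 \<and> A.two.ev x p y / A.two.ev x r y = A.two.ev x p' y / A.two.ev x r' y \<and>
      z' = B.two.ev x' p' y' / B.two.ev x' r' y'"
    then obtain p' r' where *: "A.two.ev x r' y \<noteq> 0"
      "A.two.ev x p y / A.two.ev x r y = A.two.ev x p' y / A.two.ev x r' y"
      "z' = B.two.ev x' p' y' / B.two.ev x' r' y'" by blast
    then have "A.two.ev x (p * r' - p' * r) y = 0" using r by (simp add: field_simps)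
    then have "B.two.ev x' (p * r' - p' * r) y' = 0" using iff by blast
    moreover have "B.two.ev x' r y' \<noteq> 0" "B.two.ev x' r' y' \<noteq> 0" using iff r * by blast+
    ultimately show "z' = B.two.ev x' p y' / B.two.ev x' r y'"
      unfolding *(3) by (simp add: field_simps)
  qed (use r in blast)
  have \<phi>_poly: "\<phi> (A.two.ev x p y) = B.two.ev x' p y'" for p
    using \<phi>[of 1 p] by simp
  have "\<phi> (u + v) = \<phi> u + \<phi> v \<and> \<phi> (u * v) = \<phi> u * \<phi> v" for u v
  proof -
    obtain p r where u: "A.two.ev x r y \<noteq> 0" "u = A.two.ev x p y / A.two.ev x r y"
      using A.function_field by blast
    obtain p' r' where v: "A.two.ev x r' y \<noteq> 0" "v = A.two.ev x p' y / A.two.ev x r' y"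
      using A.function_field by blast
    have nz: "A.two.ev x (r * r') y \<noteq> 0" "B.two.ev x' r y' \<noteq> 0" "B.two.ev x' r' y' \<noteq> 0"
      using u v iff by auto
    have "u + v = A.two.ev x (p * r' + p' * r) y / A.two.ev x (r * r') y"
      using u v by (simp add: add_frac_eq)
    then have "\<phi> (u + v) = B.two.ev x' (p * r' + p' * r) y' / B.two.ev x' (r * r') y'"
      by (simp only: \<phi>[OF nz(1)])
    moreover have "u * v = A.two.ev x (p * p') y / A.two.ev x (r * r') y"
      using u v by simp
    then have "\<phi> (u * v) = B.two.ev x' (p * p') y' / B.two.ev x' (r * r') y'"
      by (simp only: \<phi>[OF nz(1)])
    ultimately show ?thesis using u v \<phi>[OF u(1)] \<phi>[OF v(1)] nz by (simp add: add_frac_eq)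
  qed
  moreover have "\<phi> 1 = 1" using \<phi>_poly[of 1] by simp
  moreover have "\<phi> (\<iota> a) = \<iota>' a" for a using \<phi>_poly[of "[:[:a:]:]"] by simp
  moreover have "\<phi> x = x'" using \<phi>_poly[of "[:monom 1 1:]"] by simp
  moreover have "\<phi> y = y'" using \<phi>_poly[of "monom 1 1"] by simp
  ultimately show ?thesis by (intro exI[of _ \<phi>]) (simp add: field_embedding_def)
qed

abbreviation laurent_emb :: "'k::field \<Rightarrow> 'k alg_closure fls" where
  "laurent_emb a \<equiv> fls_const (to_ac a)"

lemma laurent_field_embedding: "field_embedding (laurent_emb :: 'k::field \<Rightarrow> _)"
  by (simp add: field_embedding_def fls_plus_const fls_const_mult_const)

lemma laurent_place: "is_place (laurent_emb :: 'k::field \<Rightarrow> _) fls_subdegree"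
  unfolding is_place_def
proof (intro conjI allI impI)
  fix u v :: "'k alg_closure fls" assume "u + v \<noteq> 0"
  then show "min (fls_subdegree u) (fls_subdegree v) \<le> fls_subdegree (u + v)"
    by (rule fls_plus_subdegree)
qed (auto intro: exI[of _ fls_X])

context superelliptic_infinity
begin

text \<open>
  Choose a root \<open>\<rho>\<close> of \<open>\<psi>\<close> in an algebraic closure and \<open>e\<close> with \<open>e ^ u = \<rho>\<close>. With \<open>x' = T ^ (- u)\<close> and
  \<open>y' = T ^ (- v) W\<close>, where \<open>W\<close> is the \<open>n\<close>-th root of \<open>f(x') / x' ^ d\<close> with constant term \<open>e\<close>, the
  pair \<open>(x', y')\<close> lies on the curve. The \<open>T\<close>-adic valuation restricts to a place of \<open>F\<close> at which
  \<open>w = y ^ u / x ^ v\<close> corresponds to \<open>W ^ u\<close> and so has residue \<open>\<rho>\<close>.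
\<close>

lemma exists_place_at_infinity:
  assumes \<psi>: "monic_irreducible \<psi>" "\<psi> dvd monom 1 c - [:l:]"
  shows "\<exists>P. inf.centered P \<and> inf.residue_poly P = \<psi>"
proof -
  define T where "T = (fls_X :: 'k alg_closure fls)"
  interpret L: finite_field_ext "laurent_emb :: 'k \<Rightarrow> _" q
    by unfold_locales (use laurent_field_embedding q_def in auto)
  interpret L: place_of_ext "laurent_emb :: 'k \<Rightarrow> _" fls_subdegree
    by unfold_locales (rule laurent_place)
  interpret ac: field_ext "to_ac :: 'k \<Rightarrow> _"
    by unfold_locales (simp add: field_embedding_def)
  have ev_const: "L.ev p (fls_const e) = fls_const (ac.ev p e)" for p e
    by (induction p) (simp_all add: fls_plus_const fls_const_mult_const)
  have "degree (map_poly to_ac \<psi>) > 0"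
    using irreducible_degree_pos[of \<psi>] \<psi> by (simp add: degree_map_poly)
  then obtain \<rho> where "poly (map_poly to_ac \<psi>) \<rho> = 0"
    using alg_closed_imp_poly_has_root by blast
  then have \<rho>: "ac.ev \<psi> \<rho> = 0" by (simp add: ac.ev_def)
  have "ac.ev (monom 1 c - [:l:]) \<rho> = 0" using ac.ev_dvd[OF \<psi>(2), of \<rho>] \<rho> by simp
  then have \<rho>c: "\<rho> ^ c = to_ac l" by simp
  have "degree (monom 1 u - [:\<rho>:]) = u"
    unfolding diff_conv_add_uminus
    by (subst degree_add_eq_left) (use u_pos in \<open>auto simp: degree_monom_eq\<close>)
  then obtain e where "poly (monom 1 u - [:\<rho>:]) e = 0"
    using alg_closed_imp_poly_has_root u_pos by metis
  then have e: "e ^ u = \<rho>" by (simp add: poly_monom)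
  have en: "e ^ n = to_ac l" by (simp add: n_eq power_mult e \<rho>c)
  have "l \<noteq> 0" using f_deg by auto
  then have e0: "e \<noteq> 0" using en n_pos by (auto simp: zero_power)
  define x' where "x' = 1 / T ^ u"
  have T: "T \<noteq> 0" and T_deg: "fls_subdegree T = 1" by (simp_all add: T_def)
  have T_pow: "T ^ m \<noteq> 0" for m using T by (rule power_not_zero)
  have x'0: "x' \<noteq> 0" and x'_deg: "fls_subdegree x' = - int u"
    unfolding x'_def using T_pow[of u] L.P_divide[OF one_neq_zero T_pow[of u]] L.P_power[OF T, of u]
    by (simp_all add: T_deg)
  define g where "g = L.ev f x' / x' ^ degree f"
  obtain r where r: "r \<in> adjoin laurent_emb {1 / x'}" "g - laurent_emb l = 1 / x' * r"
    using L.leading_term[OF x'0, of f "degree f"] by (auto simp: g_def)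
  have "L.ord_ge 1 (1 / x')" using x'_deg x'0 u_pos by (simp add: L.ord_ge_def L.P_divide)
  moreover from this have "L.ord_ge 0 r"
    by (intro L.adjoin_ord_ge_0[OF _ r(1)]) (auto intro: L.ord_ge_mono)
  ultimately have g_l: "L.ord_ge 1 (g - laurent_emb l)"
    unfolding r(2) using L.ord_ge_mult0 by (metis mult.commute)
  then have "L.ord_ge 0 ((g - laurent_emb l) + laurent_emb l)"
    by (intro L.ord_ge_add) (auto intro: L.ord_ge_mono)
  then have g_nonneg: "fls_subdegree g \<ge> 0" by (auto simp: L.ord_ge_def)
  have "fls_nth (g - laurent_emb l) 0 = 0"
  proof (cases "g - laurent_emb l = 0")
    case True
    then show ?thesis by (simp only: fls_zero_nth)
  next
    case False
    then have "1 \<le> fls_subdegree (g - laurent_emb l)" using g_l unfolding L.ord_ge_def by blast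
    then have "0 < fls_subdegree (g - laurent_emb l)" by linarith
    then show ?thesis by (rule fls_eq0_below_subdegree)
  qed
  then have g0: "fps_nth (fls_regpart g) 0 = e ^ n" by (simp add: en)
  have "of_nat n \<noteq> (0 :: 'k alg_closure)"
    using of_nat_nonzero[of n] ac.emb_eq_0_iff[of "of_nat n"] by simp
  then obtain Z where Z: "Z ^ n = fls_regpart g" "fps_nth Z 0 = e"
    using fps_nth_root_exists[of n e "fls_regpart g"] g0 e0 by auto
  define W where "W = fps_to_fls Z"
  have Wn: "W ^ n = g"
    using Z(1) g_nonneg by (simp add: W_def fls_regpart_to_fls_trivial flip: fps_to_fls_power)
  have W0: "fls_nth W 0 = e" using Z(2) by (simp add: W_def)
  have W_nz: "W \<noteq> 0" using W0 e0 by auto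
  have W_deg: "fls_subdegree W = 0"
    using W0 e0 by (intro fls_subdegree_eqI) (auto simp: W_def)
  define y' where "y' = W / T ^ v"
  have y'_nz: "y' \<noteq> 0" and y'_deg: "fls_subdegree y' = - int v"
    unfolding y'_def using T_pow[of v] W_nz W_deg L.P_divide[OF W_nz T_pow[of v]] L.P_power[OF T, of v]
    by (simp_all add: T_deg)
  have "y' ^ n = g * x' ^ degree f"
    using Wn T by (simp add: y'_def x'_def power_divide n_eq deg_eq mult_ac flip: power_mult)
  then have y'n: "y' ^ n = L.ev f x'" using x'0 by (simp add: g_def)
  have "kummer_point (laurent_emb :: 'k \<Rightarrow> _) q x' y' n f"
  proof unfold_locales
    show "L.ev p x' \<noteq> 0" if "p \<noteq> 0" for p
      using L.ev_pole[OF _ that, of x'] x'_deg u_pos by simp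
  qed (use y'n n_pos n_dvd f_sep f_deg in auto)
  then obtain \<phi> where \<phi>: "field_embedding \<phi>" "\<And>a. \<phi> (\<iota> a) = laurent_emb a" "\<phi> x = x'" "\<phi> y = y'"
    using superelliptic_embedding[of \<iota> q x y n f laurent_emb x' y'] superelliptic_axioms by blast
  interpret \<phi>: field_ext \<phi> by unfold_locales (rule \<phi>(1))
  define P where "P z = fls_subdegree (\<phi> z)" for z
  have place: "is_place \<iota> P"
    unfolding is_place_def
  proof (intro conjI allI impI)
    show "min (P z) (P z') \<le> P (z + z')" if "z \<noteq> 0" "z' \<noteq> 0" "z + z' \<noteq> 0" for z z'
    proof -
      have "\<phi> z + \<phi> z' \<noteq> 0" using that(3) by (simp flip: \<phi>.hom_add)
      then show ?thesis unfolding P_def \<phi>.hom_add by (rule fls_plus_subdegree)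
    qed
    have "P t = 1"
    proof -
      have "P t = int i * fls_subdegree x' - int j * fls_subdegree y'"
        using x'0 y'_nz by (simp add: P_def t_def \<phi> L.P_divide L.P_power)
      also have "\<dots> = int j * int v - int i * int u" by (simp add: x'_deg y'_deg)
      also have "\<dots> = 1" using bezout by (metis add_diff_cancel_left' of_nat_1 of_nat_add of_nat_mult)
      finally show ?thesis .
    qed
    then show "\<exists>t. P t = 1" by blast
  qed (simp_all add: P_def \<phi>(2))
  interpret place_of_ext \<iota> P by unfold_locales (rule place)
  have "P x < 0" using x'_deg u_pos by (simp add: P_def \<phi>(3))
  then have cen: "inf.centered P" using place centered_iff by blast
  have \<phi>_ev: "\<phi> (ev p z) = L.ev p (\<phi> z)" for p z
    by (induction p) (simp_all add: \<phi>(2))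
  have "\<phi> w = W ^ u"
    using T by (simp add: w_def \<phi> y'_def x'_def power_divide mult.commute flip: power_mult)
  have "L.ord_ge 1 (W ^ u - fls_const \<rho>)"
  proof -
    define D where "D = Z ^ u - fps_const \<rho>"
    have "W ^ u - fls_const \<rho> = fps_to_fls D"
      by (simp add: W_def D_def fps_to_fls_power)
    moreover have "fps_nth D 0 = 0" by (simp add: D_def fps_power_zeroth Z(2) e)
    then have "D = 0 \<or> subdegree D \<ge> 1"
      by (metis less_one not_less nth_subdegree_nonzero)
    ultimately show ?thesis by (auto simp: L.ord_ge_def fls_subdegree_fls_to_fps)
  qed
  moreover have "L.ord_ge 0 (W ^ u)" "L.ord_ge 0 (fls_const \<rho>)"
    using W_deg by (auto intro: L.ord_ge_power simp: L.ord_ge_def[of _ W] L.ord_ge_def[of _ "fls_const \<rho>"])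
  ultimately have "L.ord_ge 1 (L.ev \<psi> (W ^ u) - L.ev \<psi> (fls_const \<rho>))" by (intro L.ev_congruence)
  then have "L.ord_ge 1 (\<phi> (ev \<psi> w))" by (simp add: ev_const \<rho> \<phi>_ev \<open>\<phi> w = W ^ u\<close>)
  then have "ord_ge 1 (ev \<psi> w)" by (auto simp: L.ord_ge_def ord_ge_def P_def)
  then have "inf.residue_poly P dvd \<psi>" using inf.residue_poly(2)[OF cen] by blast
  then have "inf.residue_poly P = \<psi>"
    using monic_irreducible_dvd_eq inf.residue_poly(1)[OF cen] \<psi>(1) by blast
  then show ?thesis using cen by blast
qed

text \<open>
  The places at infinity correspond to the irreducible factors of \<open>X ^ c - l\<close>, with equal degrees.
\<close>

lemma degree_at_infinity: "(\<Sum>P | is_place \<iota> P \<and> P x < 0. place_degree \<iota> P) = c"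
proof -
  have bij: "bij_betw inf.residue_poly {P. inf.centered P} {\<psi>. monic_irreducible \<psi> \<and> \<psi> dvd monom 1 c - [:l:]}"
    unfolding bij_betw_def
  proof
    show "inj_on inf.residue_poly {P. inf.centered P}"
      using inf.residue_poly_inj by (auto intro!: inj_onI)
    show "inf.residue_poly ` {P. inf.centered P} = {\<psi>. monic_irreducible \<psi> \<and> \<psi> dvd monom 1 c - [:l:]}"
    proof (intro equalityI subsetI)
      fix \<psi> assume "\<psi> \<in> {\<psi>. monic_irreducible \<psi> \<and> \<psi> dvd monom 1 c - [:l:]}"
      then obtain P where "inf.centered P" "inf.residue_poly P = \<psi>"
        using exists_place_at_infinity by blast
      then show "\<psi> \<in> inf.residue_poly ` {P. inf.centered P}" by blast
    qed (use inf.residue_poly in blast)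
  qed
  have "(\<Sum>P | is_place \<iota> P \<and> P x < 0. place_degree \<iota> P) = (\<Sum>P | inf.centered P. degree (inf.residue_poly P))"
    by (rule sum.cong) (auto simp: centered_iff inf.residue_poly(4))
  also have "\<dots> = (\<Sum>\<psi> | monic_irreducible \<psi> \<and> \<psi> dvd monom 1 c - [:l:]. degree \<psi>)"
    by (rule sum.reindex_bij_betw[OF bij])
  also have "\<dots> = degree (monom 1 c - [:l:])"
    using separable_sum_degree_factors[OF inf.sep] by blast
  also have "\<dots> = c"
    unfolding diff_conv_add_uminus
    by (subst degree_add_eq_left) (use c_pos in \<open>auto simp: degree_monom_eq\<close>)
  finally show ?thesis .
qed

end

section \<open>Divisor classes\<close>

context field_ext
begin

lemma div_fun_mult: "g \<noteq> 0 \<Longrightarrow> h \<noteq> 0 \<Longrightarrow> div_fun \<iota> (g * h) = div_fun \<iota> g + div_fun \<iota> h"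
  by (auto simp: div_fun_def fun_eq_iff is_place_def)

lemma div_fun_1: "div_fun \<iota> 1 = 0"
  unfolding div_fun_def fun_eq_iff
  using place_of_ext.P_1[of \<iota>] field_ext_axioms by (auto simp: place_of_ext_def place_of_ext_axioms_def)

lemma principal_add_coset: "g \<noteq> 0 \<Longrightarrow> {h + div_fun \<iota> g | h. h \<in> principal_divisors \<iota>} = principal_divisors \<iota>"
proof (intro equalityI subsetI)
  fix A assume g: "g \<noteq> 0" and "A \<in> {h + div_fun \<iota> g | h. h \<in> principal_divisors \<iota>}"
  then obtain h where "h \<noteq> 0" "A = div_fun \<iota> h + div_fun \<iota> g"
    by (auto simp: principal_divisors_def)
  then have "A = div_fun \<iota> (h * g)" "h * g \<noteq> 0" using div_fun_mult g by simp_all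
  then show "A \<in> principal_divisors \<iota>" by (auto simp: principal_divisors_def)
next
  fix A assume g: "g \<noteq> 0" and "A \<in> principal_divisors \<iota>"
  then obtain h where h: "h \<noteq> 0" "A = div_fun \<iota> h" by (auto simp: principal_divisors_def)
  then have "A = div_fun \<iota> (h / g) + div_fun \<iota> g" using div_fun_mult[of "h / g" g] g by simp
  moreover have "div_fun \<iota> (h / g) \<in> principal_divisors \<iota>"
    using h g by (auto simp: principal_divisors_def)
  ultimately show "A \<in> {h + div_fun \<iota> g | h. h \<in> principal_divisors \<iota>}" by blast
qed

lemma divisor_class_eq: "divisor_class \<iota> A = {h + A | h. h \<in> principal_divisors \<iota>}"
  by (auto simp: divisor_class_def r_coset_def divisor_group_def)

lemma lin_equiv_imp_class_eq:
  assumes "lin_equiv \<iota> A B"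
  shows "divisor_class \<iota> A = divisor_class \<iota> B"
proof -
  obtain g where g: "g \<noteq> 0" "A - B = div_fun \<iota> g" using assms by (auto simp: lin_equiv_def)
  then have "A = div_fun \<iota> g + B" by (metis diff_add_cancel)
  then have "divisor_class \<iota> A = (\<lambda>h. h + B) ` {h + div_fun \<iota> g | h. h \<in> principal_divisors \<iota>}"
    by (auto simp: divisor_class_eq add.assoc)
  then show ?thesis unfolding principal_add_coset[OF g(1)] by (auto simp: divisor_class_eq)
qed

lemma divisor_class_add:
  "divisor_class \<iota> A \<otimes>\<^bsub>Pic \<iota>\<^esub> divisor_class \<iota> B = divisor_class \<iota> (A + B)"
proof -
  have "divisor_class \<iota> A \<otimes>\<^bsub>Pic \<iota>\<^esub> divisor_class \<iota> B
      = {(h + A) + (h' + B) | h h'. h \<in> principal_divisors \<iota> \<and> h' \<in> principal_divisors \<iota>}"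
    by (auto simp: Pic_def FactGroup_def set_mult_def divisor_group_def divisor_class_eq)
  also have "\<dots> = divisor_class \<iota> (A + B)"
    unfolding divisor_class_eq
  proof (intro equalityI subsetI)
    fix C assume "C \<in> {(h + A) + (h' + B) | h h'. h \<in> principal_divisors \<iota> \<and> h' \<in> principal_divisors \<iota>}"
    then obtain g g' where g: "g \<noteq> 0" "g' \<noteq> 0" "C = (div_fun \<iota> g + A) + (div_fun \<iota> g' + B)"
      by (auto simp: principal_divisors_def)
    then have "C = div_fun \<iota> (g * g') + (A + B)" by (simp add: div_fun_mult algebra_simps)
    then show "C \<in> {h + (A + B) | h. h \<in> principal_divisors \<iota>}"
      using g by (auto simp: principal_divisors_def)
  next
    fix C assume "C \<in> {h + (A + B) | h. h \<in> principal_divisors \<iota>}"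
    then obtain h where "h \<in> principal_divisors \<iota>" "C = (h + A) + (div_fun \<iota> 1 + B)"
      by (auto simp: div_fun_1 add.assoc)
    moreover have "div_fun \<iota> 1 \<in> principal_divisors \<iota>" by (auto simp: principal_divisors_def)
    ultimately show "C \<in> {(h + A) + (h' + B) | h h'. h \<in> principal_divisors \<iota> \<and> h' \<in> principal_divisors \<iota>}"
      by blast
  qed
  finally show ?thesis .
qed

lemma divisor_class_power:
  "divisor_class \<iota> A [^]\<^bsub>Pic \<iota>\<^esub> m = divisor_class \<iota> (div_scale (int m) A)"
proof (induction m)
  case 0
  have zero: "div_scale (int 0) A = 0" by (simp add: div_scale_def fun_eq_iff)
  have one: "divisor_class \<iota> 0 = principal_divisors \<iota>" by (simp add: divisor_class_eq)
  show ?case unfolding zero one nat_pow_0 by (simp add: Pic_def FactGroup_def)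
next
  case (Suc m)
  have "div_scale (int m) A + A = div_scale (int (Suc m)) A"
    by (simp add: div_scale_def fun_eq_iff algebra_simps)
  then show ?case using Suc divisor_class_add by simp
qed

lemma power_in_generate: "g [^]\<^bsub>G\<^esub> (m :: nat) \<in> generate G {g}"
  by (induction m) (auto intro: generate.one generate.eng generate.incl)

end

section \<open>The divisor K minus the minimum of G and A\<close>

context superelliptic_infinity
begin

definition Dinf :: "'f divisor" where "Dinf = div_infinity \<iota> x"
definition D :: "'f divisor" where "D = div_affine_rational \<iota> x"
definition K :: "'f divisor" where "K = div_differential \<iota> (- 1 / (x ^ q - x)) x"
definition G :: "int \<Rightarrow> 'f divisor" where "G s = div_scale s Dinf"
definition A :: "int \<Rightarrow> 'f divisor" where "A s = D - G s + K"
definition powers :: "'k set" where "powers = {a. poly f a \<in> {b ^ n | b. b \<noteq> 0}}"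
definition M :: int where "M = int (q * u) - int u - 1"

text \<open>The function that realises the linear equivalence.\<close>

definition H :: 'f where "H = y ^ (n - 1) / (\<Prod>a\<in>powers. x - \<iota> a)"

lemma c_eq_gcd: "gcd n (degree f) = c"
proof -
  have "coprime u v"
  proof (rule coprimeI)
    fix e assume "e dvd u" "e dvd v"
    then have "e dvd i * u + 1" using bezout by (metis dvd_mult)
    then show "is_unit e" using \<open>e dvd u\<close> by (metis dvd_add_right_iff dvd_mult)
  qed
  then show ?thesis unfolding n_eq deg_eq by (simp add: gcd_mult_distrib_nat[symmetric] mult.commute)
qed

lemma M_eq: "superelliptic_M n (degree f) q = M"
proof -
  have "(int q - 1) * int n = ((int q - 1) * int u) * int c" by (simp add: n_eq)
  then have "(int q - 1) * int n div int c = (int q - 1) * int u"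
    using c_pos by (simp only:) simp
  then show ?thesis by (simp add: superelliptic_M_def c_eq_gcd M_def algebra_simps)
qed

text \<open>
  This integer is \<open>t(s) / c\<close>, in the form in which it arises from the orders at infinity.
\<close>

definition multiple :: "int \<Rightarrow> int" where
  "multiple s = (int n - 1) * int v - int (card powers) * int u + M - min s (M - s)"

lemma card_powers: "int (card powers) = int q - int (non_power_count n f)"
proof -
  have "card powers + card (- powers) = card (UNIV :: 'k set)"
    by (subst card_Un_disjoint[symmetric]) auto
  moreover have "- powers = {a. poly f a \<notin> {b ^ n | b. b \<noteq> 0}}" by (auto simp: powers_def)
  ultimately show ?thesis by (simp add: non_power_count_def q_def)
qed

text \<open>
  The parity of the numerator makes the division by \<open>2\<close> in the genus exact; the rest is
  arithmetic with \<open>n = u c\<close> and \<open>d = v c\<close>.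
\<close>

lemma t_eq: "superelliptic_t n (degree f) q (non_power_count n f) s = int c * multiple s"
proof -
  let ?d = "degree f" and ?\<delta> = "int (non_power_count n f)"
  have "even ((int n - 1) * (int ?d - 1) + 1 - int c)"
  proof -
    have "even c \<longleftrightarrow> even n \<and> even ?d"
      using c_eq_gcd by (metis gcd_greatest_iff)
    then show ?thesis by auto
  qed
  then have "2 * superelliptic_genus n ?d = (int n - 1) * (int ?d - 1) + 1 - int c"
    by (simp add: superelliptic_genus_def c_eq_gcd)
  then have "superelliptic_t n ?d q (non_power_count n f) s
      = (int n - 1) * (int ?d - 1) - 1 - int c - int c * min s (M - s) + int n * ?\<delta>"
    by (simp add: superelliptic_t_def superelliptic_mu_def M_eq c_eq_gcd)
  also have "\<dots> = int c * multiple s"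
    unfolding multiple_def M_def card_powers by (simp add: n_eq deg_eq algebra_simps)
  finally show ?thesis .
qed

lemma P_H:
  assumes "is_place \<iota> P"
  shows "P H = (int n - 1) * P y - (\<Sum>a\<in>powers. P (x - \<iota> a))"
proof -
  interpret place_of_ext \<iota> P by unfold_locales fact
  have nz: "(\<Prod>a\<in>powers. x - \<iota> a) \<noteq> 0" using x_minus_nonzero by simp
  have "P H = int (n - 1) * P y - P (\<Prod>a\<in>powers. x - \<iota> a)"
    using nz y_nonzero by (simp add: H_def P_divide P_power)
  also have "P (\<Prod>a\<in>powers. x - \<iota> a) = (\<Sum>a\<in>powers. P (x - \<iota> a))"
    by (rule P_prod) (rule x_minus_nonzero)
  finally show ?thesis using n_pos by (simp add: of_nat_diff)
qed

lemma H_nonzero: "H \<noteq> 0"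
  using y_nonzero x_minus_nonzero by (simp add: H_def)

lemma at_infinite:
  assumes "is_place \<iota> P" "P x < 0"
  shows "(K - inf (G s) (A s)) P = M - min s (M - s)" "Dinf P = 1"
    "P H = int (card powers) * int u - (int n - 1) * int v"
proof -
  interpret place_of_ext \<iota> P by unfold_locales fact
  note inf = infinite_place[OF assms]
  have xa: "P (x - \<iota> a) = - int u" for a
    using ev_pole[OF assms(2), of "[:- a, 1:]"] inf by simp
  have "D P = 0" using xa by (auto simp: D_def div_affine_rational_def)
  moreover have "K P = M" using assms inf by (simp add: K_def div_differential_def M_def)
  moreover show "Dinf P = 1" using assms by (simp add: Dinf_def div_infinity_def)
  ultimately show "(K - inf (G s) (A s)) P = M - min s (M - s)"
    by (simp add: A_def G_def div_scale_def inf_min)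
  show "P H = int (card powers) * int u - (int n - 1) * int v"
    unfolding P_H[OF assms(1)] xa inf by simp
qed

lemma at_finite:
  assumes "finite_place \<iota> q x y n f P p"
  shows "(K - inf (G s) (A s)) P = P H" "Dinf P = 0"
    "P H \<noteq> 0 \<Longrightarrow> ram.centered P \<or> (\<exists>a. rat.centered a P)"
proof -
  interpret finite_place \<iota> q x y n f P p by fact
  show Dinf: "Dinf P = 0" using x_nonneg by (auto simp: Dinf_def div_infinity_def ord_ge_def)
  have K: "K P = \<omega> P" using place by (simp add: K_def div_differential_def)
  have coeff_eq: "(K - inf (G s) (A s)) P = \<omega> P - min 0 (D P + \<omega> P)"
    by (simp add: A_def G_def div_scale_def inf_min Dinf K)
  consider (ram) "p dvd f" | (rat) a where "\<not> p dvd f" "p = [:- a, 1:]"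
    | (other) "\<not> p dvd f" "\<And>a. p \<noteq> [:- a, 1:]" by blast
  then have "(K - inf (G s) (A s)) P = P H \<and> (P H \<noteq> 0 \<longrightarrow> ram.centered P \<or> (\<exists>a. rat.centered a P))"
  proof cases
    case ram
    note r = ramified[OF ram]
    have "D P = 0" using r by (auto simp: D_def div_affine_rational_def)
    moreover have "P H = int n - 1" by (simp add: P_H[OF place] r)
    moreover have "ram.centered P" using r place x_nonneg by (simp add: ram.centered_def)
    ultimately show ?thesis unfolding coeff_eq r using n_pos by simp
  next
    case rat
    note r = rational_value[OF rat(2)]
    have "P (x - \<iota> b) = (if b = a then 1 else 0)" for b
      using r(1) P_x_minus[of b] rat(2) by auto
    then have PH: "P H = (if a \<in> powers then - 1 else 0)"
      by (simp add: P_H[OF place] r sum.delta)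
    have "\<exists>a. 0 < P (x - \<iota> a)" by (rule exI[of _ a]) (simp add: r)
    then have "D P = (if place_degree \<iota> P = 1 then 1 else 0)"
      using place by (simp add: D_def div_affine_rational_def)
    also have "place_degree \<iota> P = 1 \<longleftrightarrow> a \<in> powers"
      using rational_iff_power[OF r(4)] by (simp add: powers_def)
    finally have "D P = (if a \<in> powers then 1 else 0)" .
    then show ?thesis unfolding coeff_eq r using PH r by auto
  next
    case other
    note r = inert[OF other]
    have "D P = 0" using r by (auto simp: D_def div_affine_rational_def)
    then show ?thesis unfolding coeff_eq r P_H[OF place] by (simp add: r)
  qed
  then show "(K - inf (G s) (A s)) P = P H" "P H \<noteq> 0 \<Longrightarrow> ram.centered P \<or> (\<exists>a. rat.centered a P)"
    by blast+
qed

lemma at_no_place: "\<not> is_place \<iota> P \<Longrightarrow> (K - inf (G s) (A s)) P = 0 \<and> Dinf P = 0"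
  by (simp add: K_def D_def Dinf_def A_def G_def div_scale_def div_differential_def div_infinity_def
      div_affine_rational_def)

lemma difference_principal: "K - inf (G s) (A s) - div_scale (multiple s) Dinf = div_fun \<iota> H"
proof
  fix P
  consider "\<not> is_place \<iota> P" | "is_place \<iota> P" "P x < 0" | "is_place \<iota> P" "\<not> P x < 0" by blast
  then show "(K - inf (G s) (A s) - div_scale (multiple s) Dinf) P = div_fun \<iota> H P"
  proof cases
    case 1
    then show ?thesis using at_no_place[of P s] by (simp add: div_scale_def div_fun_def)
  next
    case 2
    then show ?thesis using at_infinite(1)[OF 2, of s] at_infinite(2,3)[OF 2]
      by (simp add: div_scale_def div_fun_def multiple_def)
  next
    case 3
    then obtain p where "finite_place \<iota> q x y n f P p" using finite_place_cases by blast
    then show ?thesis using 3 at_finite(1)[of P p s] at_finite(2)[of P p] by (simp add: div_scale_def div_fun_def)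
  qed
qed

lemma is_divisor_difference: "is_divisor \<iota> (K - inf (G s) (A s))"
  unfolding is_divisor_def
proof
  let ?B = "K - inf (G s) (A s)"
  show "\<forall>P. ?B P \<noteq> 0 \<longrightarrow> is_place \<iota> P" using at_no_place by blast
  have "{P. ?B P \<noteq> 0} \<subseteq> {P. inf.centered P} \<union> {P. ram.centered P} \<union> (\<Union>a. {P. rat.centered a P})"
  proof
    fix P assume "P \<in> {P. ?B P \<noteq> 0}"
    then have B: "?B P \<noteq> 0" by simp
    then have P: "is_place \<iota> P" using at_no_place by blast
    show "P \<in> {P. inf.centered P} \<union> {P. ram.centered P} \<union> (\<Union>a. {P. rat.centered a P})"
    proof (cases "P x < 0")
      case True
      then show ?thesis using P centered_iff by blast
    next
      case False
      then obtain p where "finite_place \<iota> q x y n f P p" using finite_place_cases P by blast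
      then show ?thesis using at_finite(1)[of P p s] at_finite(3)[of P p] B by auto
    qed
  qed
  then show "finite {P. ?B P \<noteq> 0}"
    by (rule finite_subset) (use inf.finite_centered ram.finite_centered rat.finite_centered in auto)
qed

lemma Dinf_support: "{P. Dinf P \<noteq> 0} = {P. is_place \<iota> P \<and> P x < 0}"
  by (auto simp: Dinf_def div_infinity_def)

lemma is_effective_multiple:
  assumes "m \<ge> 0"
  shows "is_effective \<iota> (div_scale m Dinf)"
proof -
  have "finite {P. Dinf P \<noteq> 0}"
    unfolding Dinf_support using inf.finite_centered by (simp add: centered_iff)
  then have "finite {P. div_scale m Dinf P \<noteq> 0}"
    by (rule finite_subset[rotated]) (auto simp: div_scale_def)
  then show ?thesis using assms
    by (auto simp: is_effective_def is_divisor_def div_scale_def Dinf_def div_infinity_def)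
qed

lemma divisor_degree_multiple: "divisor_degree \<iota> (div_scale m Dinf) = int c * m"
proof (cases "m = 0")
  case True
  then show ?thesis by (simp add: divisor_degree_def div_scale_def)
next
  case False
  then have "{P. div_scale m Dinf P \<noteq> 0} = {P. is_place \<iota> P \<and> P x < 0}"
    using Dinf_support by (auto simp: div_scale_def)
  then have "divisor_degree \<iota> (div_scale m Dinf) = (\<Sum>P | is_place \<iota> P \<and> P x < 0. m * int (place_degree \<iota> P))"
    by (simp add: divisor_degree_def div_scale_def Dinf_def div_infinity_def)
  also have "\<dots> = m * int (\<Sum>P | is_place \<iota> P \<and> P x < 0. place_degree \<iota> P)"
    by (simp add: sum_distrib_left)
  finally show ?thesis by (simp add: degree_at_infinity mult.commute)
qed

text \<open>
  \<open>G \<or> A + G \<and> A = G + A\<close> and \<open>A = D - G + K\<close>.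
\<close>

lemma sup_minus_D: "sup (G s) (A s) - D = K - inf (G s) (A s)"
proof
  fix P
  have "sup (G s P) (A s P) + inf (G s P) (A s P) = G s P + A s P" by (simp add: sup_max inf_min)
  then show "(sup (G s) (A s) - D) P = (K - inf (G s) (A s)) P"
    by (simp add: A_def algebra_simps)
qed

end

lemma superellipticI:
  fixes \<iota> :: "'k::{finite,field} \<Rightarrow> 'f::field"
  assumes "superelliptic_function_field \<iota> x y n f" "q = card (UNIV :: 'k set)" "n > 0" "n dvd q - 1"
    "degree f > 0" "coprime f (pderiv f)" "\<forall>a. poly f a \<noteq> 0"
  shows "superelliptic \<iota> q x y n f"
proof -
  interpret finite_field_ext \<iota> q
    using assms(1,2) by unfold_locales (simp_all add: superelliptic_function_field_def)
  show ?thesis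
  proof unfold_locales
    show "\<exists>p r. two.ev x r y \<noteq> 0 \<and> z = two.ev x p y / two.ev x r y" for z
      using assms(1) by (simp add: superelliptic_function_field_def poly2_at_eq)
  qed (use assms in \<open>auto simp: superelliptic_function_field_def poly_at_eq separable_def\<close>)
qed

theorem corollary6p2:
  fixes \<iota> :: "'k::{finite,field} \<Rightarrow> 'f::field"
    and x y :: 'f
    and f :: "'k poly"
    and n d q c \<delta> :: nat
    and s t :: int
    and Dinf D K G A :: "'f divisor"
  assumes "superelliptic_function_field \<iota> x y n f"
    and "q = card (UNIV :: 'k set)"
    and "n \<ge> 2"
    and "n dvd q - 1"
    and "degree f = d"
    and "d \<ge> 3"
    and "coprime f (pderiv f)"
    and "\<forall>a. poly f a \<noteq> 0"
    and "c = gcd n d"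
    and "\<delta> = non_power_count n f"
    and "Dinf = div_infinity \<iota> x"
    and "D = div_affine_rational \<iota> x"
    and "K = div_differential \<iota> (- 1 / (x ^ q - x)) x"
    and "G = div_scale s Dinf"
    and "A = D - G + K"
    and "t = superelliptic_t n d q \<delta> s"
    and "s \<ge> 1"
    and "t \<ge> 0"
  shows "int c dvd t
    \<and> is_divisor \<iota> (K - inf G A)
    \<and> is_effective \<iota> (div_scale (t div int c) Dinf)
    \<and> lin_equiv \<iota> (K - inf G A) (div_scale (t div int c) Dinf)
    \<and> divisor_class \<iota> (K - inf G A) \<in> generate (Pic \<iota>) {divisor_class \<iota> Dinf}
    \<and> divisor_class \<iota> (K - inf G A)
        = divisor_class \<iota> Dinf
            [^]\<^bsub>Pic \<iota>\<^esub> (superelliptic_t n d q \<delta> s div int (gcd n d))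
    \<and> (\<forall>e. excess \<iota> D G A = e \<longrightarrow>
         (\<exists>B. is_effective \<iota> B \<and> divisor_degree \<iota> B = t \<and> lin_equiv \<iota> (K - inf G A) B))
    \<and> (t = 0 \<longrightarrow> lin_equiv \<iota> (sup G A) D)"
proof -
  interpret S: superelliptic \<iota> q x y n f
    by (rule superellipticI) (use assms(1-8) in auto)
  define u where "u = n div c"
  define v where "v = d div c"
  have cpos: "c > 0" using assms(3,9) by simp
  have uv: "n = u * c" "d = v * c" using assms(9) by (simp_all add: u_def v_def)
  have "v \<noteq> 0" by (rule notI) (use uv(2) assms(6) in simp)
  have "gcd v u = 1"
    using assms(9) cpos div_gcd_coprime[of d n] by (simp add: u_def v_def gcd.commute)
  then obtain j i where bez: "v * j = u * i + 1"
    using bezout_nat[OF \<open>v \<noteq> 0\<close>, of u] by auto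
  interpret S: superelliptic_infinity \<iota> q x y n f u v c i j
    by unfold_locales (use uv assms(5) bez in \<open>simp_all add: mult.commute\<close>)
  let ?m = "S.multiple s"
  have defs: "Dinf = S.Dinf" "D = S.D" "K = S.K" "G = S.G s" "A = S.A s"
    using assms(11-15) by (simp_all add: S.Dinf_def S.D_def S.K_def S.G_def S.A_def)
  have t: "t = int c * ?m" using assms(5,10,16) S.t_eq by simp
  then have tc: "t div int c = ?m" using cpos by simp
  have m: "?m \<ge> 0" using t assms(18) cpos by (simp add: zero_le_mult_iff)
  have eff: "is_effective \<iota> (div_scale ?m Dinf)"
    unfolding defs by (rule S.is_effective_multiple[OF m])
  have equiv: "lin_equiv \<iota> (K - inf G A) (div_scale ?m Dinf)"
    unfolding defs lin_equiv_def using S.difference_principal S.H_nonzero by blast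
  have cls: "divisor_class \<iota> (K - inf G A) = divisor_class \<iota> Dinf [^]\<^bsub>Pic \<iota>\<^esub> nat ?m"
    using S.lin_equiv_imp_class_eq[OF equiv] S.divisor_class_power[of Dinf "nat ?m"] m by simp
  have "lin_equiv \<iota> (sup G A) D" if "t = 0"
  proof -
    have "div_scale ?m Dinf = 0" using t that cpos by (simp add: div_scale_def fun_eq_iff)
    then show ?thesis
      unfolding lin_equiv_def defs S.sup_minus_D
      using S.difference_principal[of s] S.H_nonzero by (metis defs(1) diff_zero)
  qed
  moreover have "superelliptic_t n d q \<delta> s div int (gcd n d) = ?m" using tc assms(9,16) by simp
  moreover have "divisor_class \<iota> Dinf [^]\<^bsub>Pic \<iota>\<^esub> nat ?m = divisor_class \<iota> Dinf [^]\<^bsub>Pic \<iota>\<^esub> ?m"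
    by (rule pow_nat[OF m])
  moreover have "divisor_degree \<iota> (div_scale ?m Dinf) = t"
    unfolding defs t by (rule S.divisor_degree_multiple)
  moreover have "is_divisor \<iota> (K - inf G A)" unfolding defs by (rule S.is_divisor_difference)
  moreover have "divisor_class \<iota> (K - inf G A) \<in> generate (Pic \<iota>) {divisor_class \<iota> Dinf}"
    unfolding cls by (rule S.power_in_generate)
  ultimately show ?thesis using eff equiv cls t tc by auto
qed

end
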